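(* Let $y_0\in\mathbb H^1$ with $|y_0(x)|=1$ for all $x\in\mathcal O$, let $\zeta\in\{\zeta_+,\zeta_-\}$, and assume $$|y_0-\zeta|_{\mathbb H^1}<\frac{1}{2k^2\sqrt{|\mathcal O|}}\,\frac{\alpha}{1+2\alpha}.$$ Let $y$ be the solution of $$\frac{\partial y}{\partial t}=y\times\Delta y-\alpha y\times(y\times\Delta y)-\beta G(y)f(y),\qquad y(0)=y_0,$$ (i.e. the applied field is zero). Then $y(t)$ converges to $\zeta$ in $\mathbb H^1$ as $t\to\infty$.
   Context: $\mathcal O\subset\mathbb R$ is a bounded interval of length $|\mathcal O|$; $\mathbb H^k=W^{k,2}(\mathcal O;\mathbb R^3)$, $|u|_{\mathbb H^1}^2=|u|_{L^2}^2+|Du|_{L^2}^2$; $\Delta=d^2/dx^2$; $\times$ is the vector product in $\mathbb R^3$; $\alpha>0$, $\beta>0$. $G(y)h=y\times h-\alpha y\times(y\times h)$ and $f(y)=(0,y_2,y_3)$ for $y=(y_1,y_2,y_3)\in\mathbb R^3$. $\zeta_+=(1,0,0)$, $\zeta_-=(-1,0,0)$, also regarded as constant functions on $\mathcal O$. $k=2\max(1,1/\sqrt{|\mathcal O|})$. The solution $y$ is the unique function on $[0,\infty)$ with $y\in C([0,T];\mathbb H^1)\cap L^2(0,T;D(A))$ and $\partial_t y\in L^2(0,T;L^2(\mathcal O;\mathbb R^3))$ for all $T>0$, $|y(t)(x)|=1$, where $D(A)=\{u\in\mathbb H^2: u'=0\text{ on }\partial\mathcal O\}$ (Neumann boundary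 conditions). *)

theory Defs
  imports "HOL-Analysis.Analysis"
begin

section \<open>Sobolev spaces on an open subset of the real line\<close>

text \<open>
  Elements of Lebesgue and Sobolev spaces are represented by functions on \<^typ>\<open>real\<close>, of which only
  the values on \<open>\<Omega>\<close> matter, and these only up to a null set.  No quotient is formed: all the
  notions below are invariant under a change of the representative.
\<close>

definition L2 :: "real set \<Rightarrow> (real \<Rightarrow> real^3) set" where
  "L2 \<Omega> = {u. u \<in> borel_measurable (lebesgue_on \<Omega>) \<and>
              integrable (lebesgue_on \<Omega>) (\<lambda>x. (norm (u x))\<^sup>2)}"

definition L2_norm :: "real set \<Rightarrow> (real \<Rightarrow> real^3) \<Rightarrow> real" where
  "L2_norm \<Omega> u = sqrt (LINT x|lebesgue_on \<Omega>. (norm (u x))\<^sup>2)"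

definition test_functions :: "real set \<Rightarrow> (real \<Rightarrow> real) set" where
  "test_functions \<Omega> = {\<phi>. (\<forall>n x. (deriv ^^ n) \<phi> field_differentiable (at x)) \<and>
     compact (closure {x. \<phi> x \<noteq> 0}) \<and> closure {x. \<phi> x \<noteq> 0} \<subseteq> \<Omega>}"

definition weak_deriv :: "real set \<Rightarrow> (real \<Rightarrow> real^3) \<Rightarrow> (real \<Rightarrow> real^3) \<Rightarrow> bool" where
  "weak_deriv \<Omega> u v \<longleftrightarrow> (\<forall>\<phi>\<in>test_functions \<Omega>.
     (LINT x|lebesgue_on \<Omega>. deriv \<phi> x *\<^sub>R u x) = - (LINT x|lebesgue_on \<Omega>. \<phi> x *\<^sub>R v x))"

definition H1 :: "real set \<Rightarrow> (real \<Rightarrow> real^3) set" where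
  "H1 \<Omega> = {u \<in> L2 \<Omega>. \<exists>v\<in>L2 \<Omega>. weak_deriv \<Omega> u v}"

definition H2 :: "real set \<Rightarrow> (real \<Rightarrow> real^3) set" where
  "H2 \<Omega> = {u \<in> L2 \<Omega>. \<exists>v\<in>H1 \<Omega>. weak_deriv \<Omega> u v}"

text \<open>The weak derivative as a function; it is determined up to a null set of \<open>\<Omega>\<close>.\<close>

definition D :: "real set \<Rightarrow> (real \<Rightarrow> real^3) \<Rightarrow> real \<Rightarrow> real^3" where
  "D \<Omega> u = (SOME v. v \<in> L2 \<Omega> \<and> weak_deriv \<Omega> u v)"

abbreviation Laplacian :: "real set \<Rightarrow> (real \<Rightarrow> real^3) \<Rightarrow> real \<Rightarrow> real^3" where
  "Laplacian \<Omega> u \<equiv> D \<Omega> (D \<Omega> u)"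

definition H1_norm :: "real set \<Rightarrow> (real \<Rightarrow> real^3) \<Rightarrow> real" where
  "H1_norm \<Omega> u = sqrt ((L2_norm \<Omega> u)\<^sup>2 + (L2_norm \<Omega> (D \<Omega> u))\<^sup>2)"

definition H2_norm :: "real set \<Rightarrow> (real \<Rightarrow> real^3) \<Rightarrow> real" where
  "H2_norm \<Omega> u = sqrt ((L2_norm \<Omega> u)\<^sup>2 + (L2_norm \<Omega> (D \<Omega> u))\<^sup>2 + (L2_norm \<Omega> (Laplacian \<Omega> u))\<^sup>2)"

text \<open>
  The domain \<open>D(A)\<close> of the Neumann Laplacian.  For \<open>u\<close> in \<open>H2 \<Omega>\<close> the weak derivative has a
  representative that is continuous up to the boundary, and the boundary condition refers to the
  values of that representative.
\<close>

definition neumann_domain :: "real set \<Rightarrow> (real \<Rightarrow> real^3) set" where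
  "neumann_domain \<Omega> = {u \<in> H2 \<Omega>. \<exists>v. continuous_on (closure \<Omega>) v \<and> weak_deriv \<Omega> u v \<and>
     (\<forall>x\<in>frontier \<Omega>. v x = 0)}"


section \<open>Functions of time with values in a space of functions\<close>

text \<open>In the next three definitions \<open>X\<close> is the function space and \<open>N\<close> its norm.\<close>

definition cont_into ::
  "(real \<Rightarrow> real^3) set \<Rightarrow> ((real \<Rightarrow> real^3) \<Rightarrow> real) \<Rightarrow> real set \<Rightarrow> (real \<Rightarrow> real \<Rightarrow> real^3) \<Rightarrow> bool" where
  "cont_into X N I u \<longleftrightarrow> (\<forall>t\<in>I. u t \<in> X \<and>
     ((\<lambda>s. N (\<lambda>x. u s x - u t x)) \<longlongrightarrow> 0) (at t within I))"

definition simple_approx ::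
  "(real \<Rightarrow> real^3) set \<Rightarrow> ((real \<Rightarrow> real^3) \<Rightarrow> real) \<Rightarrow> real set \<Rightarrow>
     (nat \<Rightarrow> real \<Rightarrow> real \<Rightarrow> real^3) \<Rightarrow> (real \<Rightarrow> real \<Rightarrow> real^3) \<Rightarrow> bool" where
  "simple_approx X N I s u \<longleftrightarrow>
     (\<forall>n. simple_function (lebesgue_on I) (s n) \<and> s n ` I \<subseteq> X) \<and>
     (AE t in lebesgue_on I. u t \<in> X \<and> (\<lambda>n. N (\<lambda>x. s n t x - u t x)) \<longlonglongrightarrow> 0)"

text \<open>
  The Bochner space \<open>L\<^sup>2(I; X)\<close>: strongly measurable functions whose norm is square integrable.
\<close>

definition bochner_L2 ::
  "(real \<Rightarrow> real^3) set \<Rightarrow> ((real \<Rightarrow> real^3) \<Rightarrow> real) \<Rightarrow> real set \<Rightarrow> (real \<Rightarrow> real \<Rightarrow> real^3) set" where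
  "bochner_L2 X N I = {u. (\<exists>s. simple_approx X N I s u) \<and>
     integrable (lebesgue_on I) (\<lambda>t. (N (u t))\<^sup>2)}"

text \<open>
  \<open>w\<close> is the Bochner integral over the bounded interval \<open>I\<close> of the \<open>L2 \<Omega>\<close>-valued function \<open>u\<close>.
  The integral of the simple function \<open>s n\<close> is a finite linear combination of its values, so it may
  be computed pointwise in \<open>x\<close>.
\<close>

definition has_L2_bochner_integral ::
  "real set \<Rightarrow> real set \<Rightarrow> (real \<Rightarrow> real \<Rightarrow> real^3) \<Rightarrow> (real \<Rightarrow> real^3) \<Rightarrow> bool" where
  "has_L2_bochner_integral \<Omega> I u w \<longleftrightarrow> w \<in> L2 \<Omega> \<and>
     (\<exists>s. simple_approx (L2 \<Omega>) (L2_norm \<Omega>) I s u \<and>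
        (\<lambda>n. \<integral>\<^sup>+t. ennreal (L2_norm \<Omega> (\<lambda>x. s n t x - u t x)) \<partial>lebesgue_on I) \<longlonglongrightarrow> 0 \<and>
        (\<lambda>n. L2_norm \<Omega> (\<lambda>x. (LINT t|lebesgue_on I. s n t x) - w x)) \<longlonglongrightarrow> 0)"

text \<open>
  \<open>z\<close> is the weak time derivative of \<open>u\<close> on \<open>I\<close>, as \<open>L2 \<Omega>\<close>-valued functions:
  \<open>\<integral> \<phi>'(t) u(t) dt = - \<integral> \<phi>(t) z(t) dt\<close>.
\<close>

definition weak_time_deriv ::
  "real set \<Rightarrow> real set \<Rightarrow> (real \<Rightarrow> real \<Rightarrow> real^3) \<Rightarrow> (real \<Rightarrow> real \<Rightarrow> real^3) \<Rightarrow> bool" where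
  "weak_time_deriv \<Omega> I u z \<longleftrightarrow> (\<forall>\<phi>\<in>test_functions I. \<exists>w.
     has_L2_bochner_integral \<Omega> I (\<lambda>t x. deriv \<phi> t *\<^sub>R u t x) w \<and>
     has_L2_bochner_integral \<Omega> I (\<lambda>t x. - (\<phi> t *\<^sub>R z t x)) w)"


section \<open>The Landau-Lifshitz-Gilbert equation without applied field\<close>

definition G :: "real \<Rightarrow> real^3 \<Rightarrow> real^3 \<Rightarrow> real^3" where
  "G \<alpha> y h = cross3 y h - \<alpha> *\<^sub>R cross3 y (cross3 y h)"

definition f :: "real^3 \<Rightarrow> real^3" where
  "f y = vector [0, y $ 2, y $ 3]"

definition zeta_plus :: "real^3" where
  "zeta_plus = vector [1, 0, 0]"

definition zeta_minus :: "real^3" where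
  "zeta_minus = vector [-1, 0, 0]"

definition LLG_solution ::
  "real set \<Rightarrow> real \<Rightarrow> real \<Rightarrow> (real \<Rightarrow> real^3) \<Rightarrow> (real \<Rightarrow> real \<Rightarrow> real^3) \<Rightarrow> bool" where
  "LLG_solution \<Omega> \<alpha> \<beta> y\<^sub>0 y \<longleftrightarrow>
     (\<forall>T>0. cont_into (H1 \<Omega>) (H1_norm \<Omega>) {0..T} y \<and>
        y \<in> bochner_L2 (neumann_domain \<Omega>) (H2_norm \<Omega>) {0<..<T} \<and>
        (\<exists>z\<in>bochner_L2 (L2 \<Omega>) (L2_norm \<Omega>) {0<..<T}.
           weak_time_deriv \<Omega> {0<..<T} y z \<and>
           (AE t in lebesgue_on {0<..<T}. AE x in lebesgue_on \<Omega>.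
              z t x = cross3 (y t x) (Laplacian \<Omega> (y t) x)
                - \<alpha> *\<^sub>R cross3 (y t x) (cross3 (y t x) (Laplacian \<Omega> (y t) x))
                - \<beta> *\<^sub>R G \<alpha> (y t x) (f (y t x))))) \<and>
     (\<forall>t\<ge>0. AE x in lebesgue_on \<Omega>. norm (y t x) = 1) \<and>
     (AE x in lebesgue_on \<Omega>. y 0 x = y\<^sub>0 x)"

end

theory Submission
  imports Defs
begin

text \<open>
  Write \<open>\<Delta> y\<close> for the Laplacian and \<open>f y\<close> for the component of \<open>y\<close> orthogonal to the axis, and let \<open>y\<close> be close
  to \<open>\<zeta>\<close> in \<open>H1\<close> and hence uniformly.  Two quantities are monotone along the flow.

  The first is the Dirichlet energy.  The derivative of half of it is \<open>- \<integral> \<Delta> y \<bullet> \<partial>\<^sub>t y\<close>.  Here the precession drops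
  out, the damping contributes \<open>- \<alpha> \<integral> (norm (y \<times> \<Delta> y))\<^sup>2\<close>, and the anisotropy contributes, after an integration by
  parts, \<open>- \<beta>\<close> times the integral of a quadratic form in \<open>D y\<close>.  Since \<open>y \<bullet> D y = 0\<close>, the vector \<open>D y\<close> is nearly
  orthogonal to the axis, and the quadratic form is close to \<open>\<alpha> (norm (f (D y)))\<^sup>2\<close>; it is nonnegative if
  \<open>y\<close> deviates from \<open>\<zeta>\<close> by little in comparison with \<open>1\<close> and \<open>\<alpha>\<close> (\<open>unit_tangent_estimate\<close>).

  The second is \<open>q = \<integral> y \<bullet> \<zeta>\<close>.  Testing the equation with the constant \<open>\<zeta>\<close> gives
  \<open>q' = \<alpha> \<integral> (y \<bullet> \<zeta>) (norm (D y))\<^sup>2 + \<alpha> \<beta> \<integral> (y \<bullet> \<zeta>) (norm (f y))\<^sup>2\<close>, which is at least \<open>c N\<^sup>2\<close> for a positive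
  constant \<open>c\<close>, where \<open>N\<close> is the distance of \<open>y\<close> from \<open>\<zeta>\<close> in \<open>H1\<close> (\<open>dissipation\<close>).

  Because \<open>norm y = 1\<close>, the square \<open>N\<^sup>2\<close> is the Dirichlet energy plus \<open>2 ((b - a) - q)\<close>.  So \<open>N\<close> does not increase as long as it
  is small, and a continuity argument shows that it stays small (\<open>stays_below_threshold\<close>).  Now
  \<open>c t (N t)\<^sup>2 \<le> c \<integral>\<^sub>0\<^sup>t N\<^sup>2 \<le> q t - q 0 \<le> 2 (b - a)\<close>, whence \<open>N t\<close> tends to \<open>0\<close>.

  The work lies in justifying the two derivatives for a solution that is merely strong.  In space, functions with a weak
  derivative are primitives by the lemma of du Bois-Reymond, so that members of the domain of the Neumann
  Laplacian have continuously differentiable representatives (\<open>neumann_domain_rep\<close>).  In time, the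
  equation is tested with fixed functions of \<open>x\<close>, which turns it into statements about absolutely continuous real
  functions (\<open>weak_time_deriv_inner_primitive\<close>).  For \<open>q\<close> this is enough.  The Dirichlet energy is expanded into cosines,
  the eigenfunctions of the Neumann Laplacian; the energy identity holds for the partial sums and
  passes to the limit by Parseval's identity and dominated convergence (\<open>Dirichlet_energy_antimono\<close>).
\<close>

section \<open>Smooth functions and test functions\<close>

definition smooth :: "(real \<Rightarrow> real) \<Rightarrow> bool" where
  "smooth \<phi> \<longleftrightarrow> (\<forall>n x. (deriv ^^ n) \<phi> field_differentiable (at x))"

text \<open>
  Smoothness is a greatest fixed point: a function is smooth as soon as it lies in some class that is
  closed under differentiation.  Every closure property below names such a class, which avoids
  formulas for higher derivatives.
\<close>

lemma smooth_coinduct: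
  assumes "\<phi> \<in> S"
    and "\<And>\<psi>. \<psi> \<in> S \<Longrightarrow> \<exists>\<psi>'\<in>S. \<forall>x. (\<psi> has_real_derivative \<psi>' x) (at x)"
  shows "smooth \<phi>"
proof -
  have D: "deriv \<psi> \<in> S \<and> (\<forall>x. \<psi> field_differentiable (at x))" if \<psi>: "\<psi> \<in> S" for \<psi>
  proof -
    obtain \<psi>' where \<psi>': "\<psi>' \<in> S" "\<And>x. (\<psi> has_real_derivative \<psi>' x) (at x)"
      using assms(2)[OF \<psi>] by auto
    have "deriv \<psi> = \<psi>'" using \<psi>'(2) by (auto intro!: DERIV_imp_deriv)
    with \<psi>' show ?thesis by (auto simp: field_differentiable_def)
  qed
  have "(deriv ^^ n) \<phi> \<in> S" for n
    by (induction n) (use assms(1) D in auto)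
  with D show ?thesis by (auto simp: smooth_def)
qed

lemma smooth_has_derivative:
  assumes "smooth \<phi>"
  shows "(\<phi> has_real_derivative deriv \<phi> x) (at x)"
proof -
  have "(deriv ^^ 0) \<phi> field_differentiable (at x)"
    using assms unfolding smooth_def by blast
  then show ?thesis by (simp add: DERIV_deriv_iff_field_differentiable)
qed

lemma smooth_deriv: "smooth \<phi> \<Longrightarrow> smooth (deriv \<phi>)"
  unfolding smooth_def by (metis funpow_Suc_right o_apply)

lemma smooth_continuous: "smooth \<phi> \<Longrightarrow> continuous_on S \<phi>"
  by (meson DERIV_continuous_on has_field_derivative_at_within smooth_has_derivative)

lemma smooth_primitive:
  assumes "\<And>x. (\<Phi> has_real_derivative \<phi> x) (at x)" "smooth \<phi>"
  shows "smooth \<Phi>"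
proof (rule smooth_coinduct)
  show "\<Phi> \<in> insert \<Phi> (Collect smooth)" by simp
  fix \<psi> assume "\<psi> \<in> insert \<Phi> (Collect smooth)"
  then show "\<exists>\<psi>'\<in>insert \<Phi> (Collect smooth). \<forall>x. (\<psi> has_real_derivative \<psi>' x) (at x)"
    using assms smooth_has_derivative smooth_deriv by (metis insertE insertI2 mem_Collect_eq)
qed

lemma smooth_diff_scaled:
  assumes "smooth \<phi>" "smooth \<psi>"
  shows "smooth (\<lambda>x. \<phi> x - c * \<psi> x)"
proof (rule smooth_coinduct[where S = "{(\<lambda>x. \<phi> x - c * \<psi> x) |\<phi> \<psi>. smooth \<phi> \<and> smooth \<psi>}"])
  fix g assume "g \<in> {(\<lambda>x. \<phi> x - c * \<psi> x) |\<phi> \<psi>. smooth \<phi> \<and> smooth \<psi>}"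
  then obtain \<phi> \<psi> where *: "g = (\<lambda>x. \<phi> x - c * \<psi> x)" "smooth \<phi>" "smooth \<psi>" by auto
  then have "\<forall>x. (g has_real_derivative deriv \<phi> x - c * deriv \<psi> x) (at x)"
    by (auto intro!: derivative_eq_intros smooth_has_derivative)
  moreover have "(\<lambda>x. deriv \<phi> x - c * deriv \<psi> x) \<in> {(\<lambda>x. \<phi> x - c * \<psi> x) |\<phi> \<psi>. smooth \<phi> \<and> smooth \<psi>}"
    using * smooth_deriv by blast
  ultimately show "\<exists>\<psi>'\<in>{(\<lambda>x. \<phi> x - c * \<psi> x) |\<phi> \<psi>. smooth \<phi> \<and> smooth \<psi>}. \<forall>x. (g has_real_derivative \<psi>' x) (at x)"
    by (rule bexI)
qed (use assms in auto)

lemma smooth_affine: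
  assumes "smooth \<phi>"
  shows "smooth (\<lambda>x. \<phi> (c * x + d))"
proof (rule smooth_coinduct[where S = "{(\<lambda>x. k * \<phi> (c * x + d)) |\<phi> k. smooth \<phi>}"])
  show "(\<lambda>x. \<phi> (c * x + d)) \<in> {(\<lambda>x. k * \<phi> (c * x + d)) |\<phi> k. smooth \<phi>}"
    using assms by (auto intro!: exI[of _ \<phi>] exI[of _ 1])
  fix g assume "g \<in> {(\<lambda>x. k * \<phi> (c * x + d)) |\<phi> k. smooth \<phi>}"
  then obtain \<phi> k where *: "g = (\<lambda>x. k * \<phi> (c * x + d))" "smooth \<phi>" by auto
  have "\<forall>x. (g has_real_derivative (k * c) * deriv \<phi> (c * x + d)) (at x)"
    unfolding * by (auto intro!: derivative_eq_intros DERIV_chain2[OF smooth_has_derivative[OF *(2)]])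
  moreover have "(\<lambda>x. (k * c) * deriv \<phi> (c * x + d)) \<in> {(\<lambda>x. k * \<phi> (c * x + d)) |\<phi> k. smooth \<phi>}"
    using * smooth_deriv by blast
  ultimately show "\<exists>\<psi>'\<in>{(\<lambda>x. k * \<phi> (c * x + d)) |\<phi> k. smooth \<phi>}. \<forall>x. (g has_real_derivative \<psi>' x) (at x)"
    by (rule bexI)
qed

text \<open>
  The Leibniz rule does not stay within the single products, but it stays within their finite sums.
\<close>

inductive_set smooth_products :: "(real \<Rightarrow> real) set" where
  prod: "smooth \<phi> \<Longrightarrow> smooth \<psi> \<Longrightarrow> (\<lambda>x. \<phi> x * \<psi> x) \<in> smooth_products"
| add: "\<phi> \<in> smooth_products \<Longrightarrow> \<psi> \<in> smooth_products \<Longrightarrow> (\<lambda>x. \<phi> x + \<psi> x) \<in> smooth_products"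

lemma smooth_mult:
  assumes "smooth \<phi>" "smooth \<psi>"
  shows "smooth (\<lambda>x. \<phi> x * \<psi> x)"
proof (rule smooth_coinduct)
  show "(\<lambda>x. \<phi> x * \<psi> x) \<in> smooth_products" using assms by (rule smooth_products.prod)
  fix g assume "g \<in> smooth_products"
  then show "\<exists>\<psi>'\<in>smooth_products. \<forall>x. (g has_real_derivative \<psi>' x) (at x)"
  proof induction
    case (prod \<phi> \<psi>)
    let ?d = "\<lambda>x. deriv \<phi> x * \<psi> x + deriv \<psi> x * \<phi> x"
    have "?d \<in> smooth_products" using prod
      by (intro smooth_products.intros smooth_deriv)
    moreover have "\<forall>x. ((\<lambda>x. \<phi> x * \<psi> x) has_real_derivative ?d x) (at x)"
      using prod by (auto intro!: DERIV_mult smooth_has_derivative)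
    ultimately show ?case by (intro bexI[of _ ?d])
  next
    case (add \<phi> \<psi>)
    then obtain \<phi>' \<psi>' where "\<phi>' \<in> smooth_products" "\<psi>' \<in> smooth_products"
      "\<forall>x. (\<phi> has_real_derivative \<phi>' x) (at x)" "\<forall>x. (\<psi> has_real_derivative \<psi>' x) (at x)"
      by auto
    then show ?case
      by (intro bexI[of _ "\<lambda>x. \<phi>' x + \<psi>' x"] allI DERIV_add smooth_products.add) auto
  qed
qed

text \<open>
  The classical smooth function that is not analytic at \<open>0\<close>.  The polynomial factor in \<open>1 / x\<close> is there
  because differentiation of \<open>exp (- 1 / x)\<close> produces such factors and nothing else.
\<close>

definition flat :: "real poly \<Rightarrow> real \<Rightarrow> real" where
  "flat p x = (if x > 0 then poly p (1 / x) * exp (- (1 / x)) else 0)"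

lemma poly_times_exp_tendsto_0: "((\<lambda>y. poly p y * exp (- y)) \<longlongrightarrow> (0::real)) at_top"
proof -
  have "((\<lambda>y. \<Sum>i\<le>degree p. coeff p i * (y ^ i / exp y)) \<longlongrightarrow> (\<Sum>i\<le>degree p. coeff p i * 0)) at_top"
    by (intro tendsto_intros tendsto_power_div_exp_0)
  then show ?thesis
    by (simp add: poly_altdef exp_minus divide_inverse sum_distrib_right mult.assoc)
qed

lemma flat_tendsto_0: "(flat p \<longlongrightarrow> 0) (at 0)"
proof -
  have "((\<lambda>x. poly p (1 / x) * exp (- (1 / x))) \<longlongrightarrow> 0) (at_right (0::real))"
  proof (rule filterlim_compose[OF poly_times_exp_tendsto_0])
    show "filterlim (\<lambda>x::real. 1 / x) at_top (at_right 0)"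
      using filterlim_inverse_at_top_right by (simp add: inverse_eq_divide)
  qed
  then have "(flat p \<longlongrightarrow> 0) (at_right 0)"
    by (rule Lim_transform_eventually) (auto simp: eventually_at_right_less flat_def eventually_at_filter)
  moreover have "(flat p \<longlongrightarrow> 0) (at_left 0)"
    by (rule tendsto_eventually) (auto simp: eventually_at_filter flat_def)
  ultimately show ?thesis by (simp add: filterlim_at_split)
qed

text \<open>
  For \<open>x > 0\<close> this is the chain rule.  At \<open>0\<close> the difference quotient is again a flat function, whose
  limit is \<open>0\<close> since the exponential beats every power.
\<close>

lemma flat_has_derivative:
  "(flat p has_real_derivative flat ([:0, 0, 1:] * (p - pderiv p)) x) (at x)"
proof -
  consider "x > 0" | "x < 0" | "x = 0" by linarith
  then show ?thesis
  proof cases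
    case 1
    have "((\<lambda>x. poly p (1 / x) * exp (- (1 / x))) has_real_derivative
        flat ([:0, 0, 1:] * (p - pderiv p)) x) (at x)"
      using 1 by (auto intro!: derivative_eq_intros DERIV_chain2[OF poly_DERIV]
          simp: flat_def field_simps power2_eq_square)
    then show ?thesis
      by (rule has_field_derivative_transform_within_open[where S = "{0<..}"]) (use 1 in \<open>auto simp: flat_def\<close>)
  next
    case 2
    have "((\<lambda>x. 0) has_real_derivative flat ([:0, 0, 1:] * (p - pderiv p)) x) (at x)"
      using 2 by (auto simp: flat_def)
    then show ?thesis
      by (rule has_field_derivative_transform_within_open[where S = "{..<0}"]) (use 2 in \<open>auto simp: flat_def\<close>)
  next
    case 3
    have "((\<lambda>h. (flat p (0 + h) - flat p 0) / h) \<longlongrightarrow> 0) (at 0)"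
      by (rule Lim_transform_eventually[OF flat_tendsto_0[of "[:0, 1:] * p"]])
        (auto simp: flat_def eventually_at_filter)
    then show ?thesis
      using 3 by (simp add: DERIV_def flat_def)
  qed
qed

lemma smooth_flat: "smooth (flat p)"
proof (rule smooth_coinduct[where S = "range flat"])
  fix \<psi> assume "\<psi> \<in> range flat"
  then obtain p where "\<psi> = flat p" by auto
  then show "\<exists>\<psi>'\<in>range flat. \<forall>x. (\<psi> has_real_derivative \<psi>' x) (at x)"
    using flat_has_derivative[of p] by auto
qed simp

text \<open>
  Smooth approximations from below of the indicator of the open interval from \<open>p\<close> to \<open>q\<close>: the factor \<open>Suc n\<close>
  pushes both arguments of the flat exponential to infinity inside the interval.
\<close>

definition bump :: "real \<Rightarrow> real \<Rightarrow> nat \<Rightarrow> real \<Rightarrow> real" where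
  "bump p q n x = flat 1 (real (Suc n) * (x - p)) * flat 1 (real (Suc n) * (q - x))"

lemma bump_smooth: "smooth (bump p q n)"
proof -
  have "smooth (\<lambda>x. flat 1 (real (Suc n) * x + - (real (Suc n) * p)) * flat 1 (- real (Suc n) * x + real (Suc n) * q))"
    by (intro smooth_mult smooth_affine smooth_flat)
  then show ?thesis unfolding bump_def[abs_def] by (simp add: algebra_simps)
qed

lemma bump_eq_0: "x \<notin> {p<..<q} \<Longrightarrow> bump p q n x = 0"
  by (auto simp: bump_def flat_def zero_less_mult_iff)

lemma bump_pos: "x \<in> {p<..<q} \<Longrightarrow> bump p q n x > 0"
  by (auto simp: bump_def flat_def zero_less_mult_iff)

lemma bump_bounds: "0 \<le> bump p q n x" "bump p q n x \<le> 1"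
proof -
  have "0 \<le> flat 1 x \<and> flat 1 x \<le> 1" for x by (auto simp: flat_def)
  then show "0 \<le> bump p q n x" "bump p q n x \<le> 1"
    unfolding bump_def by (auto intro!: mult_nonneg_nonneg mult_le_one)
qed

lemma bump_tendsto: "(\<lambda>n. bump p q n x) \<longlonglongrightarrow> indicator {p<..<q} x"
proof (cases "x \<in> {p<..<q}")
  case True
  have lim: "(\<lambda>n. flat 1 (real (Suc n) * r)) \<longlonglongrightarrow> 1" if "r > 0" for r
  proof -
    have "(\<lambda>n. exp (- (inverse (real (Suc n)) / r))) \<longlonglongrightarrow> exp (- (0 / r))"
      using that by (intro tendsto_intros LIMSEQ_inverse_real_of_nat) auto
    then show ?thesis using that
      by (simp add: flat_def zero_less_mult_iff inverse_eq_divide divide_divide_eq_left)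
  qed
  have "(\<lambda>n. bump p q n x) \<longlonglongrightarrow> 1 * 1"
    unfolding bump_def by (intro tendsto_mult lim) (use True in auto)
  then show ?thesis using True by simp
next
  case False
  then show ?thesis by (simp add: bump_eq_0)
qed

lemma test_functionsI:
  assumes "smooth \<phi>" "\<And>x. x \<notin> {p..q} \<Longrightarrow> \<phi> x = 0" "{p..q} \<subseteq> \<Omega>"
  shows "\<phi> \<in> test_functions \<Omega>"
proof -
  have sub: "closure {x. \<phi> x \<noteq> 0} \<subseteq> {p..q}"
    by (rule closure_minimal) (use assms(2) in \<open>blast, simp\<close>)
  then have "compact (closure {x. \<phi> x \<noteq> 0})"
    by (meson bounded_closed_interval bounded_subset closed_closure compact_eq_bounded_closed)
  with sub assms show ?thesis by (auto simp: test_functions_def smooth_def)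
qed

lemma test_function_smooth: "\<phi> \<in> test_functions \<Omega> \<Longrightarrow> smooth \<phi>"
  by (auto simp: test_functions_def smooth_def)

lemma test_function_eq_0: "\<phi> \<in> test_functions \<Omega> \<Longrightarrow> x \<notin> \<Omega> \<Longrightarrow> \<phi> x = 0"
  using closure_subset[of "{x. \<phi> x \<noteq> 0}"] by (auto simp: test_functions_def)

section \<open>The lemma of du Bois-Reymond\<close>

lemma integrable_Ioo_iff:
  fixes f :: "real \<Rightarrow> 'a::euclidean_space"
  shows "integrable (lebesgue_on {a<..<b}) f \<longleftrightarrow> f absolutely_integrable_on {a..b}"
  using absolutely_integrable_on_Icc_iff_Ioo[of a b f]
  by (simp add: integrable_restrict_space set_integrable_def)

lemma LINT_Ioo:
  fixes f :: "real \<Rightarrow> 'a::euclidean_space"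
  assumes "integrable (lebesgue_on {a<..<b}) f"
  shows "(LINT x|lebesgue_on {a<..<b}. f x) = integral {a..b} f"
  using lebesgue_integral_eq_integral[OF assms] by (simp add: integral_open_interval_real)

lemma finite_measure_Ioo: "finite_measure (lebesgue_on {a<..<b::real})"
  by (rule finite_measure_lebesgue_on) simp

lemma integrable_Ioo_continuous:
  fixes f :: "real \<Rightarrow> 'a::euclidean_space"
  assumes "continuous_on {a..b} f"
  shows "integrable (lebesgue_on {a<..<b}) f"
  by (simp add: integrable_Ioo_iff absolutely_integrable_continuous_real assms)

lemma integrable_Ioo_subset:
  fixes f :: "real \<Rightarrow> 'a::euclidean_space"
  assumes "integrable (lebesgue_on {a<..<b}) f" "a \<le> p" "q \<le> b"
  shows "integrable (lebesgue_on {p<..<q}) f"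
  using assms by (auto simp: integrable_Ioo_iff intro: absolutely_integrable_on_subinterval)

text \<open>
  By Lebesgue differentiation the averages over short intervals to the right of \<open>x\<close> converge to the value at
  almost every \<open>x\<close>.
\<close>

lemma AE_eq_0_if_interval_integrals_0:
  fixes h :: "real \<Rightarrow> real"
  assumes h: "integrable (lebesgue_on {a<..<b}) h"
    and 0: "\<And>p q. a < p \<Longrightarrow> p < q \<Longrightarrow> q < b \<Longrightarrow> integral {p..q} h = 0"
  shows "AE x in lebesgue_on {a<..<b}. h x = 0"
proof -
  \<comment> \<open>the extension by \<open>0\<close> is integrable over every interval, as differentiation requires\<close>
  define k where "k x = (if x \<in> {a<..<b} then h x else 0)" for x
  have "k absolutely_integrable_on UNIV"
    unfolding k_def absolutely_integrable_restrict_UNIV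
    using h by (simp add: integrable_Ioo_iff absolutely_integrable_on_Icc_iff_Ioo)
  then have "k integrable_on cbox p q" for p q
    using integrable_on_subcbox set_lebesgue_integral_eq_integral(1) by blast
  then obtain N where N: "negligible N"
    and lim: "\<And>x e. \<lbrakk>x \<notin> N; 0 < e\<rbrakk> \<Longrightarrow> \<exists>d>0. \<forall>r. 0 < r \<and> r < d \<longrightarrow>
        norm (integral (cbox x (x + r *\<^sub>R One)) k /\<^sub>R r ^ DIM(real) - k x) < e"
    using integrable_ccontinuous_explicit[of k] by metis
  have "h x = 0" if x: "x \<in> {a<..<b}" "x \<notin> N" for x
  proof -
    have "\<bar>h x\<bar> < e" if e: "e > 0" for e
    proof -
      obtain d where d: "d > 0" and dd: "\<And>r. 0 < r \<Longrightarrow> r < d \<Longrightarrow>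
          norm (integral (cbox x (x + r *\<^sub>R One)) k /\<^sub>R r ^ DIM(real) - k x) < e"
        using lim[OF x(2) e] by blast
      define r where "r = min (d / 2) ((b - x) / 2)"
      have r: "0 < r" "r < d" "x + r < b" using d x by (auto simp: r_def min_def field_simps)
      have "integral {x..x + r} k = integral {x..x + r} h"
        by (rule integral_cong) (use x r in \<open>auto simp: k_def\<close>)
      then have "integral {x..x + r} k = 0" using 0[of x "x + r"] x r by simp
      then show ?thesis using dd[OF r(1,2)] x by (simp add: k_def)
    qed
    then show ?thesis by (metis abs_0_eq abs_le_zero_iff less_irrefl zero_less_abs_iff)
  qed
  moreover have "AE x in lebesgue. x \<notin> N"
    using N by (simp add: negligible_iff_null_sets AE_not_in)
  ultimately show ?thesis by (auto simp: AE_restrict_space_iff)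
qed

lemma integrable_scaleR_continuous:
  fixes g :: "real \<Rightarrow> 'a::euclidean_space"
  assumes "integrable (lebesgue_on {a<..<b}) g" "continuous_on {a..b} h"
  shows "integrable (lebesgue_on {a<..<b}) (\<lambda>x. h x *\<^sub>R g x)"
  unfolding integrable_Ioo_iff
proof (rule absolutely_integrable_bounded_measurable_product[of "(*\<^sub>R)"])
  show "bilinear ((*\<^sub>R) :: real \<Rightarrow> 'a \<Rightarrow> 'a)"
    by (auto simp: bilinear_def algebra_simps intro!: linearI)
  show "h \<in> borel_measurable (lebesgue_on {a..b})"
    using assms by (intro continuous_imp_measurable_on_sets_lebesgue) auto
  show "bounded (h ` {a..b})"
    using assms by (intro compact_imp_bounded compact_continuous_image) auto
qed (use assms in \<open>auto simp: integrable_Ioo_iff\<close>)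

lemma integrable_mult_continuous:
  fixes w h :: "real \<Rightarrow> real"
  assumes "integrable (lebesgue_on {a<..<b}) w" "continuous_on {a..b} h"
  shows "integrable (lebesgue_on {a<..<b}) (\<lambda>x. h x * w x)"
  using integrable_scaleR_continuous[OF assms] by simp

lemma integral_vanish:
  fixes f :: "real \<Rightarrow> 'a::real_normed_vector"
  shows "(\<And>x. x \<in> S \<Longrightarrow> f x = 0) \<Longrightarrow> integral S f = 0"
  by (subst integral_cong[of S f "\<lambda>_. 0"]) auto

text \<open>
  A test function is the derivative of a test function exactly when its integral vanishes; the constant \<open>c\<close>
  balances the two bumps so that this is the case.
\<close>

lemma bump_difference_primitive:
  assumes pq: "p0 < q0" and ab: "a < p" "q < b" "a < p0" "q0 < b"
    and c: "c * integral {a..b} (bump p0 q0 0) = integral {a..b} (bump p q n)"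
  obtains \<Phi> where "\<Phi> \<in> test_functions {a<..<b}"
    "\<And>x. deriv \<Phi> x = bump p q n x - c * bump p0 q0 0 x"
proof -
  define \<psi> where "\<psi> x = bump p q n x - c * bump p0 q0 0 x" for x
  define \<Phi> where "\<Phi> x = integral {a..x} \<psi>" for x
  have s: "smooth \<psi>" unfolding \<psi>_def[abs_def] by (intro smooth_diff_scaled bump_smooth)
  have int: "\<psi> integrable_on {u..v}" for u v
    by (intro integrable_continuous_real smooth_continuous s)
  have z: "\<psi> x = 0" if "x \<notin> {min p p0<..<max q q0}" for x
  proof -
    have "x \<notin> {p<..<q}" "x \<notin> {p0<..<q0}" using that by auto
    then show ?thesis by (simp add: \<psi>_def bump_eq_0)
  qed
  have \<Phi>0: "\<Phi> x = 0" if "x \<le> min p p0" for x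
    unfolding \<Phi>_def by (rule integral_vanish, rule z) (use that in auto)
  have \<Phi>1: "\<Phi> x = 0" if x: "x \<ge> max q q0" for x
  proof -
    have "integral {a..b} \<psi> = 0"
      unfolding \<psi>_def using c
      by (subst integral_diff)
        (auto intro!: integrable_continuous_real continuous_intros smooth_continuous[OF bump_smooth])
    moreover have "integral {x..b} \<psi> = 0" "integral {b..x} \<psi> = 0"
      by (rule integral_vanish, rule z, use x ab in auto)+
    moreover have "a \<le> x" "a \<le> b" using x ab pq by auto
    ultimately show ?thesis unfolding \<Phi>_def
      using Henstock_Kurzweil_Integration.integral_combine[OF _ _ int, of a x b]
        Henstock_Kurzweil_Integration.integral_combine[OF _ _ int, of a b x]
      by (cases "x \<le> b") auto
  qed
  have der: "(\<Phi> has_real_derivative \<psi> x) (at x)" for x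
  proof (cases "x < min p p0")
    case True
    have "((\<lambda>x. 0) has_real_derivative \<psi> x) (at x)" using z[of x] True by simp
    then show ?thesis
      by (rule has_field_derivative_transform_within_open[where S = "{..<min p p0}"]) (use True \<Phi>0 in auto)
  next
    case False
    have "(\<Phi> has_real_derivative \<psi> x) (at x within {a..x + 1})"
      unfolding \<Phi>_def by (rule integral_has_real_derivative) (use False ab s in \<open>auto intro: smooth_continuous\<close>)
    then show ?thesis
      using at_within_Icc_at[of a x "x + 1"] False ab by auto
  qed
  have "smooth \<Phi>" using der s by (rule smooth_primitive)
  moreover have "\<Phi> x = 0" if "x \<notin> {min p p0..max q q0}" for x
    using that \<Phi>0[of x] \<Phi>1[of x] by fastforce
  ultimately have "\<Phi> \<in> test_functions {a<..<b}"
    by (rule test_functionsI) (use ab in auto)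
  moreover have "deriv \<Phi> x = bump p q n x - c * bump p0 q0 0 x" for x
    using DERIV_imp_deriv[OF der] by (simp add: \<psi>_def)
  ultimately show thesis by (rule that)
qed

lemma bump_integral_pos:
  assumes "a \<le> p" "p < q" "q \<le> b"
  shows "integral {a..b} (bump p q n) > 0"
proof -
  have c: "continuous_on {a..b} (bump p q n)" by (intro smooth_continuous bump_smooth)
  have "integral {a..b} (bump p q n) \<ge> 0"
    by (intro integral_nonneg integrable_continuous_real c bump_bounds)
  moreover have "integral {a..b} (bump p q n) \<noteq> 0"
  proof
    assume "integral {a..b} (bump p q n) = 0"
    then have "\<forall>x\<in>{a..b}. bump p q n x = 0"
      using integral_eq_0_iff[OF c] assms bump_bounds by auto
    moreover have "bump p q n ((p + q) / 2) > 0" using assms by (intro bump_pos) auto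
    ultimately show False using assms by (auto dest!: bspec[of _ _ "(p + q) / 2"])
  qed
  ultimately show ?thesis by simp
qed

text \<open>
  Fix one bump \<open>\<theta>\<close>.  For every other bump \<open>\<psi>\<close> the difference of \<open>\<psi>\<close> and a suitable multiple of \<open>\<theta>\<close> is the
  derivative of a test function, so that the integral of \<open>g * \<psi>\<close> is a fixed multiple \<open>c\<close> of the integral of
  \<open>\<psi>\<close>.  Letting \<open>\<psi>\<close> tend to the indicator of an interval shows that \<open>g - c\<close> has integral \<open>0\<close> over all intervals.
\<close>

lemma du_Bois_Reymond:
  fixes g :: "real \<Rightarrow> real"
  assumes ab: "a < b" and g: "integrable (lebesgue_on {a<..<b}) g"
    and 0: "\<And>\<phi>. \<phi> \<in> test_functions {a<..<b} \<Longrightarrow> (LINT x|lebesgue_on {a<..<b}. deriv \<phi> x * g x) = 0"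
  shows "\<exists>c. AE x in lebesgue_on {a<..<b}. g x = c"
proof -
  let ?M = "lebesgue_on {a<..<b}"
  \<comment> \<open>any interval that is compactly contained in the given one will do\<close>
  define p0 q0 where "p0 = (2 * a + b) / 3" and "q0 = (a + 2 * b) / 3"
  have pq0: "a < p0" "p0 < q0" "q0 < b" using ab by (auto simp: p0_def q0_def)
  define \<theta> where "\<theta> = bump p0 q0 0"
  have \<theta>: "integral {a..b} \<theta> > 0"
    unfolding \<theta>_def by (rule bump_integral_pos) (use pq0 in auto)
  define c where "c = (LINT x|?M. \<theta> x * g x) / integral {a..b} \<theta>"
  have bump_int: "(LINT x|?M. bump p q n x * (g x - c)) = 0" if pq: "a < p" "p < q" "q < b" for p q n
  proof -
    define d where "d = integral {a..b} (bump p q n) / integral {a..b} \<theta>"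
    obtain \<Phi> where \<Phi>: "\<Phi> \<in> test_functions {a<..<b}" "\<And>x. deriv \<Phi> x = bump p q n x - d * \<theta> x"
      using bump_difference_primitive[of p0 q0 a p q b d n] pq0 pq \<theta> by (auto simp: d_def \<theta>_def)
    have i: "integrable ?M (\<lambda>x. bump p q n x * g x)" "integrable ?M (\<lambda>x. \<theta> x * g x)"
      unfolding \<theta>_def by (intro integrable_mult_continuous g smooth_continuous bump_smooth)+
    have ib: "integrable ?M (bump p q n)"
      by (intro integrable_Ioo_continuous smooth_continuous bump_smooth)
    have "0 = (LINT x|?M. bump p q n x * g x - d * (\<theta> x * g x))"
      using 0[OF \<Phi>(1)] by (simp add: \<Phi>(2) algebra_simps)
    also have "\<dots> = (LINT x|?M. bump p q n x * g x) - d * (LINT x|?M. \<theta> x * g x)"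
      using i by simp
    also have "d * (LINT x|?M. \<theta> x * g x) = c * (LINT x|?M. bump p q n x)"
      by (simp add: d_def c_def LINT_Ioo[OF ib])
    also have "(LINT x|?M. bump p q n x * g x) - c * (LINT x|?M. bump p q n x) = (LINT x|?M. bump p q n x * g x - c * bump p q n x)"
      using i ib by simp
    finally show ?thesis by (simp add: algebra_simps)
  qed
  have gc: "integrable ?M (\<lambda>x. g x - c)"
    using g integrable_Ioo_continuous[of a b "\<lambda>_. c"] by auto
  have "AE x in ?M. g x - c = 0"
  proof (rule AE_eq_0_if_interval_integrals_0[OF gc])
    fix p q assume pq: "a < p" "p < q" "q < b"
    have "(\<lambda>n. LINT x|?M. bump p q n x * (g x - c)) \<longlonglongrightarrow> (LINT x|?M. indicator {p<..<q} x * (g x - c))"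
    proof (rule integral_dominated_convergence[where w = "\<lambda>x. \<bar>g x - c\<bar>"])
      show "(\<lambda>x. indicator {p<..<q} x * (g x - c)) \<in> borel_measurable ?M"
        using gc by (intro borel_measurable_times borel_measurable_indicator)
          (auto simp: sets_restrict_space intro!: image_eqI[of _ _ "{p<..<q}"] dest: borel_measurable_integrable, use pq in auto)
      show "(\<lambda>x. bump p q n x * (g x - c)) \<in> borel_measurable ?M" for n
        using integrable_mult_continuous[OF gc smooth_continuous[OF bump_smooth]] by auto
      show "AE x in ?M. (\<lambda>n. bump p q n x * (g x - c)) \<longlonglongrightarrow> indicator {p<..<q} x * (g x - c)"
        by (intro AE_I2 tendsto_mult bump_tendsto tendsto_const)
      show "AE x in ?M. norm (bump p q n x * (g x - c)) \<le> \<bar>g x - c\<bar>" for n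
        by (auto simp: abs_mult bump_bounds intro!: AE_I2 mult_left_le_one_le)
    qed (use gc in auto)
    then have "(LINT x|?M. indicator {p<..<q} x * (g x - c)) = 0"
      using bump_int[OF pq] by (simp add: LIMSEQ_const_iff)
    moreover have "(LINT x|?M. indicator {p<..<q} x * (g x - c)) = (LINT x|lebesgue_on {p<..<q}. g x - c)"
    proof -
      have "(\<lambda>x. indicator {a<..<b} x * (indicator {p<..<q} x * (g x - c))) = (\<lambda>x. indicator {p<..<q} x * (g x - c))"
        using pq by (auto simp: indicator_def)
      then show ?thesis
        using integral_restrict_space[of "{a<..<b}" lebesgue "\<lambda>x. indicator {p<..<q} x * (g x - c)"]
          integral_restrict_space[of "{p<..<q}" lebesgue "\<lambda>x. g x - c"] by simp
    qed
    ultimately show "integral {p..q} (\<lambda>x. g x - c) = 0"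
      using LINT_Ioo[OF integrable_Ioo_subset[OF gc, of p q]] pq by simp
  qed
  then show ?thesis by auto
qed

section \<open>Primitives of integrable functions and integration by parts\<close>

lemma borel_measurable_less_Ioo:
  assumes [measurable]: "w \<in> borel_measurable (lebesgue_on {a<..<b::real})"
  shows "(\<lambda>t. if t < x then w t else 0 :: real) \<in> borel_measurable (lebesgue_on {a<..<b})"
proof -
  have [measurable]: "(\<lambda>t. t) \<in> borel_measurable (lebesgue_on {a<..<b})"
    using id_borel_measurable_lebesgue_on by (simp add: id_def)
  show ?thesis by measurable
qed

lemma LINT_less_eq_integral:
  fixes w :: "real \<Rightarrow> real"
  assumes w: "integrable (lebesgue_on {a<..<b}) w" and x: "a \<le> x" "x \<le> b"
  shows "integrable (lebesgue_on {a<..<b}) (\<lambda>t. if t < x then w t else 0)"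
    and "(LINT t|lebesgue_on {a<..<b}. (if t < x then w t else 0)) = integral {a..x} w"
proof -
  show i: "integrable (lebesgue_on {a<..<b}) (\<lambda>t. if t < x then w t else 0)"
    by (rule Bochner_Integration.integrable_bound[OF w])
      (use borel_measurable_integrable[OF w] in \<open>auto intro: borel_measurable_less_Ioo\<close>)
  have "(LINT t|lebesgue_on {a<..<b}. (if t < x then w t else 0)) = integral {a..b} (\<lambda>t. if t \<in> {..<x} then w t else 0)"
    by (simp add: LINT_Ioo[OF i])
  also have "\<dots> = integral ({..<x} \<inter> {a..b}) w"
    by (rule integral_restrict_Int)
  also have "\<dots> = integral {a..x} w"
  proof (rule integral_spike_set)
    show "negligible {y \<in> {..<x} \<inter> {a..b} - {a..x}. w y \<noteq> 0}"
      by (rule negligible_subset[of "{}"]) auto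
    show "negligible {y \<in> {a..x} - {..<x} \<inter> {a..b}. w y \<noteq> 0}"
      by (rule negligible_subset[of "{x}"]) (use x in auto)
  qed
  finally show "(LINT t|lebesgue_on {a<..<b}. (if t < x then w t else 0)) = integral {a..x} w" .
qed

lemma LINT_greater_eq_integral:
  fixes w :: "real \<Rightarrow> real"
  assumes w: "integrable (lebesgue_on {a<..<b}) w" and x: "a \<le> x" "x \<le> b"
  shows "(LINT t|lebesgue_on {a<..<b}. (if x < t then w t else 0)) = integral {x..b} w"
proof -
  have "integrable (lebesgue_on {a<..<b}) (\<lambda>t. if x < t then w t else 0)"
  proof (rule Bochner_Integration.integrable_bound[OF w])
    have [measurable]: "(\<lambda>t. t) \<in> borel_measurable (lebesgue_on {a<..<b})"
      using id_borel_measurable_lebesgue_on by (simp add: id_def)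
    have [measurable]: "w \<in> borel_measurable (lebesgue_on {a<..<b})" using w by auto
    show "(\<lambda>t. if x < t then w t else 0) \<in> borel_measurable (lebesgue_on {a<..<b})"
      by measurable
  qed auto
  then have "(LINT t|lebesgue_on {a<..<b}. (if x < t then w t else 0)) = integral {a..b} (\<lambda>t. if t \<in> {x<..} then w t else 0)"
    by (simp add: LINT_Ioo)
  also have "\<dots> = integral ({x<..} \<inter> {a..b}) w"
    by (rule integral_restrict_Int)
  also have "\<dots> = integral {x..b} w"
  proof (rule integral_spike_set)
    show "negligible {y \<in> {x<..} \<inter> {a..b} - {x..b}. w y \<noteq> 0}"
      by (rule negligible_subset[of "{}"]) auto
    show "negligible {y \<in> {x..b} - {x<..} \<inter> {a..b}. w y \<noteq> 0}"
      by (rule negligible_subset[of "{x}"]) (use x in auto)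
  qed
  finally show ?thesis .
qed

text \<open>
  Both sides are the integral of \<open>h x * w t\<close> over the triangle \<open>t < x\<close>.
\<close>

lemma Fubini_triangle:
  fixes w h :: "real \<Rightarrow> real"
  assumes w: "integrable (lebesgue_on {a<..<b}) w" and h: "integrable (lebesgue_on {a<..<b}) h"
  shows "(LINT x|lebesgue_on {a<..<b}. h x * integral {a..x} w) =
    (LINT t|lebesgue_on {a<..<b}. w t * integral {t..b} h)"
proof -
  let ?M = "lebesgue_on {a<..<b}"
  interpret M: finite_measure ?M by (rule finite_measure_Ioo)
  interpret pair_sigma_finite ?M ?M ..
  have [measurable]: "w \<in> borel_measurable ?M" "h \<in> borel_measurable ?M" using w h by auto
  have [measurable]: "(\<lambda>t. t) \<in> borel_measurable ?M"
    using id_borel_measurable_lebesgue_on by (simp add: id_def)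
  have [measurable]: "fst \<in> borel_measurable (?M \<Otimes>\<^sub>M ?M)" "snd \<in> borel_measurable (?M \<Otimes>\<^sub>M ?M)"
    using measurable_compose[OF measurable_fst, of "\<lambda>t. t" ?M borel ?M]
      measurable_compose[OF measurable_snd, of "\<lambda>t. t" ?M borel ?M] by simp_all
  have prod: "integrable (?M \<Otimes>\<^sub>M ?M) (\<lambda>(x, t). h x * w t)"
    by (rule Fubini_integrable) (use w h in \<open>auto simp: abs_mult\<close>)
  have tri: "integrable (?M \<Otimes>\<^sub>M ?M) (\<lambda>(x, t). if t < x then h x * w t else 0)"
    by (rule Bochner_Integration.integrable_bound[OF prod]) (auto simp: case_prod_beta)
  have "(LINT x|?M. h x * integral {a..x} w) = (LINT x|?M. LINT t|?M. (if t < x then h x * w t else 0))"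
  proof (intro Bochner_Integration.integral_cong refl)
    fix x assume "x \<in> space ?M"
    then have "integral {a..x} w = (LINT t|?M. (if t < x then w t else 0))"
      by (simp add: LINT_less_eq_integral[OF w])
    moreover have "(\<lambda>t. if t < x then h x * w t else 0) = (\<lambda>t. h x * (if t < x then w t else 0))" by auto
    ultimately show "h x * integral {a..x} w = (LINT t|?M. (if t < x then h x * w t else 0))"
      by (simp only: integral_mult_right_zero)
  qed
  also have "\<dots> = (LINT t|?M. LINT x|?M. (if t < x then h x * w t else 0))"
    using Fubini_integral[OF tri] by simp
  also have "\<dots> = (LINT t|?M. w t * integral {t..b} h)"
  proof (intro Bochner_Integration.integral_cong refl)
    fix t assume "t \<in> space ?M"
    then have "integral {t..b} h = (LINT x|?M. (if t < x then h x else 0))"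
      by (simp add: LINT_greater_eq_integral[OF h])
    moreover have "(\<lambda>x. if t < x then h x * w t else 0) = (\<lambda>x. w t * (if t < x then h x else 0))" by auto
    ultimately show "(LINT x|?M. (if t < x then h x * w t else 0)) = w t * integral {t..b} h"
      by (simp only: integral_mult_right_zero)
  qed
  finally show ?thesis .
qed

lemma primitive_continuous:
  fixes w :: "real \<Rightarrow> 'a::euclidean_space"
  assumes "integrable (lebesgue_on {a<..<b}) w"
  shows "continuous_on {a..b} (\<lambda>x. c + integral {a..x} w)"
  using assms by (intro continuous_intros indefinite_integral_continuous_1)
    (auto simp: integrable_Ioo_iff dest: set_lebesgue_integral_eq_integral(1))

text \<open>
  Integration by parts for two absolutely continuous functions, given as primitives of integrable ones.  It
  serves in the space variable for \<open>D u\<close> and in the time variable for the Fourier coefficients of a solution.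
\<close>

lemma integration_by_parts_primitives:
  fixes w h X Y :: "real \<Rightarrow> real"
  assumes ab: "a \<le> b"
    and w: "integrable (lebesgue_on {a<..<b}) w" and h: "integrable (lebesgue_on {a<..<b}) h"
    and Y: "\<And>x. x \<in> {a..b} \<Longrightarrow> Y x = Y a + integral {a..x} w"
    and X: "\<And>x. x \<in> {a..b} \<Longrightarrow> X x = X a + integral {a..x} h"
  shows "(LINT x|lebesgue_on {a<..<b}. w x * X x) + (LINT x|lebesgue_on {a<..<b}. h x * Y x) = Y b * X b - Y a * X a"
proof -
  let ?M = "lebesgue_on {a<..<b}"
  have cY: "continuous_on {a..b} (\<lambda>x. integral {a..x} w)" and cX: "continuous_on {a..b} (\<lambda>x. integral {a..x} h)"
    using primitive_continuous[OF w, of 0] primitive_continuous[OF h, of 0] by simp_all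
  have iw: "integral {a..b} w = Y b - Y a" and ih: "integral {a..b} h = X b - X a"
    using X[of b] Y[of b] ab by auto
  have hint: "h integrable_on {a..b}"
    using h by (auto simp: integrable_Ioo_iff dest: set_lebesgue_integral_eq_integral(1))
  have "(LINT x|?M. h x * Y x) = (LINT x|?M. Y a * h x + h x * integral {a..x} w)"
  proof (intro Bochner_Integration.integral_cong refl)
    fix x assume "x \<in> space ?M"
    then show "h x * Y x = Y a * h x + h x * integral {a..x} w"
      using Y[of x] by (simp add: algebra_simps)
  qed
  also have "\<dots> = Y a * (X b - X a) + (LINT x|?M. h x * integral {a..x} w)"
    using h integrable_mult_continuous[OF h cY] ih by (simp add: mult.commute LINT_Ioo)
  also have "(LINT x|?M. h x * integral {a..x} w) = (LINT t|?M. w t * integral {t..b} h)"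
    by (rule Fubini_triangle[OF w h])
  also have "\<dots> = (LINT t|?M. X b * w t - w t * X t)"
  proof (intro Bochner_Integration.integral_cong refl)
    fix t assume "t \<in> space ?M"
    then have "integral {a..t} h + integral {t..b} h = integral {a..b} h"
      by (intro Henstock_Kurzweil_Integration.integral_combine hint) auto
    with X[of t] ih \<open>t \<in> space ?M\<close> have eq: "integral {t..b} h = X b - X t" by simp
    show "w t * integral {t..b} h = X b * w t - w t * X t"
      unfolding eq by (simp add: algebra_simps)
  qed
  also have "\<dots> = X b * (Y b - Y a) - (LINT t|?M. w t * X t)"
  proof -
    have "integrable ?M (\<lambda>t. w t * X t) \<longleftrightarrow> integrable ?M (\<lambda>t. (X a + integral {a..t} h) * w t)"
    proof (intro Bochner_Integration.integrable_cong refl)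
      fix t assume "t \<in> space ?M"
      then show "w t * X t = (X a + integral {a..t} h) * w t" using X[of t] by simp
    qed
    then have "integrable ?M (\<lambda>t. w t * X t)"
      using integrable_mult_continuous[OF w primitive_continuous[OF h, of "X a"]] by simp
    then show ?thesis using w iw by (simp add: LINT_Ioo)
  qed
  finally show ?thesis by (simp add: algebra_simps)
qed

text \<open>
  By Fubini's theorem the primitive of \<open>v\<close> has the weak derivative \<open>v\<close> as well, so that the difference from
  \<open>u\<close> has the weak derivative \<open>0\<close> and is constant.
\<close>

lemma weak_derivative_imp_primitive:
  fixes u v :: "real \<Rightarrow> real"
  assumes ab: "a < b"
    and u: "integrable (lebesgue_on {a<..<b}) u" and v: "integrable (lebesgue_on {a<..<b}) v"
    and weak: "\<And>\<phi>. \<phi> \<in> test_functions {a<..<b} \<Longrightarrow>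
      (LINT x|lebesgue_on {a<..<b}. deriv \<phi> x * u x) = - (LINT x|lebesgue_on {a<..<b}. \<phi> x * v x)"
  shows "\<exists>c. AE x in lebesgue_on {a<..<b}. u x = c + integral {a..x} v"
proof -
  let ?M = "lebesgue_on {a<..<b}"
  have cV: "continuous_on {a..b} (\<lambda>x. integral {a..x} v)"
    using primitive_continuous[OF v, of 0] by simp
  have V: "integrable ?M (\<lambda>x. integral {a..x} v)"
    by (rule integrable_Ioo_continuous[OF cV])
  have "\<exists>c. AE x in ?M. u x - integral {a..x} v = c"
  proof (rule du_Bois_Reymond[OF ab])
    show "integrable ?M (\<lambda>x. u x - integral {a..x} v)" using u V by simp
    fix \<phi> assume \<phi>: "\<phi> \<in> test_functions {a<..<b}"
    then have s: "smooth \<phi>" "smooth (deriv \<phi>)" by (auto intro: test_function_smooth smooth_deriv)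
    have z: "\<phi> a = 0" "\<phi> b = 0" using test_function_eq_0[OF \<phi>] by auto
    have d: "integrable ?M (deriv \<phi>)" by (intro integrable_Ioo_continuous smooth_continuous s)
    have "(LINT x|?M. deriv \<phi> x * integral {a..x} v) = (LINT t|?M. v t * integral {t..b} (deriv \<phi>))"
      by (rule Fubini_triangle[OF v d])
    also have "\<dots> = (LINT t|?M. - (\<phi> t * v t))"
    proof (intro Bochner_Integration.integral_cong refl)
      fix t assume "t \<in> space ?M"
      then have "(deriv \<phi> has_integral (\<phi> b - \<phi> t)) {t..b}"
        by (intro fundamental_theorem_of_calculus)
          (auto simp: has_real_derivative_iff_has_vector_derivative[symmetric]
            intro!: smooth_has_derivative[OF s(1)] has_field_derivative_at_within)
      then show "v t * integral {t..b} (deriv \<phi>) = - (\<phi> t * v t)" using z by (simp add: integral_unique)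
    qed
    finally have "(LINT x|?M. deriv \<phi> x * integral {a..x} v) = (LINT x|?M. deriv \<phi> x * u x)"
      using weak[OF \<phi>] by simp
    then show "(LINT x|?M. deriv \<phi> x * (u x - integral {a..x} v)) = 0"
      using integrable_mult_continuous[OF u smooth_continuous[OF s(2)]]
        integrable_mult_continuous[OF V smooth_continuous[OF s(2)]]
      by (simp add: right_diff_distrib)
  qed
  then obtain c where "AE x in ?M. u x - integral {a..x} v = c" by blast
  then show ?thesis by (intro exI[of _ c]) (auto elim!: eventually_mono)
qed

section \<open>The inner product of \<open>L2\<close>\<close>

definition L2_inner :: "real set \<Rightarrow> (real \<Rightarrow> real^3) \<Rightarrow> (real \<Rightarrow> real^3) \<Rightarrow> real" where
  "L2_inner \<Omega> u v = (LINT x|lebesgue_on \<Omega>. u x \<bullet> v x)"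

lemma L2_measurable: "u \<in> L2 \<Omega> \<Longrightarrow> u \<in> borel_measurable (lebesgue_on \<Omega>)"
  by (simp add: L2_def)

lemma L2_square_integrable: "u \<in> L2 \<Omega> \<Longrightarrow> integrable (lebesgue_on \<Omega>) (\<lambda>x. (norm (u x))\<^sup>2)"
  by (simp add: L2_def)

lemma L2_inner_integrable:
  assumes "u \<in> L2 \<Omega>" "v \<in> L2 \<Omega>"
  shows "integrable (lebesgue_on \<Omega>) (\<lambda>x. u x \<bullet> v x)"
proof (rule Bochner_Integration.integrable_bound)
  show "integrable (lebesgue_on \<Omega>) (\<lambda>x. (norm (u x))\<^sup>2 + (norm (v x))\<^sup>2)"
    using assms by (auto dest: L2_square_integrable)
  show "AE x in lebesgue_on \<Omega>. norm (u x \<bullet> v x) \<le> norm ((norm (u x))\<^sup>2 + (norm (v x))\<^sup>2)"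
  proof (rule AE_I2)
    fix x
    have "norm (u x \<bullet> v x) \<le> norm (u x) * norm (v x)" by (simp add: Cauchy_Schwarz_ineq2)
    also have "\<dots> \<le> 2 * norm (u x) * norm (v x)" by simp
    also have "\<dots> \<le> (norm (u x))\<^sup>2 + (norm (v x))\<^sup>2" by (rule sum_squares_bound)
    finally show "norm (u x \<bullet> v x) \<le> norm ((norm (u x))\<^sup>2 + (norm (v x))\<^sup>2)" by simp
  qed
qed (use assms in \<open>auto intro!: borel_measurable_inner L2_measurable\<close>)

lemma L2_add:
  assumes "u \<in> L2 \<Omega>" "v \<in> L2 \<Omega>"
  shows "(\<lambda>x. u x + v x) \<in> L2 \<Omega>"
proof -
  have "(norm (u x + v x))\<^sup>2 = (norm (u x))\<^sup>2 + 2 * (u x \<bullet> v x) + (norm (v x))\<^sup>2" for x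
    by (simp add: power2_norm_eq_inner inner_add_left inner_add_right inner_commute)
  then show ?thesis
    using assms L2_inner_integrable[OF assms]
    by (auto simp: L2_def intro!: borel_measurable_add)
qed

lemma L2_scaleR: "u \<in> L2 \<Omega> \<Longrightarrow> (\<lambda>x. c *\<^sub>R u x) \<in> L2 \<Omega>"
  by (auto simp: L2_def power_mult_distrib intro!: borel_measurable_scaleR)

lemma L2_minus: "u \<in> L2 \<Omega> \<Longrightarrow> (\<lambda>x. - u x) \<in> L2 \<Omega>"
  using L2_scaleR[of u \<Omega> "-1"] by simp

lemma L2_diff: "u \<in> L2 \<Omega> \<Longrightarrow> v \<in> L2 \<Omega> \<Longrightarrow> (\<lambda>x. u x - v x) \<in> L2 \<Omega>"
  using L2_add[OF _ L2_minus, of u \<Omega> v] by simp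

lemma L2_zero: "(\<lambda>x. 0) \<in> L2 \<Omega>"
  by (simp add: L2_def)

lemma L2_sum: "finite A \<Longrightarrow> (\<And>i. i \<in> A \<Longrightarrow> u i \<in> L2 \<Omega>) \<Longrightarrow> (\<lambda>x. \<Sum>i\<in>A. u i x) \<in> L2 \<Omega>"
  by (induction A rule: finite_induct) (auto intro: L2_zero L2_add)

lemma L2_continuous:
  assumes "continuous_on {a..b} u"
  shows "u \<in> L2 {a<..<b}"
proof -
  have "integrable (lebesgue_on {a<..<b}) u" by (rule integrable_Ioo_continuous[OF assms])
  moreover have "integrable (lebesgue_on {a<..<b}) (\<lambda>x. (norm (u x))\<^sup>2)"
    by (intro integrable_Ioo_continuous continuous_intros assms)
  ultimately show ?thesis by (auto simp: L2_def)
qed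

lemma L2_integrable:
  assumes "u \<in> L2 {a<..<b}"
  shows "integrable (lebesgue_on {a<..<b}) u"
proof (rule Bochner_Integration.integrable_bound)
  show "integrable (lebesgue_on {a<..<b}) (\<lambda>x. 1 + (norm (u x))\<^sup>2)"
    using assms L2_square_integrable integrable_Ioo_continuous[of a b "\<lambda>_. 1::real"] by auto
  have "t \<le> 1 + t\<^sup>2" for t :: real
  proof -
    have "0 \<le> (t - 1 / 2)\<^sup>2" by simp
    also have "\<dots> = t\<^sup>2 - t + 1 / 4" by (simp add: power2_eq_square field_simps)
    finally show ?thesis by simp
  qed
  then show "AE x in lebesgue_on {a<..<b}. norm (u x) \<le> norm (1 + (norm (u x))\<^sup>2)"
    by (intro AE_I2) (simp add: abs_of_nonneg)
qed (use assms in \<open>auto intro: L2_measurable\<close>)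

text \<open>
  This needs the completeness of Lebesgue measure.
\<close>

lemma borel_measurable_AE_on:
  fixes u :: "real \<Rightarrow> 'a::euclidean_space"
  assumes "\<Omega> \<in> sets lebesgue" "u \<in> borel_measurable (lebesgue_on \<Omega>)" "AE x in lebesgue_on \<Omega>. u x = v x"
  shows "v \<in> borel_measurable (lebesgue_on \<Omega>)"
proof -
  have "(\<lambda>x. indicator \<Omega> x *\<^sub>R v x) \<in> borel_measurable lebesgue"
  proof (rule borel_measurable_AE)
    show "(\<lambda>x. indicator \<Omega> x *\<^sub>R u x) \<in> borel_measurable lebesgue"
      using assms by (simp add: borel_measurable_restrict_space_iff)
    show "AE x in lebesgue. indicator \<Omega> x *\<^sub>R u x = indicator \<Omega> x *\<^sub>R v x"
      using assms(1,3) by (auto simp: AE_restrict_space_iff indicator_def elim!: eventually_mono)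
  qed
  then show ?thesis using assms by (simp add: borel_measurable_restrict_space_iff)
qed

lemma L2_cong_AE:
  assumes "u \<in> L2 \<Omega>" "AE x in lebesgue_on \<Omega>. u x = v x" "\<Omega> \<in> sets lebesgue"
  shows "v \<in> L2 \<Omega>"
proof -
  have m: "v \<in> borel_measurable (lebesgue_on \<Omega>)"
    using borel_measurable_AE_on[OF assms(3) L2_measurable[OF assms(1)] assms(2)] .
  have "integrable (lebesgue_on \<Omega>) (\<lambda>x. (norm (v x))\<^sup>2)"
    by (rule integrable_cong_AE_imp[OF L2_square_integrable[OF assms(1)]])
      (use assms(2) m in auto)
  with m show ?thesis by (simp add: L2_def)
qed

lemma L2_inner_cong_AE:
  assumes "u \<in> L2 \<Omega>" "AE x in lebesgue_on \<Omega>. u x = u' x"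
    "v \<in> L2 \<Omega>" "AE x in lebesgue_on \<Omega>. v x = v' x" "\<Omega> \<in> sets lebesgue"
  shows "L2_inner \<Omega> u v = L2_inner \<Omega> u' v'"
  unfolding L2_inner_def
proof (rule Bochner_Integration.integral_cong_AE)
  show "(\<lambda>x. u x \<bullet> v x) \<in> borel_measurable (lebesgue_on \<Omega>)" "(\<lambda>x. u' x \<bullet> v' x) \<in> borel_measurable (lebesgue_on \<Omega>)"
    using assms by (auto intro!: borel_measurable_inner intro: L2_measurable L2_cong_AE)
qed (use assms in auto)

lemma L2_inner_commute: "L2_inner \<Omega> u v = L2_inner \<Omega> v u"
  by (simp add: L2_inner_def inner_commute)

lemma L2_inner_add_left:
  "u \<in> L2 \<Omega> \<Longrightarrow> u' \<in> L2 \<Omega> \<Longrightarrow> v \<in> L2 \<Omega> \<Longrightarrow>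
    L2_inner \<Omega> (\<lambda>x. u x + u' x) v = L2_inner \<Omega> u v + L2_inner \<Omega> u' v"
  by (simp add: L2_inner_def inner_add_left L2_inner_integrable)

lemma L2_inner_diff_left:
  "u \<in> L2 \<Omega> \<Longrightarrow> u' \<in> L2 \<Omega> \<Longrightarrow> v \<in> L2 \<Omega> \<Longrightarrow>
    L2_inner \<Omega> (\<lambda>x. u x - u' x) v = L2_inner \<Omega> u v - L2_inner \<Omega> u' v"
  by (simp add: L2_inner_def inner_diff_left L2_inner_integrable)

lemma L2_inner_scaleR_left: "L2_inner \<Omega> (\<lambda>x. c *\<^sub>R u x) v = c * L2_inner \<Omega> u v"
  by (simp add: L2_inner_def)

lemma L2_inner_minus_left: "L2_inner \<Omega> (\<lambda>x. - u x) v = - L2_inner \<Omega> u v"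
  using L2_inner_scaleR_left[of \<Omega> "-1"] by simp

lemma L2_inner_sum_left:
  "finite A \<Longrightarrow> (\<And>i. i \<in> A \<Longrightarrow> u i \<in> L2 \<Omega>) \<Longrightarrow> v \<in> L2 \<Omega> \<Longrightarrow>
    L2_inner \<Omega> (\<lambda>x. \<Sum>i\<in>A. u i x) v = (\<Sum>i\<in>A. L2_inner \<Omega> (u i) v)"
  by (simp add: L2_inner_def inner_sum_left L2_inner_integrable)

lemma L2_inner_add_right:
  "u \<in> L2 \<Omega> \<Longrightarrow> u' \<in> L2 \<Omega> \<Longrightarrow> v \<in> L2 \<Omega> \<Longrightarrow>
    L2_inner \<Omega> v (\<lambda>x. u x + u' x) = L2_inner \<Omega> v u + L2_inner \<Omega> v u'"
  by (simp add: L2_inner_def inner_add_right L2_inner_integrable)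

lemma L2_inner_scaleR_right: "L2_inner \<Omega> v (\<lambda>x. c *\<^sub>R u x) = c * L2_inner \<Omega> v u"
  by (simp add: L2_inner_def)

lemma L2_inner_minus_right: "L2_inner \<Omega> v (\<lambda>x. - u x) = - L2_inner \<Omega> v u"
  by (simp add: L2_inner_def)

lemma L2_norm_nonneg: "0 \<le> L2_norm \<Omega> u"
  by (simp add: L2_norm_def)

lemma L2_norm_square: "(L2_norm \<Omega> u)\<^sup>2 = L2_inner \<Omega> u u"
  by (simp add: L2_norm_def L2_inner_def power2_norm_eq_inner)

lemma L2_norm_cong_AE:
  assumes "u \<in> L2 \<Omega>" "AE x in lebesgue_on \<Omega>. u x = u' x" "\<Omega> \<in> sets lebesgue"
  shows "L2_norm \<Omega> u = L2_norm \<Omega> u'"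
proof -
  have "(L2_norm \<Omega> u)\<^sup>2 = (L2_norm \<Omega> u')\<^sup>2"
    unfolding L2_norm_square using assms by (intro L2_inner_cong_AE) auto
  then show ?thesis by (simp add: L2_norm_nonneg)
qed

lemma L2_norm_minus: "L2_norm \<Omega> (\<lambda>x. - u x) = L2_norm \<Omega> u"
  by (simp add: L2_norm_def)

lemma L2_norm_minus_commute: "L2_norm \<Omega> (\<lambda>x. u x - v x) = L2_norm \<Omega> (\<lambda>x. v x - u x)"
  by (simp add: L2_norm_def norm_minus_commute)

lemma L2_norm_add_square:
  assumes "u \<in> L2 \<Omega>" "v \<in> L2 \<Omega>"
  shows "(L2_norm \<Omega> (\<lambda>x. u x + v x))\<^sup>2 = (L2_norm \<Omega> u)\<^sup>2 + 2 * L2_inner \<Omega> u v + (L2_norm \<Omega> v)\<^sup>2"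
proof -
  have uv: "(\<lambda>x. u x + v x) \<in> L2 \<Omega>" using assms by (rule L2_add)
  show ?thesis unfolding L2_norm_square L2_inner_add_left[OF assms uv]
    by (simp add: L2_inner_add_right assms L2_inner_commute[of \<Omega> v u])
qed

lemma L2_norm_diff_square:
  assumes "u \<in> L2 \<Omega>" "v \<in> L2 \<Omega>"
  shows "(L2_norm \<Omega> (\<lambda>x. u x - v x))\<^sup>2 = (L2_norm \<Omega> u)\<^sup>2 - 2 * L2_inner \<Omega> u v + (L2_norm \<Omega> v)\<^sup>2"
  using L2_norm_add_square[OF assms(1) L2_minus[OF assms(2)]]
  by (simp add: L2_inner_minus_right L2_norm_minus)

text \<open>
  The usual argument: the quadratic polynomial giving the squared norm of \<open>u - s *\<^sub>R v\<close> is nonnegative.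
\<close>

lemma L2_Cauchy_Schwarz:
  assumes "u \<in> L2 \<Omega>" "v \<in> L2 \<Omega>"
  shows "\<bar>L2_inner \<Omega> u v\<bar> \<le> L2_norm \<Omega> u * L2_norm \<Omega> v"
proof -
  define A B C where "A = (L2_norm \<Omega> u)\<^sup>2" "B = L2_inner \<Omega> u v" "C = (L2_norm \<Omega> v)\<^sup>2"
  have q: "0 \<le> A - 2 * s * B + s\<^sup>2 * C" for s
  proof -
    have "(L2_norm \<Omega> (\<lambda>x. s *\<^sub>R v x))\<^sup>2 = s\<^sup>2 * C"
      unfolding L2_norm_square A_B_C_def
      by (simp add: L2_inner_scaleR_left L2_inner_scaleR_right power2_eq_square)
    then have "(L2_norm \<Omega> (\<lambda>x. u x - s *\<^sub>R v x))\<^sup>2 = A - 2 * s * B + s\<^sup>2 * C"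
      using L2_norm_diff_square[OF assms(1) L2_scaleR[OF assms(2)], of s]
      by (simp add: L2_inner_scaleR_right A_B_C_def)
    then show ?thesis by (metis zero_le_power2)
  qed
  have "B\<^sup>2 \<le> A * C"
  proof (cases "C = 0")
    case True
    have "B = 0"
    proof (rule ccontr)
      assume "B \<noteq> 0"
      with q[of "(A + 1) / (2 * B)"] True show False by simp
    qed
    with True show ?thesis by simp
  next
    case False
    then have "C > 0" by (simp add: A_B_C_def)
    with q[of "B / C"] show ?thesis by (simp add: field_simps power2_eq_square)
  qed
  then have "\<bar>B\<bar>\<^sup>2 \<le> (L2_norm \<Omega> u * L2_norm \<Omega> v)\<^sup>2" by (simp add: A_B_C_def power_mult_distrib)
  then show ?thesis unfolding A_B_C_def
    by (rule power2_le_imp_le) (simp add: L2_norm_nonneg)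
qed

lemma L2_norm_triangle:
  assumes "u \<in> L2 \<Omega>" "v \<in> L2 \<Omega>"
  shows "L2_norm \<Omega> (\<lambda>x. u x + v x) \<le> L2_norm \<Omega> u + L2_norm \<Omega> v"
proof (rule power2_le_imp_le)
  show "(L2_norm \<Omega> (\<lambda>x. u x + v x))\<^sup>2 \<le> (L2_norm \<Omega> u + L2_norm \<Omega> v)\<^sup>2"
    unfolding L2_norm_add_square[OF assms] using L2_Cauchy_Schwarz[OF assms]
    by (simp add: power2_sum)
qed (simp add: L2_norm_nonneg)

lemma L2_norm_reverse_triangle:
  assumes "u \<in> L2 \<Omega>" "v \<in> L2 \<Omega>"
  shows "\<bar>L2_norm \<Omega> u - L2_norm \<Omega> v\<bar> \<le> L2_norm \<Omega> (\<lambda>x. u x - v x)"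
  using L2_norm_triangle[OF L2_diff[OF assms] assms(2)]
    L2_norm_triangle[OF L2_diff[OF assms(2,1)] assms(1)]
  by (simp add: L2_norm_minus_commute[of \<Omega> v u])

section \<open>Weak derivatives\<close>

text \<open>
  This turns the almost everywhere identities for Sobolev functions into pointwise ones for their
  continuous representatives, up to the boundary.
\<close>

lemma continuous_AE_eq_0:
  fixes f :: "real \<Rightarrow> 'a::euclidean_space"
  assumes ab: "a < b" and f: "continuous_on {a..b} f" and 0: "AE x in lebesgue_on {a<..<b}. f x = 0"
    and x: "x \<in> {a..b}"
  shows "f x = 0"
proof -
  have c: "continuous_on {a..b} (\<lambda>x. norm (f x))" by (intro continuous_intros f)
  have i: "integrable (lebesgue_on {a<..<b}) (\<lambda>x. norm (f x))" by (rule integrable_Ioo_continuous[OF c])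
  have "integral {a..b} (\<lambda>x. norm (f x)) = (LINT x|lebesgue_on {a<..<b}. norm (f x))"
    by (simp add: LINT_Ioo[OF i])
  also have "\<dots> = 0"
    by (rule integral_eq_zero_AE) (use 0 in auto)
  finally show ?thesis
    using integral_eq_0_iff[OF c] ab x by auto
qed

lemma LINT_inner:
  fixes f :: "'a \<Rightarrow> real^3"
  assumes "integrable M f"
  shows "(LINT x|M. f x) \<bullet> k = (LINT x|M. f x \<bullet> k)"
  using integral_inner_left[of k M f] assms by auto

lemma weak_deriv_inner:
  assumes u: "integrable (lebesgue_on {a<..<b}) u" and v: "integrable (lebesgue_on {a<..<b}) v"
    and uv: "weak_deriv {a<..<b} u v" and \<phi>: "\<phi> \<in> test_functions {a<..<b}"
  shows "(LINT x|lebesgue_on {a<..<b}. deriv \<phi> x * (u x \<bullet> k)) = - (LINT x|lebesgue_on {a<..<b}. \<phi> x * (v x \<bullet> k))"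
proof -
  have s: "smooth \<phi>" "smooth (deriv \<phi>)" using \<phi> by (auto intro: test_function_smooth smooth_deriv)
  have "(LINT x|lebesgue_on {a<..<b}. deriv \<phi> x *\<^sub>R u x) \<bullet> k = (- (LINT x|lebesgue_on {a<..<b}. \<phi> x *\<^sub>R v x)) \<bullet> k"
    using uv \<phi> by (simp add: weak_deriv_def)
  then show ?thesis
    using u v s by (simp add: LINT_inner integrable_scaleR_continuous smooth_continuous)
qed

lemma weak_deriv_primitive:
  assumes ab: "a < b"
    and u: "integrable (lebesgue_on {a<..<b}) u" and v: "integrable (lebesgue_on {a<..<b}) v"
    and uv: "weak_deriv {a<..<b} u v"
  shows "\<exists>c. AE x in lebesgue_on {a<..<b}. u x = c + integral {a..x} v"
proof -
  let ?M = "lebesgue_on {a<..<b}"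
  have "\<exists>c. AE x in ?M. u x \<bullet> k = c + integral {a..x} (\<lambda>x. v x \<bullet> k)" for k
    by (rule weak_derivative_imp_primitive[OF ab]) (use u v weak_deriv_inner[OF u v uv] in auto)
  then obtain c where c: "\<And>k. AE x in ?M. u x \<bullet> k = c k + integral {a..x} (\<lambda>x. v x \<bullet> k)" by metis
  have "AE x in ?M. \<forall>k\<in>Basis. u x \<bullet> k = c k + integral {a..x} (\<lambda>x. v x \<bullet> k)"
    by (rule AE_finite_allI) (use c in auto)
  then have "AE x in ?M. u x = (\<Sum>k\<in>Basis. c k *\<^sub>R k) + integral {a..x} v"
  proof (rule AE_mp, intro AE_I2 impI)
    fix x assume x: "x \<in> space ?M" and eq: "\<forall>k\<in>Basis. u x \<bullet> k = c k + integral {a..x} (\<lambda>x. v x \<bullet> k)"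
    have "v integrable_on {a..x}"
      using integrable_Ioo_subset[OF v, of a x] x
      by (auto simp: integrable_Ioo_iff dest: set_lebesgue_integral_eq_integral(1))
    then have "integral {a..x} v \<bullet> k = integral {a..x} (\<lambda>x. v x \<bullet> k)" if "k \<in> Basis" for k
      by (rule integral_component_eq[symmetric])
    with eq show "u x = (\<Sum>k\<in>Basis. c k *\<^sub>R k) + integral {a..x} v"
      by (intro euclidean_eqI[where x = "u x"]) (simp add: inner_add_left)
  qed
  then show ?thesis by blast
qed

lemma AE_eq_0_if_primitive_0:
  fixes w :: "real \<Rightarrow> real^3"
  assumes ab: "a < b" and w: "integrable (lebesgue_on {a<..<b}) w"
    and 0: "\<And>x. x \<in> {a..b} \<Longrightarrow> c + integral {a..x} w = 0"
  shows "AE x in lebesgue_on {a<..<b}. w x = 0"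
proof -
  have c: "c = 0" using 0[of a] ab by simp
  have wi: "w integrable_on {a..b}"
    using w by (auto simp: integrable_Ioo_iff dest: set_lebesgue_integral_eq_integral(1))
  have "AE x in lebesgue_on {a<..<b}. w x \<bullet> k = 0" if k: "k \<in> Basis" for k
  proof (rule AE_eq_0_if_interval_integrals_0)
    show "integrable (lebesgue_on {a<..<b}) (\<lambda>x. w x \<bullet> k)" using w by auto
    fix p q assume pq: "a < p" "p < q" "q < b"
    have i: "w integrable_on {a..q}" "w integrable_on {p..q}"
      using integrable_on_subinterval[OF wi] pq by auto
    have "integral {a..p} w + integral {p..q} w = integral {a..q} w"
      using pq i by (intro Henstock_Kurzweil_Integration.integral_combine) auto
    then have "integral {p..q} w = 0" using 0[of p] 0[of q] pq c by simp
    then show "integral {p..q} (\<lambda>x. w x \<bullet> k) = 0"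
      using integral_component_eq[OF i(2), of k] by simp
  qed
  then have "AE x in lebesgue_on {a<..<b}. \<forall>k\<in>Basis. w x \<bullet> k = 0"
    by (intro AE_finite_allI) auto
  then show ?thesis by (rule AE_mp) (auto intro!: AE_I2 simp: euclidean_eq_iff[of _ "0 :: real^3"])
qed

text \<open>
  Two weak derivatives have primitives that differ by a constant, since both represent \<open>u\<close>.
\<close>

lemma weak_deriv_unique:
  assumes ab: "a < b" and u: "integrable (lebesgue_on {a<..<b}) u"
    and v: "integrable (lebesgue_on {a<..<b}) v" "integrable (lebesgue_on {a<..<b}) v'"
    and uv: "weak_deriv {a<..<b} u v" "weak_deriv {a<..<b} u v'"
  shows "AE x in lebesgue_on {a<..<b}. v x = v' x"
proof -
  let ?M = "lebesgue_on {a<..<b}"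
  obtain c where c: "AE x in ?M. u x = c + integral {a..x} v"
    using weak_deriv_primitive[OF ab u v(1) uv(1)] by blast
  obtain c' where c': "AE x in ?M. u x = c' + integral {a..x} v'"
    using weak_deriv_primitive[OF ab u v(2) uv(2)] by blast
  have vi: "v integrable_on {a..b}" "v' integrable_on {a..b}"
    using v by (auto simp: integrable_Ioo_iff dest: set_lebesgue_integral_eq_integral(1))
  have eq: "(c - c') + integral {a..x} (\<lambda>x. v x - v' x) = (c + integral {a..x} v) - (c' + integral {a..x} v')"
    if "x \<in> {a..b}" for x
    using that integrable_on_subinterval[OF vi(1), of a x] integrable_on_subinterval[OF vi(2), of a x]
    by (subst integral_diff) auto
  have "AE x in ?M. v x - v' x = 0"
  proof (rule AE_eq_0_if_primitive_0[OF ab])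
    show "integrable ?M (\<lambda>x. v x - v' x)" using v by auto
    fix x assume x: "x \<in> {a..b}"
    show "(c - c') + integral {a..x} (\<lambda>x. v x - v' x) = 0"
      unfolding eq[OF x]
      by (rule continuous_AE_eq_0[OF ab _ _ x])
        (use c c' in \<open>auto intro!: continuous_on_diff primitive_continuous v elim: AE_mp\<close>)
  qed
  then show ?thesis by simp
qed

lemma weak_deriv_diff:
  assumes "integrable (lebesgue_on {a<..<b}) u" "integrable (lebesgue_on {a<..<b}) v"
    and "integrable (lebesgue_on {a<..<b}) u'" "integrable (lebesgue_on {a<..<b}) v'"
    and "weak_deriv {a<..<b} u v" "weak_deriv {a<..<b} u' v'"
  shows "weak_deriv {a<..<b} (\<lambda>x. u x - u' x) (\<lambda>x. v x - v' x)"
  unfolding weak_deriv_def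
proof
  fix \<phi> assume \<phi>: "\<phi> \<in> test_functions {a<..<b}"
  then have s: "smooth \<phi>" "smooth (deriv \<phi>)" by (auto intro: test_function_smooth smooth_deriv)
  show "(LINT x|lebesgue_on {a<..<b}. deriv \<phi> x *\<^sub>R (u x - u' x)) = - (LINT x|lebesgue_on {a<..<b}. \<phi> x *\<^sub>R (v x - v' x))"
    using assms \<phi> s by (simp add: weak_deriv_def scaleR_diff_right integrable_scaleR_continuous smooth_continuous)
qed

lemma weak_deriv_const: "weak_deriv {a<..<b} (\<lambda>x. c) (\<lambda>x. 0)"
  unfolding weak_deriv_def
proof
  fix \<phi> assume \<phi>: "\<phi> \<in> test_functions {a<..<b}"
  then have s: "smooth \<phi>" "smooth (deriv \<phi>)" by (auto intro: test_function_smooth smooth_deriv)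
  have d: "integrable (lebesgue_on {a<..<b}) (deriv \<phi>)"
    by (intro integrable_Ioo_continuous smooth_continuous s)
  have "(LINT x|lebesgue_on {a<..<b}. deriv \<phi> x) = 0"
  proof (cases "a \<le> b")
    case True
    then have "(deriv \<phi> has_integral (\<phi> b - \<phi> a)) {a..b}"
      by (intro fundamental_theorem_of_calculus)
        (auto simp: has_real_derivative_iff_has_vector_derivative[symmetric]
          intro!: smooth_has_derivative[OF s(1)] has_field_derivative_at_within)
    then show ?thesis using test_function_eq_0[OF \<phi>] by (simp add: LINT_Ioo[OF d] integral_unique)
  qed (simp add: LINT_Ioo[OF d])
  with d show "(LINT x|lebesgue_on {a<..<b}. deriv \<phi> x *\<^sub>R c) = - (LINT x|lebesgue_on {a<..<b}. \<phi> x *\<^sub>R 0)"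
    by simp
qed

lemma D_weak_deriv:
  assumes "v \<in> L2 \<Omega>" "weak_deriv \<Omega> u v"
  shows "D \<Omega> u \<in> L2 \<Omega>" "weak_deriv \<Omega> u (D \<Omega> u)"
  unfolding D_def using someI[of "\<lambda>v. v \<in> L2 \<Omega> \<and> weak_deriv \<Omega> u v" v] assms by auto

lemma D_AE_eq:
  assumes "a < b" "u \<in> L2 {a<..<b}" "v \<in> L2 {a<..<b}" "weak_deriv {a<..<b} u v"
  shows "AE x in lebesgue_on {a<..<b}. D {a<..<b} u x = v x"
  using D_weak_deriv[OF assms(3,4)] assms by (intro weak_deriv_unique[of a b u]) (auto intro: L2_integrable)

lemma H1_L2: "u \<in> H1 \<Omega> \<Longrightarrow> u \<in> L2 \<Omega>" by (simp add: H1_def)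

lemma H1_D: "u \<in> H1 \<Omega> \<Longrightarrow> D \<Omega> u \<in> L2 \<Omega>" "u \<in> H1 \<Omega> \<Longrightarrow> weak_deriv \<Omega> u (D \<Omega> u)"
  using D_weak_deriv by (auto simp: H1_def)

lemma D_diff_AE_eq:
  assumes "a < b" "u \<in> H1 {a<..<b}" "v \<in> H1 {a<..<b}"
  shows "AE x in lebesgue_on {a<..<b}. D {a<..<b} (\<lambda>x. u x - v x) x = D {a<..<b} u x - D {a<..<b} v x"
  using assms by (intro D_AE_eq weak_deriv_diff L2_diff L2_integrable H1_D) (auto intro: H1_L2)

lemma D_diff_const_AE_eq:
  assumes "a < b" "u \<in> H1 {a<..<b}"
  shows "AE x in lebesgue_on {a<..<b}. D {a<..<b} (\<lambda>x. u x - c) x = D {a<..<b} u x"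
proof -
  note u = H1_L2[OF assms(2)] H1_D[OF assms(2)]
  have c: "(\<lambda>x. c) \<in> L2 {a<..<b}" by (rule L2_continuous) simp
  have "weak_deriv {a<..<b} (\<lambda>x. u x - c) (\<lambda>x. D {a<..<b} u x - 0)"
    by (rule weak_deriv_diff[OF _ _ _ _ u(3) weak_deriv_const]) (use u c in \<open>auto intro: L2_integrable\<close>)
  with u show ?thesis
    by (intro D_AE_eq[OF assms(1) L2_diff[OF u(1) c]]) auto
qed

lemma weak_deriv_cong_AE:
  assumes u: "integrable (lebesgue_on {a<..<b}) u" "integrable (lebesgue_on {a<..<b}) u'"
    and eq: "AE x in lebesgue_on {a<..<b}. u x = u' x" and uv: "weak_deriv {a<..<b} u v"
  shows "weak_deriv {a<..<b} u' v"
  unfolding weak_deriv_def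
proof
  fix \<phi> assume \<phi>: "\<phi> \<in> test_functions {a<..<b}"
  then have s: "smooth (deriv \<phi>)" by (auto intro: test_function_smooth smooth_deriv)
  have "(LINT x|lebesgue_on {a<..<b}. deriv \<phi> x *\<^sub>R u' x) = (LINT x|lebesgue_on {a<..<b}. deriv \<phi> x *\<^sub>R u x)"
    using u s eq
    by (intro Bochner_Integration.integral_cong_AE borel_measurable_integrable integrable_scaleR_continuous
        smooth_continuous) auto
  then show "(LINT x|lebesgue_on {a<..<b}. deriv \<phi> x *\<^sub>R u' x) = - (LINT x|lebesgue_on {a<..<b}. \<phi> x *\<^sub>R v x)"
    using uv \<phi> by (simp add: weak_deriv_def)
qed

lemma D_cong_AE:
  assumes ab: "a < b" and u: "u \<in> H1 {a<..<b}" and v: "v \<in> H1 {a<..<b}"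
    and eq: "AE x in lebesgue_on {a<..<b}. u x = v x"
  shows "AE x in lebesgue_on {a<..<b}. D {a<..<b} u x = D {a<..<b} v x"
proof (rule D_AE_eq[OF ab H1_L2[OF u] H1_D(1)[OF v]])
  have "AE x in lebesgue_on {a<..<b}. v x = u x" using eq by (rule eventually_mono) simp
  then show "weak_deriv {a<..<b} u (D {a<..<b} v)"
    by (intro weak_deriv_cong_AE[OF _ _ _ H1_D(2)[OF v]] L2_integrable H1_L2 u v)
qed

lemma L2_norm_le_H1_norm: "L2_norm \<Omega> u \<le> H1_norm \<Omega> u"
  unfolding H1_norm_def by (rule real_le_rsqrt) simp

lemma L2_norm_D_le_H1_norm: "L2_norm \<Omega> (D \<Omega> u) \<le> H1_norm \<Omega> u"
  unfolding H1_norm_def by (rule real_le_rsqrt) simp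

lemma H1_norm_diff_const_square:
  assumes "a < b" "u \<in> H1 {a<..<b}"
  shows "(H1_norm {a<..<b} (\<lambda>x. u x - c))\<^sup>2 =
    (L2_norm {a<..<b} (\<lambda>x. u x - c))\<^sup>2 + (L2_norm {a<..<b} (D {a<..<b} u))\<^sup>2"
proof -
  have "L2_norm {a<..<b} (D {a<..<b} u) = L2_norm {a<..<b} (D {a<..<b} (\<lambda>x. u x - c))"
    using D_diff_const_AE_eq[OF assms, of c] H1_D(1)[OF assms(2)]
    by (intro L2_norm_cong_AE) auto
  then show ?thesis by (simp add: H1_norm_def)
qed

section \<open>Completeness of the cosines\<close>

lemma L2_dominated_convergence:
  assumes "\<And>n. s n \<in> L2 \<Omega>" "u \<in> L2 \<Omega>" "AE x in lebesgue_on \<Omega>. (\<lambda>n. s n x) \<longlonglongrightarrow> u x"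
    and "integrable (lebesgue_on \<Omega>) w" "\<And>n. AE x in lebesgue_on \<Omega>. (norm (s n x - u x))\<^sup>2 \<le> w x"
  shows "(\<lambda>n. L2_norm \<Omega> (\<lambda>x. s n x - u x)) \<longlonglongrightarrow> 0"
proof -
  have "(\<lambda>n. LINT x|lebesgue_on \<Omega>. (norm (s n x - u x))\<^sup>2) \<longlonglongrightarrow> (LINT x|lebesgue_on \<Omega>. 0)"
  proof (rule integral_dominated_convergence[OF _ _ assms(4)])
    show "(\<lambda>x. (norm (s n x - u x))\<^sup>2) \<in> borel_measurable (lebesgue_on \<Omega>)" for n
      using L2_square_integrable[OF L2_diff[OF assms(1,2)]] by auto
    show "AE x in lebesgue_on \<Omega>. (\<lambda>n. (norm (s n x - u x))\<^sup>2) \<longlonglongrightarrow> 0"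
      using assms(3)
    proof (rule AE_mp, intro AE_I2 impI)
      fix x assume "(\<lambda>n. s n x) \<longlonglongrightarrow> u x"
      then have "(\<lambda>n. (norm (s n x - u x))\<^sup>2) \<longlonglongrightarrow> (norm (u x - u x))\<^sup>2" by (intro tendsto_intros)
      then show "(\<lambda>n. (norm (s n x - u x))\<^sup>2) \<longlonglongrightarrow> 0" by simp
    qed
  qed (use assms(5) in auto)
  then have "(\<lambda>n. sqrt (LINT x|lebesgue_on \<Omega>. (norm (s n x - u x))\<^sup>2)) \<longlonglongrightarrow> sqrt 0"
    by (intro tendsto_real_sqrt) simp
  then show ?thesis by (simp add: L2_norm_def)
qed

text \<open>
  First \<open>u\<close> is replaced by its projection to a large ball.  A measurable function is an almost everywhere
  limit of continuous ones, and these may be projected to the same ball, whereupon dominated convergence applies.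
\<close>

lemma continuous_dense_L2:
  assumes u: "u \<in> L2 {a<..<b}" and e: "e > 0"
  obtains g where "continuous_on UNIV g" "L2_norm {a<..<b} (\<lambda>x. u x - g x) < e"
proof -
  let ?M = "lebesgue_on {a<..<b}"
  define \<tau> where "\<tau> m y = closest_point (cball 0 (real (Suc m))) y" for m and y :: "real^3"
  have \<tau>c: "continuous_on UNIV (\<tau> m)" for m
    unfolding \<tau>_def[abs_def] by (rule continuous_on_closest_point) auto
  have \<tau>b: "norm (\<tau> m y) \<le> real (Suc m)" for m y
    using closest_point_in_set[of "cball 0 (real (Suc m))" y] by (auto simp: \<tau>_def)
  have \<tau>d: "norm (\<tau> m y - y) \<le> norm y" for m y
    using closest_point_le[of "cball 0 (real (Suc m))" 0 y] by (simp add: \<tau>_def dist_norm norm_minus_commute)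
  have \<tau>l: "(\<lambda>m. \<tau> m y) \<longlonglongrightarrow> y" for y
  proof (rule tendsto_eventually, rule eventually_sequentiallyI)
    fix m assume "m \<ge> nat \<lceil>norm y\<rceil>"
    then have "norm y \<le> real (Suc m)" by linarith
    then show "\<tau> m y = y" unfolding \<tau>_def by (intro closest_point_self) auto
  qed
  have \<tau>L2: "(\<lambda>x. \<tau> m (v x)) \<in> L2 {a<..<b}" if "v \<in> borel_measurable ?M" for m v
  proof -
    have m: "(\<lambda>x. \<tau> m (v x)) \<in> borel_measurable ?M"
      by (rule measurable_compose[OF that borel_measurable_continuous_onI[OF \<tau>c]])
    have "integrable ?M (\<lambda>x. (norm (\<tau> m (v x)))\<^sup>2)"
    proof (rule Bochner_Integration.integrable_bound)
      show "integrable ?M (\<lambda>x. (real (Suc m))\<^sup>2)" by (rule integrable_Ioo_continuous) simp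
      show "AE x in ?M. norm ((norm (\<tau> m (v x)))\<^sup>2) \<le> norm ((real (Suc m))\<^sup>2)"
        by (intro AE_I2) (use \<tau>b in \<open>simp add: power_mono del: of_nat_Suc\<close>)
    qed (use m in auto)
    with m show ?thesis by (simp add: L2_def)
  qed
  note um = L2_measurable[OF u]
  have "(\<lambda>m. L2_norm {a<..<b} (\<lambda>x. \<tau> m (u x) - u x)) \<longlonglongrightarrow> 0"
    by (rule L2_dominated_convergence[OF \<tau>L2[OF um] u _ L2_square_integrable[OF u]])
      (use \<tau>l \<tau>d in \<open>auto intro!: AE_I2 power_mono\<close>)
  then have "eventually (\<lambda>m. L2_norm {a<..<b} (\<lambda>x. \<tau> m (u x) - u x) < e / 2) sequentially"
    by (rule order_tendstoD) (use e in simp)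
  then obtain m where m: "L2_norm {a<..<b} (\<lambda>x. \<tau> m (u x) - u x) < e / 2"
    by (auto simp: eventually_sequentially)
  have "u measurable_on {a<..<b}" using um by (simp add: measurable_on_iff_borel_measurable)
  then obtain N h where N: "negligible N" and h: "\<And>n. continuous_on UNIV (h n)"
    and hu: "\<And>x. x \<notin> N \<Longrightarrow> (\<lambda>n. h n x) \<longlonglongrightarrow> (if x \<in> {a<..<b} then u x else 0)"
    unfolding measurable_on_def by metis
  have hc: "continuous_on UNIV (\<lambda>x. \<tau> m (h n x))" for n
    using continuous_on_compose2[OF \<tau>c h] by auto
  have "(\<lambda>n. L2_norm {a<..<b} (\<lambda>x. \<tau> m (h n x) - \<tau> m (u x))) \<longlonglongrightarrow> 0"
  proof (rule L2_dominated_convergence[OF _ \<tau>L2[OF um]])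
    show "(\<lambda>x. \<tau> m (h n x)) \<in> L2 {a<..<b}" for n
      by (rule L2_continuous) (use hc continuous_on_subset in blast)
    have "AE x in lebesgue. x \<notin> N"
      using N by (simp add: negligible_iff_null_sets AE_not_in)
    then have "AE x in ?M. x \<notin> N" by (auto simp: AE_restrict_space_iff)
    then show "AE x in ?M. (\<lambda>n. \<tau> m (h n x)) \<longlonglongrightarrow> \<tau> m (u x)"
    proof (rule AE_mp, intro AE_I2 impI)
      fix x assume "x \<in> space ?M" "x \<notin> N"
      then have "(\<lambda>n. h n x) \<longlonglongrightarrow> u x" using hu[of x] by simp
      then show "(\<lambda>n. \<tau> m (h n x)) \<longlonglongrightarrow> \<tau> m (u x)"
        by (rule continuous_on_tendsto_compose[OF \<tau>c]) auto
    qed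
    show "integrable ?M (\<lambda>x. (2 * real (Suc m))\<^sup>2)" by (rule integrable_Ioo_continuous) simp
    have "norm (\<tau> m y - \<tau> m z) \<le> 2 * real (Suc m)" for y z
    proof -
      have "norm (\<tau> m y - \<tau> m z) \<le> norm (\<tau> m y) + norm (\<tau> m z)" by (rule norm_triangle_ineq4)
      also have "\<dots> \<le> real (Suc m) + real (Suc m)" by (intro add_mono \<tau>b)
      finally show ?thesis by simp
    qed
    then show "AE x in ?M. (norm (\<tau> m (h n x) - \<tau> m (u x)))\<^sup>2 \<le> (2 * real (Suc m))\<^sup>2" for n
      by (intro AE_I2 power_mono) auto
  qed
  then have "eventually (\<lambda>n. L2_norm {a<..<b} (\<lambda>x. \<tau> m (h n x) - \<tau> m (u x)) < e / 2) sequentially"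
    by (rule order_tendstoD) (use e in simp)
  then obtain n where n: "L2_norm {a<..<b} (\<lambda>x. \<tau> m (h n x) - \<tau> m (u x)) < e / 2"
    by (auto simp: eventually_sequentially)
  have hL: "(\<lambda>x. \<tau> m (h n x)) \<in> L2 {a<..<b}"
    by (rule L2_continuous) (use hc continuous_on_subset in blast)
  have "L2_norm {a<..<b} (\<lambda>x. u x - \<tau> m (h n x)) = L2_norm {a<..<b} (\<lambda>x. (\<tau> m (h n x) - \<tau> m (u x)) + (\<tau> m (u x) - u x))"
    by (simp add: L2_norm_minus_commute[of _ u])
  also have "\<dots> \<le> L2_norm {a<..<b} (\<lambda>x. \<tau> m (h n x) - \<tau> m (u x)) + L2_norm {a<..<b} (\<lambda>x. \<tau> m (u x) - u x)"
    by (intro L2_norm_triangle L2_diff hL \<tau>L2 um u)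
  also have "\<dots> < e" using m n by simp
  finally show thesis using that hc by blast
qed

text \<open>
  Only the even trigonometric polynomials occur, because they satisfy the Neumann boundary condition.
\<close>

inductive cosine_polynomial :: "real \<Rightarrow> real \<Rightarrow> (real \<Rightarrow> real) \<Rightarrow> bool" for a b where
  cosine: "cosine_polynomial a b (\<lambda>x. c * cos (real k * (pi * (x - a) / (b - a))))"
| add: "cosine_polynomial a b q \<Longrightarrow> cosine_polynomial a b g \<Longrightarrow> cosine_polynomial a b (\<lambda>x. q x + g x)"

lemma cosine_polynomial_mult:
  assumes "cosine_polynomial a b q" "cosine_polynomial a b g"
  shows "cosine_polynomial a b (\<lambda>x. q x * g x)"
  using assms(1)
proof induction
  case (cosine c k)
  show ?case using assms(2)
  proof induction
    case (cosine d l)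
    have product: "c * cos (real k * t) * (d * cos (real l * t)) =
      (c * d / 2) * cos (real (k + l) * t) + (c * d / 2) * cos (real (max k l - min k l) * t)" for t
    proof -
      have "cos (real (max k l - min k l) * t) = cos (real k * t - real l * t)"
        by (cases "k \<le> l") (auto simp: of_nat_diff algebra_simps max_def min_def cos_diff)
      then show ?thesis by (simp add: cos_add cos_diff distrib_right algebra_simps)
    qed
    show ?case unfolding product by (intro cosine_polynomial.intros)
  next
    case (add q g)
    then show ?case by (simp add: distrib_left cosine_polynomial.add)
  qed
next
  case (add q h)
  then show ?case by (simp add: distrib_right cosine_polynomial.add)
qed

text \<open>
  The theorem of Stone and Weierstrass applies since already the first cosine is injective on the interval.
\<close>

lemma cosine_polynomials_uniformly_dense:
  fixes q :: "real \<Rightarrow> real"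
  assumes ab: "a < b" and "continuous_on {a..b} q" "e > 0"
  shows "\<exists>g. cosine_polynomial a b g \<and> (\<forall>x\<in>{a..b}. \<bar>q x - g x\<bar> < e)"
proof (rule Stone_Weierstrass_HOL[OF compact_Icc])
  show "cosine_polynomial a b (\<lambda>x. c)" for c
    using cosine_polynomial.cosine[of a b c 0] by simp
  show "continuous_on {a..b} g" if "cosine_polynomial a b g" for g
    using that by induction (use ab in \<open>auto intro!: continuous_intros\<close>)
  fix x y assume xy: "x \<in> {a..b} \<and> y \<in> {a..b} \<and> x \<noteq> y"
  define t where "t x = pi * (x - a) / (b - a)" for x
  have "0 \<le> t x" "t x \<le> pi" "0 \<le> t y" "t y \<le> pi" "t x \<noteq> t y"
    using xy ab by (auto simp: t_def field_simps)
  then have "cos (t x) \<noteq> cos (t y)" using cos_inj_pi by blast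
  then show "\<exists>q. cosine_polynomial a b q \<and> q x \<noteq> q y"
    using cosine_polynomial.cosine[of a b 1 1] by (intro exI conjI) (auto simp: t_def)
qed (use assms cosine_polynomial_mult in \<open>auto intro: cosine_polynomial.add\<close>)

text \<open>
  The vector valued eigenfunctions of the Neumann Laplacian are indexed by a frequency and a direction.
\<close>

definition cosine_mode :: "real \<Rightarrow> real \<Rightarrow> nat \<times> (real^3) \<Rightarrow> real \<Rightarrow> real^3" where
  "cosine_mode a b p x = cos (real (fst p) * (pi * (x - a) / (b - a))) *\<^sub>R snd p"

definition modes :: "nat \<Rightarrow> (nat \<times> (real^3)) set" where
  "modes n = {..<n} \<times> Basis"

lemma finite_modes: "finite (modes n)" by (simp add: modes_def)

lemma cosine_mode_L2: "a < b \<Longrightarrow> cosine_mode a b p \<in> L2 {a<..<b}"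
  unfolding cosine_mode_def[abs_def] by (intro L2_continuous continuous_intros) auto

definition cosine_sum :: "real \<Rightarrow> real \<Rightarrow> (real \<Rightarrow> real^3) \<Rightarrow> bool" where
  "cosine_sum a b q \<longleftrightarrow> (\<exists>n c. \<forall>x. q x = (\<Sum>p\<in>modes n. c p *\<^sub>R cosine_mode a b p x))"

lemma modes_mono: "n \<le> m \<Longrightarrow> modes n \<subseteq> modes m"
  by (auto simp: modes_def)

lemma sum_modes_pad:
  assumes "n \<le> m"
  shows "(\<Sum>p\<in>modes n. c p *\<^sub>R cosine_mode a b p x) =
    (\<Sum>p\<in>modes m. (if p \<in> modes n then c p else 0) *\<^sub>R cosine_mode a b p x)"
  by (rule sum.mono_neutral_cong_left) (use assms modes_mono in \<open>auto simp: finite_modes\<close>)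

lemma cosine_sum_add:
  assumes "cosine_sum a b q" "cosine_sum a b r"
  shows "cosine_sum a b (\<lambda>x. q x + r x)"
proof -
  obtain n c m d where q: "\<And>x. q x = (\<Sum>p\<in>modes n. c p *\<^sub>R cosine_mode a b p x)"
    and r: "\<And>x. r x = (\<Sum>p\<in>modes m. d p *\<^sub>R cosine_mode a b p x)"
    using assms unfolding cosine_sum_def by blast
  let ?c = "\<lambda>p. (if p \<in> modes n then c p else 0) + (if p \<in> modes m then d p else 0)"
  have "q x + r x = (\<Sum>p\<in>modes (max n m). ?c p *\<^sub>R cosine_mode a b p x)" for x
    unfolding q r sum_modes_pad[of n "max n m", simplified] sum_modes_pad[of m "max n m", simplified]
      scaleR_add_left sum.distrib by (rule refl)
  then show ?thesis unfolding cosine_sum_def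
    by (intro exI[of _ "max n m"] exI[of _ ?c]) blast
qed

lemma cosine_polynomial_sum:
  assumes "cosine_polynomial a b q" "i \<in> Basis"
  shows "cosine_sum a b (\<lambda>x. q x *\<^sub>R i)"
  using assms(1)
proof induction
  case (cosine c k)
  have "(c * cos (real k * (pi * (x - a) / (b - a)))) *\<^sub>R i =
      (\<Sum>p\<in>modes (Suc k). (if p = (k, i) then c else 0) *\<^sub>R cosine_mode a b p x)" for x
  proof -
    have "(\<Sum>p\<in>modes (Suc k). (if p = (k, i) then c else 0) *\<^sub>R cosine_mode a b p x) =
        (\<Sum>p\<in>modes (Suc k). if p = (k, i) then c *\<^sub>R cosine_mode a b p x else 0)"
      by (intro sum.cong) auto
    also have "\<dots> = c *\<^sub>R cosine_mode a b (k, i) x"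
      using assms(2) by (subst sum.delta) (auto simp: modes_def)
    finally show ?thesis by (simp add: cosine_mode_def)
  qed
  then show ?case unfolding cosine_sum_def by (intro exI[of _ "Suc k"] exI[of _ "\<lambda>p. if p = (k, i) then c else 0"]) blast
next
  case (add q r)
  then show ?case using cosine_sum_add by (simp add: scaleR_add_left)
qed

lemma cosine_sum_zero: "cosine_sum a b (\<lambda>x. 0)"
  unfolding cosine_sum_def by (intro exI[of _ 0]) (simp add: modes_def)

lemma cosine_sum_sum:
  assumes "finite A" "\<And>i. i \<in> A \<Longrightarrow> cosine_sum a b (q i)"
  shows "cosine_sum a b (\<lambda>x. \<Sum>i\<in>A. q i x)"
  using assms by (induction A rule: finite_induct) (auto intro: cosine_sum_zero cosine_sum_add)

lemma cosine_sum_L2: "a < b \<Longrightarrow> cosine_sum a b q \<Longrightarrow> q \<in> L2 {a<..<b}"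
proof -
  assume ab: "a < b" and "cosine_sum a b q"
  then obtain n c where "q = (\<lambda>x. \<Sum>p\<in>modes n. c p *\<^sub>R cosine_mode a b p x)"
    unfolding cosine_sum_def by blast
  then show ?thesis using ab by (auto intro!: L2_sum finite_modes L2_scaleR cosine_mode_L2)
qed

lemma cosine_sums_dense_L2:
  assumes ab: "a < b" and u: "u \<in> L2 {a<..<b}" and e: "e > 0"
  obtains q where "cosine_sum a b q" "L2_norm {a<..<b} (\<lambda>x. u x - q x) < e"
proof -
  obtain g where g: "continuous_on UNIV g" and ug: "L2_norm {a<..<b} (\<lambda>x. u x - g x) < e / 2"
    using continuous_dense_L2[OF u, of "e / 2"] e by auto
  \<comment> \<open>a uniform error \<open>3 * d\<close> over the three components amounts to \<open>e / 4\<close> in the norm of \<open>L2\<close>\<close>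
  define d where "d = e / (12 * sqrt (b - a))"
  have d: "d > 0" using e ab by (simp add: d_def)
  have "\<exists>q. cosine_polynomial a b q \<and> (\<forall>x\<in>{a..b}. \<bar>g x \<bullet> i - q x\<bar> < d)" for i
    by (rule cosine_polynomials_uniformly_dense[OF ab _ d])
      (intro continuous_intros continuous_on_subset[OF g], auto)
  then obtain q where q: "\<And>i. cosine_polynomial a b (q i)" "\<And>i x. x \<in> {a..b} \<Longrightarrow> \<bar>g x \<bullet> i - q i x\<bar> < d"
    by metis
  define r where "r x = (\<Sum>i\<in>Basis. q i x *\<^sub>R i)" for x :: real
  have r: "cosine_sum a b r"
    unfolding r_def[abs_def] by (intro cosine_sum_sum cosine_polynomial_sum q) auto
  have rL: "r \<in> L2 {a<..<b}" by (rule cosine_sum_L2[OF ab r])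
  have gL: "g \<in> L2 {a<..<b}" by (rule L2_continuous[OF continuous_on_subset[OF g]]) simp
  have gr: "norm (g x - r x) \<le> 3 * d" if x: "x \<in> {a..b}" for x
  proof -
    have "norm (g x - r x) \<le> (\<Sum>i\<in>Basis. \<bar>(g x - r x) \<bullet> i\<bar>)" by (rule norm_le_l1)
    also have "\<dots> \<le> (\<Sum>i\<in>(Basis :: (real^3) set). d)"
      using q(2)[OF x] by (intro sum_mono) (simp add: r_def inner_diff_left less_imp_le)
    also have "\<dots> = 3 * d" by simp
    finally show ?thesis .
  qed
  have "(LINT x|lebesgue_on {a<..<b}. (norm (g x - r x))\<^sup>2) \<le> (LINT x|lebesgue_on {a<..<b}. (3 * d)\<^sup>2)"
    by (intro integral_mono L2_square_integrable[OF L2_diff[OF gL rL]] integrable_Ioo_continuous power_mono)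
      (use gr in auto)
  also have "\<dots> = (b - a) * (3 * d)\<^sup>2"
    using ab integrable_Ioo_continuous[of a b "\<lambda>_. (3 * d)\<^sup>2"] by (subst LINT_Ioo) auto
  also have "\<dots> = (e / 4)\<^sup>2"
    using ab by (simp add: d_def power_divide power_mult_distrib field_simps)
  finally have "L2_norm {a<..<b} (\<lambda>x. g x - r x) \<le> e / 4"
    unfolding L2_norm_def using e by (intro real_le_lsqrt) auto
  moreover have "L2_norm {a<..<b} (\<lambda>x. u x - r x) \<le> L2_norm {a<..<b} (\<lambda>x. u x - g x) + L2_norm {a<..<b} (\<lambda>x. g x - r x)"
    using L2_norm_triangle[OF L2_diff[OF u gL] L2_diff[OF gL rL]] by simp
  ultimately show thesis using that r ug e by force
qed

lemma LINT_cosine: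
  assumes ab: "a < b" and m: "m \<noteq> 0"
  shows "(LINT x|lebesgue_on {a<..<b}. cos (of_int m * (pi * (x - a) / (b - a)))) = 0"
proof -
  define r where "r = of_int m * pi / (b - a)"
  have r: "r \<noteq> 0" using ab m by (simp add: r_def)
  have rx: "of_int m * (pi * (x - a) / (b - a)) = r * (x - a)" for x by (simp add: r_def)
  let ?F = "\<lambda>x. sin (r * (x - a)) / r"
  have "((\<lambda>x. cos (r * (x - a))) has_integral (?F b - ?F a)) {a..b}"
  proof (rule fundamental_theorem_of_calculus)
    fix x assume "x \<in> {a..b}"
    have "(?F has_real_derivative cos (r * (x - a))) (at x within {a..b})"
      using r by (auto intro!: derivative_eq_intros)
    then show "(?F has_vector_derivative cos (r * (x - a))) (at x within {a..b})"
      by (simp add: has_real_derivative_iff_has_vector_derivative)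
  qed (use ab in simp)
  moreover have "?F b = 0" "?F a = 0"
    using ab sin_zero_iff_int2[of "of_int m * pi"] by (auto simp: r_def)
  ultimately have "integral {a..b} (\<lambda>x. cos (r * (x - a))) = 0"
    by (simp add: integral_unique)
  moreover have "integrable (lebesgue_on {a<..<b}) (\<lambda>x. cos (r * (x - a)))"
    by (intro integrable_Ioo_continuous continuous_intros)
  ultimately show ?thesis unfolding rx by (simp add: LINT_Ioo)
qed

lemma cosine_modes_orthogonal:
  assumes ab: "a < b" and pq: "p \<in> modes n" "q \<in> modes n" "p \<noteq> q"
  shows "L2_inner {a<..<b} (cosine_mode a b p) (cosine_mode a b q) = 0"
proof (cases "snd p = snd q")
  case False
  then have "snd p \<bullet> snd q = 0" using pq by (auto simp: modes_def inner_not_same_Basis)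
  then show ?thesis by (simp add: L2_inner_def cosine_mode_def)
next
  case True
  define k l where "k = int (fst p)" "l = int (fst q)"
  have kl: "k - l \<noteq> 0" "k + l \<noteq> 0" using True pq by (auto simp: k_l_def modes_def prod_eq_iff)
  have one: "snd p \<bullet> snd p = 1" using pq by (auto simp: modes_def inner_same_Basis)
  have eq: "cosine_mode a b p x \<bullet> cosine_mode a b q x =
      (cos (of_int (k + l) * (pi * (x - a) / (b - a))) + cos (of_int (k - l) * (pi * (x - a) / (b - a)))) / 2" for x
  proof -
    have product: "cos (real (fst p) * t) * cos (real (fst q) * t) = (cos (of_int (k + l) * t) + cos (of_int (k - l) * t)) / 2" for t
      by (simp add: k_l_def distrib_right left_diff_distrib cos_add cos_diff)
    have "cosine_mode a b p x \<bullet> cosine_mode a b q x =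
        cos (real (fst p) * (pi * (x - a) / (b - a))) * cos (real (fst q) * (pi * (x - a) / (b - a)))"
      using True one by (simp add: cosine_mode_def)
    then show ?thesis unfolding product .
  qed
  have "integrable (lebesgue_on {a<..<b}) (\<lambda>x. cos (of_int m * (pi * (x - a) / (b - a))))" for m
    using ab by (intro integrable_Ioo_continuous continuous_intros) auto
  then show ?thesis
    unfolding L2_inner_def eq using LINT_cosine[OF ab kl(1)] LINT_cosine[OF ab kl(2)]
    by (simp del: of_int_add of_int_diff)
qed

lemma cosine_mode_norm_pos:
  assumes ab: "a < b" and p: "p \<in> modes n"
  shows "(L2_norm {a<..<b} (cosine_mode a b p))\<^sup>2 > 0"
proof -
  have c: "continuous_on {a..b} (\<lambda>x. cosine_mode a b p x \<bullet> cosine_mode a b p x)"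
    unfolding cosine_mode_def using ab by (intro continuous_intros) auto
  have "integral {a..b} (\<lambda>x. cosine_mode a b p x \<bullet> cosine_mode a b p x) \<noteq> 0"
  proof
    assume "integral {a..b} (\<lambda>x. cosine_mode a b p x \<bullet> cosine_mode a b p x) = 0"
    then have "\<forall>x\<in>{a..b}. cosine_mode a b p x \<bullet> cosine_mode a b p x = 0"
      using integral_eq_0_iff[OF c] ab by auto
    then have "cosine_mode a b p a = 0" using ab by auto
    then show False using p by (auto simp: cosine_mode_def modes_def nonzero_Basis)
  qed
  then have "(L2_norm {a<..<b} (cosine_mode a b p))\<^sup>2 \<noteq> 0"
    using LINT_Ioo[OF integrable_Ioo_continuous[OF c]] by (simp add: L2_norm_square L2_inner_def)
  then show ?thesis by (metis zero_le_power2 le_less)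
qed

definition cosine_coeff :: "real \<Rightarrow> real \<Rightarrow> (real \<Rightarrow> real^3) \<Rightarrow> nat \<times> (real^3) \<Rightarrow> real" where
  "cosine_coeff a b u p = L2_inner {a<..<b} u (cosine_mode a b p)"

definition mode_weight :: "real \<Rightarrow> real \<Rightarrow> nat \<times> (real^3) \<Rightarrow> real" where
  "mode_weight a b p = (L2_norm {a<..<b} (cosine_mode a b p))\<^sup>2"

lemma L2_norm_diff_cosine_sum_square:
  assumes ab: "a < b" and u: "u \<in> L2 {a<..<b}"
  shows "(L2_norm {a<..<b} (\<lambda>x. u x - (\<Sum>p\<in>modes n. c p *\<^sub>R cosine_mode a b p x)))\<^sup>2 =
    (L2_norm {a<..<b} u)\<^sup>2 - 2 * (\<Sum>p\<in>modes n. c p * cosine_coeff a b u p) + (\<Sum>p\<in>modes n. (c p)\<^sup>2 * mode_weight a b p)"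
proof -
  let ?q = "\<lambda>x. \<Sum>p\<in>modes n. c p *\<^sub>R cosine_mode a b p x"
  have eL: "(\<lambda>x. c p *\<^sub>R cosine_mode a b p x) \<in> L2 {a<..<b}" for p
    by (intro L2_scaleR cosine_mode_L2 ab)
  have q: "?q \<in> L2 {a<..<b}" by (intro L2_sum finite_modes eL)
  have qv: "L2_inner {a<..<b} ?q v = (\<Sum>p\<in>modes n. c p * cosine_coeff a b v p)" if "v \<in> L2 {a<..<b}" for v
    using L2_inner_sum_left[OF finite_modes eL that]
    by (simp add: L2_inner_scaleR_left cosine_coeff_def L2_inner_commute[of _ v])
  have "cosine_coeff a b ?q p = c p * mode_weight a b p" if p: "p \<in> modes n" for p
  proof -
    have "cosine_coeff a b ?q p = (\<Sum>r\<in>modes n. c r * cosine_coeff a b (cosine_mode a b p) r)"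
      unfolding cosine_coeff_def[of a b ?q] by (rule qv[OF cosine_mode_L2[OF ab]])
    also have "\<dots> = (\<Sum>r\<in>modes n. if r = p then c p * mode_weight a b p else 0)"
      using p cosine_modes_orthogonal[OF ab p]
      by (intro sum.cong) (auto simp: cosine_coeff_def mode_weight_def L2_norm_square)
    also have "\<dots> = c p * mode_weight a b p" using p finite_modes by (simp add: sum.delta)
    finally show ?thesis .
  qed
  then have "(L2_norm {a<..<b} ?q)\<^sup>2 = (\<Sum>p\<in>modes n. (c p)\<^sup>2 * mode_weight a b p)"
    unfolding L2_norm_square qv[OF q] by (intro sum.cong) (auto simp: power2_eq_square)
  then show ?thesis
    unfolding L2_norm_diff_square[OF u q] L2_inner_commute[of _ u ?q] qv[OF u] by simp
qed

text \<open>
  The inner product of the projections of \<open>u\<close> and \<open>v\<close> to the span of the first modes.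
\<close>

definition cosine_product :: "real \<Rightarrow> real \<Rightarrow> nat \<Rightarrow> (real \<Rightarrow> real^3) \<Rightarrow> (real \<Rightarrow> real^3) \<Rightarrow> real" where
  "cosine_product a b n u v = (\<Sum>p\<in>modes n. cosine_coeff a b u p * cosine_coeff a b v p / mode_weight a b p)"

definition cosine_projection :: "real \<Rightarrow> real \<Rightarrow> nat \<Rightarrow> (real \<Rightarrow> real^3) \<Rightarrow> real \<Rightarrow> real^3" where
  "cosine_projection a b n u x = (\<Sum>p\<in>modes n. (cosine_coeff a b u p / mode_weight a b p) *\<^sub>R cosine_mode a b p x)"

lemma cosine_projection_L2: "a < b \<Longrightarrow> cosine_projection a b n u \<in> L2 {a<..<b}"
  unfolding cosine_projection_def[abs_def] by (intro L2_sum finite_modes L2_scaleR cosine_mode_L2)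

lemma cosine_projection_inner:
  assumes "a < b" "v \<in> L2 {a<..<b}"
  shows "L2_inner {a<..<b} (cosine_projection a b n u) v = cosine_product a b n u v"
proof -
  have "(\<lambda>x. (cosine_coeff a b u p / mode_weight a b p) *\<^sub>R cosine_mode a b p x) \<in> L2 {a<..<b}" for p
    using assms by (intro L2_scaleR cosine_mode_L2)
  then show ?thesis
    unfolding cosine_projection_def[abs_def] cosine_product_def
    using L2_inner_sum_left[OF finite_modes _ assms(2)]
    by (simp add: L2_inner_scaleR_left cosine_coeff_def L2_inner_commute[of _ v])
qed

text \<open>
  Completing the square separately for every coefficient: the Fourier coefficients minimize
  the distance to the span of the modes.
\<close>

lemma cosine_projection_best:
  assumes ab: "a < b" and u: "u \<in> L2 {a<..<b}"
  shows "L2_norm {a<..<b} (\<lambda>x. u x - cosine_projection a b n u x)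
    \<le> L2_norm {a<..<b} (\<lambda>x. u x - (\<Sum>p\<in>modes n. c p *\<^sub>R cosine_mode a b p x))"
proof (rule power2_le_imp_le)
  have w: "mode_weight a b p > 0" if "p \<in> modes n" for p
    using cosine_mode_norm_pos[OF ab that] by (simp add: mode_weight_def)
  have "(\<Sum>p\<in>modes n. (cosine_coeff a b u p / mode_weight a b p)\<^sup>2 * mode_weight a b p)
      - 2 * (\<Sum>p\<in>modes n. cosine_coeff a b u p / mode_weight a b p * cosine_coeff a b u p)
    = (\<Sum>p\<in>modes n. - ((cosine_coeff a b u p)\<^sup>2 / mode_weight a b p))"
    unfolding sum_distrib_left sum_subtractf[symmetric]
    by (intro sum.cong refl) (use w in \<open>simp add: field_simps power2_eq_square less_imp_neq[symmetric]\<close>)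
  also have "\<dots> \<le> (\<Sum>p\<in>modes n. (c p)\<^sup>2 * mode_weight a b p - 2 * (c p * cosine_coeff a b u p))"
  proof (rule sum_mono)
    fix p assume p: "p \<in> modes n"
    have "0 \<le> (c p * mode_weight a b p - cosine_coeff a b u p)\<^sup>2 / mode_weight a b p"
      using w[OF p] by simp
    also have "\<dots> = (c p)\<^sup>2 * mode_weight a b p - 2 * (c p * cosine_coeff a b u p) + (cosine_coeff a b u p)\<^sup>2 / mode_weight a b p"
      using w[OF p] by (simp add: field_simps power2_eq_square)
    finally show "- ((cosine_coeff a b u p)\<^sup>2 / mode_weight a b p) \<le> (c p)\<^sup>2 * mode_weight a b p - 2 * (c p * cosine_coeff a b u p)"
      by simp
  qed
  finally show "(L2_norm {a<..<b} (\<lambda>x. u x - cosine_projection a b n u x))\<^sup>2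
    \<le> (L2_norm {a<..<b} (\<lambda>x. u x - (\<Sum>p\<in>modes n. c p *\<^sub>R cosine_mode a b p x)))\<^sup>2"
    unfolding cosine_projection_def L2_norm_diff_cosine_sum_square[OF ab u]
    by (simp add: sum_subtractf sum_distrib_left)
qed (rule L2_norm_nonneg)

lemma cosine_projection_norm_le:
  assumes ab: "a < b" and u: "u \<in> L2 {a<..<b}"
  shows "L2_norm {a<..<b} (cosine_projection a b n u) \<le> 2 * L2_norm {a<..<b} u"
proof -
  have "L2_norm {a<..<b} (\<lambda>x. u x - cosine_projection a b n u x) \<le> L2_norm {a<..<b} u"
    using cosine_projection_best[OF ab u, of n "\<lambda>_. 0"] by simp
  moreover have "\<bar>L2_norm {a<..<b} u - L2_norm {a<..<b} (cosine_projection a b n u)\<bar> \<le>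
      L2_norm {a<..<b} (\<lambda>x. u x - cosine_projection a b n u x)"
    by (rule L2_norm_reverse_triangle[OF u cosine_projection_L2[OF ab]])
  ultimately show ?thesis by linarith
qed

text \<open>
  A bound that is uniform in \<open>n\<close>, to be used as a majorant.  The factor \<open>2\<close>
  comes from the triangle inequality for \<open>u\<close> and its projection.
\<close>

lemma cosine_product_bound:
  assumes ab: "a < b" and u: "u \<in> L2 {a<..<b}" and v: "v \<in> L2 {a<..<b}"
  shows "\<bar>cosine_product a b n u v\<bar> \<le> 2 * L2_norm {a<..<b} u * L2_norm {a<..<b} v"
proof -
  have "\<bar>cosine_product a b n u v\<bar> \<le> L2_norm {a<..<b} (cosine_projection a b n u) * L2_norm {a<..<b} v"
    unfolding cosine_projection_inner[OF ab v, symmetric]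
    by (rule L2_Cauchy_Schwarz[OF cosine_projection_L2[OF ab] v])
  also have "\<dots> \<le> 2 * L2_norm {a<..<b} u * L2_norm {a<..<b} v"
    by (intro mult_right_mono cosine_projection_norm_le assms L2_norm_nonneg)
  finally show ?thesis .
qed

lemma cosine_projection_tendsto:
  assumes ab: "a < b" and u: "u \<in> L2 {a<..<b}"
  shows "(\<lambda>n. L2_norm {a<..<b} (\<lambda>x. u x - cosine_projection a b n u x)) \<longlonglongrightarrow> 0"
proof (rule LIMSEQ_I)
  fix e :: real assume "e > 0"
  then obtain q where q: "cosine_sum a b q" "L2_norm {a<..<b} (\<lambda>x. u x - q x) < e"
    using cosine_sums_dense_L2[OF ab u] by blast
  obtain n c where qc: "\<And>x. q x = (\<Sum>p\<in>modes n. c p *\<^sub>R cosine_mode a b p x)"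
    using q(1) unfolding cosine_sum_def by blast
  have "L2_norm {a<..<b} (\<lambda>x. u x - cosine_projection a b m u x) < e" if "m \<ge> n" for m
    using cosine_projection_best[OF ab u, of m "\<lambda>p. if p \<in> modes n then c p else 0"] q(2)
    unfolding qc sum_modes_pad[OF that] by simp
  then show "\<exists>n. \<forall>m\<ge>n. norm (L2_norm {a<..<b} (\<lambda>x. u x - cosine_projection a b m u x) - 0) < e"
    by (intro exI[of _ n]) (simp add: L2_norm_nonneg)
qed

lemma cosine_Parseval:
  assumes ab: "a < b" and u: "u \<in> L2 {a<..<b}" and v: "v \<in> L2 {a<..<b}"
  shows "(\<lambda>n. cosine_product a b n u v) \<longlonglongrightarrow> L2_inner {a<..<b} u v"
proof (rule LIM_zero_cancel, rule Lim_null_comparison)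
  show "(\<lambda>n. L2_norm {a<..<b} (\<lambda>x. u x - cosine_projection a b n u x) * L2_norm {a<..<b} v) \<longlonglongrightarrow> 0"
    using cosine_projection_tendsto[OF ab u] by (rule tendsto_mult_left_zero)
  have "norm (cosine_product a b n u v - L2_inner {a<..<b} u v)
      \<le> L2_norm {a<..<b} (\<lambda>x. u x - cosine_projection a b n u x) * L2_norm {a<..<b} v" for n
    using L2_Cauchy_Schwarz[OF L2_diff[OF u cosine_projection_L2[OF ab]] v, of n u]
    by (simp add: L2_inner_diff_left[OF u cosine_projection_L2[OF ab] v] cosine_projection_inner[OF ab v]
        abs_minus_commute)
  then show "eventually (\<lambda>n. norm (cosine_product a b n u v - L2_inner {a<..<b} u v)
      \<le> L2_norm {a<..<b} (\<lambda>x. u x - cosine_projection a b n u x) * L2_norm {a<..<b} v) sequentially"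
    by simp
qed

section \<open>The domain of the Neumann Laplacian\<close>

text \<open>
  The regular representatives of a function in the domain of the Neumann Laplacian, of its derivative and of
  its second derivative: \<open>U\<close> is continuously differentiable, \<open>V\<close> is absolutely continuous and vanishes on the
  boundary, and \<open>W\<close> is merely square integrable.
\<close>

definition neumann_rep ::
  "real \<Rightarrow> real \<Rightarrow> (real \<Rightarrow> real^3) \<Rightarrow> (real \<Rightarrow> real^3) \<Rightarrow> (real \<Rightarrow> real^3) \<Rightarrow> bool" where
  "neumann_rep a b U V W \<longleftrightarrow>
     (\<forall>x\<in>{a..b}. (U has_vector_derivative V x) (at x within {a..b})) \<and>
     continuous_on {a..b} V \<and> V a = 0 \<and> V b = 0 \<and> W \<in> L2 {a<..<b} \<and>
     (\<forall>x\<in>{a..b}. V x = integral {a..x} W)"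

lemma neumann_domain_rep:
  assumes ab: "a < b" and u: "u \<in> neumann_domain {a<..<b}"
  obtains U V where "neumann_rep a b U V (Laplacian {a<..<b} u)"
    "AE x in lebesgue_on {a<..<b}. u x = U x" "AE x in lebesgue_on {a<..<b}. D {a<..<b} u x = V x"
proof -
  let ?M = "lebesgue_on {a<..<b}"
  obtain V where V: "continuous_on {a..b} V" "weak_deriv {a<..<b} u V" "V a = 0" "V b = 0"
    using u ab by (auto simp: neumann_domain_def frontier_def)
  obtain v where v: "v \<in> H1 {a<..<b}" "weak_deriv {a<..<b} u v" and uL: "u \<in> L2 {a<..<b}"
    using u by (auto simp: neumann_domain_def H2_def)
  note vL = H1_L2[OF v(1)]
  have VL: "V \<in> L2 {a<..<b}" by (rule L2_continuous[OF V(1)])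
  have Du: "D {a<..<b} u \<in> L2 {a<..<b}" "AE x in ?M. D {a<..<b} u x = v x" "AE x in ?M. D {a<..<b} u x = V x"
    using D_weak_deriv[OF vL v(2)] D_AE_eq[OF ab uL vL v(2)] D_AE_eq[OF ab uL VL V(2)] by auto
  define W where "W = Laplacian {a<..<b} u"
  have "weak_deriv {a<..<b} (D {a<..<b} u) (D {a<..<b} v)"
    by (rule weak_deriv_cong_AE[OF _ _ _ H1_D(2)[OF v(1)]])
      (use vL Du in \<open>auto intro: L2_integrable\<close>)
  then have W: "W \<in> L2 {a<..<b}" "weak_deriv {a<..<b} (D {a<..<b} u) W"
    unfolding W_def using D_weak_deriv H1_D(1)[OF v(1)] by blast+
  then have "weak_deriv {a<..<b} V W"
    by (intro weak_deriv_cong_AE[OF _ _ Du(3) W(2)] L2_integrable Du VL)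
  then obtain c where c: "AE x in ?M. V x = c + integral {a..x} W"
    using weak_deriv_primitive[OF ab L2_integrable[OF VL] L2_integrable[OF W(1)]] by blast
  \<comment> \<open>the weak derivative of \<open>V\<close> is the chosen representative \<open>W\<close>, and \<open>V a = 0\<close> fixes the constant\<close>
  have Vc: "V x - (c + integral {a..x} W) = 0" if "x \<in> {a..b}" for x
    by (rule continuous_AE_eq_0[OF ab _ _ that])
      (use c in \<open>auto intro!: continuous_on_diff V primitive_continuous L2_integrable W\<close>)
  then have "c = 0" using V(3) Vc[of a] ab by simp
  with Vc have VW: "\<forall>x\<in>{a..b}. V x = integral {a..x} W" by simp
  obtain d where d: "AE x in ?M. u x = d + integral {a..x} V"
    using weak_deriv_primitive[OF ab L2_integrable[OF uL] L2_integrable[OF VL] V(2)] by blast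
  have "((\<lambda>x. d + integral {a..x} V) has_vector_derivative V x) (at x within {a..b})" if "x \<in> {a..b}" for x
    using integral_has_vector_derivative[OF V(1) that] by (auto intro!: derivative_eq_intros)
  then have "neumann_rep a b (\<lambda>x. d + integral {a..x} V) V W"
    using V VW W by (simp add: neumann_rep_def)
  then show thesis using that d Du(3) unfolding W_def by blast
qed

lemma neumann_rep_derivative:
  "neumann_rep a b U V W \<Longrightarrow> x \<in> {a..b} \<Longrightarrow> (U has_vector_derivative V x) (at x within {a..b})"
  unfolding neumann_rep_def by blast

lemma neumann_rep_continuous_deriv: "neumann_rep a b U V W \<Longrightarrow> continuous_on {a..b} V"
  by (simp add: neumann_rep_def)

lemma neumann_rep_continuous: "neumann_rep a b U V W \<Longrightarrow> continuous_on {a..b} U"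
  unfolding neumann_rep_def by (meson continuous_on_vector_derivative)

lemma has_vector_derivative_inner_const:
  "(\<Psi> has_vector_derivative \<Psi>') F \<Longrightarrow> ((\<lambda>x. \<Psi> x \<bullet> k) has_vector_derivative (\<Psi>' \<bullet> k)) F"
  by (rule bounded_linear.has_vector_derivative[OF bounded_linear_inner_left])

text \<open>
  There are no boundary terms because \<open>V\<close>, rather than \<open>\<Psi>\<close>, vanishes at the end points.
\<close>

lemma neumann_by_parts:
  assumes ab: "a < b" and r: "neumann_rep a b U V W"
    and \<Psi>: "\<And>x. x \<in> {a..b} \<Longrightarrow> (\<Psi> has_vector_derivative \<Psi>' x) (at x within {a..b})"
    and \<Psi>': "continuous_on {a..b} \<Psi>'"
  shows "L2_inner {a<..<b} W \<Psi> = - L2_inner {a<..<b} V \<Psi>'"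
proof -
  let ?M = "lebesgue_on {a<..<b}"
  have V: "continuous_on {a..b} V" "V a = 0" "V b = 0" and W: "W \<in> L2 {a<..<b}"
    and VW: "\<And>x. x \<in> {a..b} \<Longrightarrow> V x = integral {a..x} W"
    using r by (auto simp: neumann_rep_def)
  have Wi: "integrable ?M W" by (rule L2_integrable[OF W])
  then have WI: "W integrable_on {a..b}"
    by (auto simp: integrable_Ioo_iff dest: set_lebesgue_integral_eq_integral(1))
  have c: "continuous_on {a..b} \<Psi>" using \<Psi> by (meson continuous_on_vector_derivative)
  have "(LINT x|?M. (W x \<bullet> k) * (\<Psi> x \<bullet> k)) + (LINT x|?M. (\<Psi>' x \<bullet> k) * (V x \<bullet> k)) =
      (V b \<bullet> k) * (\<Psi> b \<bullet> k) - (V a \<bullet> k) * (\<Psi> a \<bullet> k)" for k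
  proof (rule integration_by_parts_primitives)
    show "integrable ?M (\<lambda>x. W x \<bullet> k)" using Wi by auto
    show "integrable ?M (\<lambda>x. \<Psi>' x \<bullet> k)" by (intro integrable_Ioo_continuous continuous_intros \<Psi>')
    fix x assume x: "x \<in> {a..b}"
    then have "W integrable_on {a..x}" by (intro integrable_on_subinterval[OF WI]) auto
    then show "V x \<bullet> k = V a \<bullet> k + integral {a..x} (\<lambda>x. W x \<bullet> k)"
      using VW[OF x] V by (simp add: integral_component_eq)
    have "((\<lambda>x. \<Psi>' x \<bullet> k) has_integral (\<Psi> x \<bullet> k - \<Psi> a \<bullet> k)) {a..x}"
      using x by (intro fundamental_theorem_of_calculus has_vector_derivative_inner_const
          has_vector_derivative_within_subset[OF \<Psi>]) auto
    then show "\<Psi> x \<bullet> k = \<Psi> a \<bullet> k + integral {a..x} (\<lambda>x. \<Psi>' x \<bullet> k)"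
      by (simp add: integral_unique)
  qed (use ab in simp)
  then have eq: "(LINT x|?M. (W x \<bullet> k) * (\<Psi> x \<bullet> k)) = - (LINT x|?M. (\<Psi>' x \<bullet> k) * (V x \<bullet> k))" for k
    using V by (simp add: eq_neg_iff_add_eq_0)
  have i1: "integrable ?M (\<lambda>x. (W x \<bullet> k) * (\<Psi> x \<bullet> k))" for k
  proof -
    have "integrable ?M (\<lambda>x. (\<Psi> x \<bullet> k) * (W x \<bullet> k))"
      by (intro integrable_mult_continuous continuous_intros c) (use Wi in auto)
    then show ?thesis by (simp add: mult.commute)
  qed
  have i2: "integrable ?M (\<lambda>x. (\<Psi>' x \<bullet> k) * (V x \<bullet> k))" for k
    by (intro integrable_Ioo_continuous continuous_intros \<Psi>' V)
  have "L2_inner {a<..<b} W \<Psi> = (LINT x|?M. (\<Sum>k\<in>Basis. (W x \<bullet> k) * (\<Psi> x \<bullet> k)))"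
    unfolding L2_inner_def by (intro Bochner_Integration.integral_cong refl euclidean_inner)
  also have "\<dots> = (\<Sum>k\<in>Basis. (LINT x|?M. (W x \<bullet> k) * (\<Psi> x \<bullet> k)))"
    using i1 by (rule Bochner_Integration.integral_sum)
  also have "\<dots> = - (\<Sum>k\<in>Basis. (LINT x|?M. (\<Psi>' x \<bullet> k) * (V x \<bullet> k)))"
    unfolding eq by (simp add: sum_negf)
  also have "(\<Sum>k\<in>Basis. (LINT x|?M. (\<Psi>' x \<bullet> k) * (V x \<bullet> k))) = (LINT x|?M. (\<Sum>k\<in>Basis. (\<Psi>' x \<bullet> k) * (V x \<bullet> k)))"
    using i2 by (rule Bochner_Integration.integral_sum[symmetric])
  also have "\<dots> = L2_inner {a<..<b} V \<Psi>'"
    unfolding L2_inner_def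
    by (intro Bochner_Integration.integral_cong refl, subst euclidean_inner, simp only: mult.commute)
  finally show ?thesis .
qed

lemma neumann_energy:
  assumes "a < b" "neumann_rep a b U V W"
  shows "(L2_norm {a<..<b} V)\<^sup>2 = - L2_inner {a<..<b} W U"
  using neumann_by_parts[OF assms neumann_rep_derivative[OF assms(2)] neumann_rep_continuous_deriv[OF assms(2)]]
  by (simp add: L2_norm_square)

text \<open>
  The cosines are eigenfunctions of the Neumann Laplacian: the first integration by parts uses the boundary
  condition of \<open>U\<close>, the second one that of the cosine.
\<close>

lemma neumann_cosine_coeff:
  assumes ab: "a < b" and r: "neumann_rep a b U V W"
  shows "cosine_coeff a b W p = - (real (fst p) * pi / (b - a))\<^sup>2 * cosine_coeff a b U p"
proof -
  define s where "s = real (fst p) * pi / (b - a)"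
  have sx: "real (fst p) * (pi * (x - a) / (b - a)) = s * (x - a)" for x by (simp add: s_def)
  define E E' where "E x = cos (s * (x - a)) *\<^sub>R snd p" and "E' x = (- s * sin (s * (x - a))) *\<^sub>R snd p" for x
  have E: "cosine_mode a b p = E" unfolding cosine_mode_def[abs_def] sx E_def[abs_def] ..
  have dE: "(E has_vector_derivative E' x) (at x within {a..b})" for x
    unfolding E_def E'_def by (rule has_vector_derivative_scaleR[THEN has_vector_derivative_eq_rhs, OF _ has_vector_derivative_const])
      (auto intro!: derivative_eq_intros)
  have dE': "(E' has_vector_derivative (- s\<^sup>2) *\<^sub>R E x) (at x within {a..b})" for x
    unfolding E_def E'_def by (rule has_vector_derivative_scaleR[THEN has_vector_derivative_eq_rhs, OF _ has_vector_derivative_const])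
      (auto intro!: derivative_eq_intros simp: power2_eq_square)
  have cU: "continuous_on {a..b} U" and cV: "continuous_on {a..b} V"
    using neumann_rep_continuous[OF r] r by (auto simp: neumann_rep_def)
  have cE: "continuous_on {a..b} E" "continuous_on {a..b} E'"
    using dE dE' by (meson continuous_on_vector_derivative)+
  have W: "L2_inner {a<..<b} W E = - L2_inner {a<..<b} V E'"
    by (rule neumann_by_parts[OF ab r dE cE(2)])
  have "((\<lambda>x. U x \<bullet> ((- s\<^sup>2) *\<^sub>R E x) + V x \<bullet> E' x) has_integral (U b \<bullet> E' b - U a \<bullet> E' a)) {a..b}"
  proof (rule fundamental_theorem_of_calculus)
    fix x assume "x \<in> {a..b}"
    then have "(U has_vector_derivative V x) (at x within {a..b})" by (rule neumann_rep_derivative[OF r])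
    from bounded_bilinear.has_vector_derivative[OF bounded_bilinear_inner this dE']
    show "((\<lambda>x. U x \<bullet> E' x) has_vector_derivative U x \<bullet> ((- s\<^sup>2) *\<^sub>R E x) + V x \<bullet> E' x) (at x within {a..b})" .
  qed (use ab in simp)
  moreover have "E' a = 0" "E' b = 0"
    using ab sin_zero_iff_int2[of "real (fst p) * pi"] by (auto simp: E'_def s_def intro!: exI[of _ "int (fst p)"])
  moreover have i: "integrable (lebesgue_on {a<..<b}) (\<lambda>x. U x \<bullet> ((- s\<^sup>2) *\<^sub>R E x))"
      "integrable (lebesgue_on {a<..<b}) (\<lambda>x. V x \<bullet> E' x)"
    by (intro integrable_Ioo_continuous continuous_intros cU cV cE)+
  ultimately have "(LINT x|lebesgue_on {a<..<b}. U x \<bullet> ((- s\<^sup>2) *\<^sub>R E x) + V x \<bullet> E' x) = 0"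
    by (subst LINT_Ioo) (auto simp: integral_unique)
  then have "- s\<^sup>2 * L2_inner {a<..<b} U E + L2_inner {a<..<b} V E' = 0"
    using i by (simp add: L2_inner_def)
  then show ?thesis using W unfolding cosine_coeff_def E s_def[symmetric] by simp
qed

lemma integral_norm_le_L2_norm:
  fixes h :: "real \<Rightarrow> real^3"
  assumes ab: "a < b" and h: "continuous_on {a..b} h"
  shows "integral {a..b} (\<lambda>x. norm (h x)) \<le> sqrt (b - a) * L2_norm {a<..<b} h"
proof -
  obtain e :: "real^3" where e: "norm e = 1" using norm_axis_1 by blast
  have c: "continuous_on {a..b} (\<lambda>x. norm (h x))" by (intro continuous_intros h)
  have L: "(\<lambda>x. norm (h x) *\<^sub>R e) \<in> L2 {a<..<b}" "(\<lambda>x. e) \<in> L2 {a<..<b}"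
    by (intro L2_continuous continuous_intros h)+
  have "integral {a..b} (\<lambda>x. norm (h x)) = L2_inner {a<..<b} (\<lambda>x. norm (h x) *\<^sub>R e) (\<lambda>x. e)"
    using e LINT_Ioo[OF integrable_Ioo_continuous[OF c]] by (simp add: L2_inner_def norm_eq_1)
  also have "\<dots> \<le> L2_norm {a<..<b} (\<lambda>x. norm (h x) *\<^sub>R e) * L2_norm {a<..<b} (\<lambda>x. e)"
    using L2_Cauchy_Schwarz[OF L] by linarith
  also have "L2_norm {a<..<b} (\<lambda>x. norm (h x) *\<^sub>R e) = L2_norm {a<..<b} h"
    using e by (simp add: L2_norm_def)
  also have "L2_norm {a<..<b} (\<lambda>x. e) = sqrt (b - a)"
    using e ab LINT_Ioo[OF integrable_Ioo_continuous[of a b "\<lambda>_. 1::real"]] by (simp add: L2_norm_def)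
  finally show ?thesis by (simp add: mult.commute)
qed

text \<open>
  The oscillation of \<open>U\<close> is at most the integral of \<open>norm V\<close>.  Hence \<open>norm (U x - \<zeta>)\<close> exceeds its mean over the
  interval by at most that amount, and both terms are estimated by the inequality of Cauchy and Schwarz.
\<close>

lemma neumann_sup_bound:
  assumes ab: "a < b" and r: "neumann_rep a b U V W" and x: "x \<in> {a..b}"
  shows "norm (U x - \<zeta>) \<le> L2_norm {a<..<b} (\<lambda>x. U x - \<zeta>) / sqrt (b - a) + sqrt (b - a) * L2_norm {a<..<b} V"
proof -
  have cU: "continuous_on {a..b} U" and cV: "continuous_on {a..b} V"
    using neumann_rep_continuous[OF r] r by (auto simp: neumann_rep_def)
  have cn: "continuous_on {a..b} (\<lambda>x. norm (V x))" by (intro continuous_intros cV)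
  define I where "I = integral {a..b} (\<lambda>x. norm (V x))"
  have less: "norm (U q - U p) \<le> I" if pq: "p \<in> {a..b}" "q \<in> {a..b}" "p \<le> q" for p q
  proof -
    have "(V has_integral (U q - U p)) {p..q}"
      by (rule fundamental_theorem_of_calculus[OF pq(3)],
          rule has_vector_derivative_within_subset[OF neumann_rep_derivative[OF r]]) (use pq in auto)
    then have "norm (U q - U p) = norm (integral {p..q} V)" by (simp add: integral_unique)
    also have "\<dots> \<le> integral {p..q} (\<lambda>x. norm (V x))"
      by (rule integral_norm_bound_integral)
        (use pq in \<open>auto intro!: integrable_continuous_real intro: continuous_on_subset[OF cV] continuous_on_subset[OF cn]\<close>)
    also have "\<dots> \<le> I" unfolding I_def
      by (rule integral_subset_le)
        (use pq in \<open>auto intro!: integrable_continuous_real intro: continuous_on_subset[OF cn]\<close>)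
    finally show ?thesis .
  qed
  have all: "norm (U x - \<zeta>) \<le> norm (U y - \<zeta>) + I" if y: "y \<in> {a..b}" for y
  proof -
    have "norm (U x - U y) \<le> I"
      using less[of x y] less[of y x] x y by (cases "x \<le> y") (auto simp: norm_minus_commute)
    moreover have "norm (U x - \<zeta>) \<le> norm (U x - U y) + norm (U y - \<zeta>)"
      using norm_triangle_ineq[of "U x - U y" "U y - \<zeta>"] by simp
    ultimately show ?thesis by simp
  qed
  have cz: "continuous_on {a..b} (\<lambda>y. U y - \<zeta>)" by (intro continuous_intros cU)
  have "integral {a..b} (\<lambda>y. norm (U x - \<zeta>)) \<le> integral {a..b} (\<lambda>y. norm (U y - \<zeta>) + I)"
    by (rule integral_le) (use all in \<open>auto intro!: integrable_continuous_real continuous_intros cU\<close>)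
  also have "\<dots> = integral {a..b} (\<lambda>y. norm (U y - \<zeta>)) + (b - a) * I"
    using ab by (subst integral_add) (auto intro!: integrable_continuous_real continuous_intros cU)
  also have "\<dots> \<le> sqrt (b - a) * L2_norm {a<..<b} (\<lambda>x. U x - \<zeta>) + (b - a) * (sqrt (b - a) * L2_norm {a<..<b} V)"
    unfolding I_def using ab by (intro add_mono mult_left_mono integral_norm_le_L2_norm cz cV) auto
  finally have "(b - a) * norm (U x - \<zeta>) \<le> sqrt (b - a) * L2_norm {a<..<b} (\<lambda>x. U x - \<zeta>) + (b - a) * (sqrt (b - a) * L2_norm {a<..<b} V)"
    using ab by simp
  then have "norm (U x - \<zeta>) \<le> (sqrt (b - a) / (b - a)) * L2_norm {a<..<b} (\<lambda>x. U x - \<zeta>) + sqrt (b - a) * L2_norm {a<..<b} V"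
    using ab by (simp add: field_simps)
  also have "sqrt (b - a) / (b - a) = 1 / sqrt (b - a)"
    using ab by (simp add: field_simps real_sqrt_mult[symmetric])
  finally show ?thesis by simp
qed

section \<open>The sign of the dissipation\<close>

text \<open>
  Let \<open>p\<close> and \<open>q\<close> be the squared lengths of the components of \<open>u\<close> and \<open>v\<close> orthogonal to the axis.  A tangent vector
  at a point near the axis is nearly orthogonal to the axis: \<open>v1\<^sup>2\<close> is at most \<open>2 * p * q\<close>.  So both terms that
  compete with \<open>\<alpha> * q\<close> carry the small factor \<open>p\<close>, and smallness of \<open>p\<close> relative to \<open>\<alpha>\<close> decides the sign.
\<close>

lemma unit_tangent_estimate:
  fixes u1 u2 u3 v1 v2 v3 \<alpha> :: real
  assumes unit: "u1\<^sup>2 + u2\<^sup>2 + u3\<^sup>2 = 1" and tangent: "u1 * v1 + u2 * v2 + u3 * v3 = 0"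
    and \<alpha>: "\<alpha> > 0" and small: "u2\<^sup>2 + u3\<^sup>2 \<le> 1 / 64" "u2\<^sup>2 + u3\<^sup>2 \<le> \<alpha> / 32"
  shows "0 \<le> \<alpha> * ((v2\<^sup>2 + v3\<^sup>2) - (u2\<^sup>2 + u3\<^sup>2) * (v1\<^sup>2 + v2\<^sup>2 + v3\<^sup>2)) + v1 * (v3 * u2 - v2 * u3)"
proof -
  define p q where "p = u2\<^sup>2 + u3\<^sup>2" and "q = v2\<^sup>2 + v3\<^sup>2"
  have pq: "p \<ge> 0" "q \<ge> 0" "p * q \<ge> 0" by (auto simp: p_def q_def)
  have p: "p \<le> 1 / 64" "p \<le> \<alpha> / 32" using small by (simp_all add: p_def)
  have "(u1 * v1)\<^sup>2 = (u2 * v2 + u3 * v3)\<^sup>2"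
  proof -
    have eq: "u1 * v1 = - (u2 * v2 + u3 * v3)" using tangent by linarith
    show ?thesis unfolding eq by (rule power2_minus)
  qed
  also have "\<dots> \<le> p * q"
  proof -
    have "0 \<le> (u2 * v3 - u3 * v2)\<^sup>2" by simp
    then show ?thesis unfolding p_def q_def by (simp add: power2_eq_square algebra_simps)
  qed
  finally have "(u1 * v1)\<^sup>2 \<le> p * q" .
  moreover have "1 - p = u1\<^sup>2" using unit by (simp add: p_def)
  ultimately have "(1 - p) * v1\<^sup>2 \<le> p * q" by (simp add: power_mult_distrib)
  moreover have "(1 / 2) * v1\<^sup>2 \<le> (1 - p) * v1\<^sup>2"
    by (rule mult_right_mono) (use p in simp_all)
  ultimately have v1: "v1\<^sup>2 \<le> 2 * (p * q)" by linarith
  have cross: "(v3 * u2 - v2 * u3)\<^sup>2 \<le> p * q"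
  proof -
    have "0 \<le> (u2 * v2 + u3 * v3)\<^sup>2" by simp
    then show ?thesis unfolding p_def q_def by (simp add: power2_eq_square algebra_simps)
  qed
  have "\<bar>v1 * (v3 * u2 - v2 * u3)\<bar>\<^sup>2 = v1\<^sup>2 * (v3 * u2 - v2 * u3)\<^sup>2" by (simp add: power_mult_distrib)
  also have "\<dots> \<le> (2 * (p * q)) * (p * q)" by (rule mult_mono) (use v1 cross pq in simp_all)
  also have "\<dots> \<le> (2 * (p * q))\<^sup>2" using pq by (simp add: power2_eq_square)
  finally have c: "\<bar>v1 * (v3 * u2 - v2 * u3)\<bar> \<le> 2 * (p * q)"
    by (rule power2_le_imp_le) (use pq in simp)
  have "p * (q + v1\<^sup>2) \<le> (1 / 64) * (q + 2 * (p * q))"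
    by (rule mult_mono) (use p pq v1 in simp_all)
  also have "\<dots> \<le> (1 / 64) * (q + 2 * ((1 / 64) * q))"
    by (intro mult_left_mono add_left_mono mult_right_mono) (use p pq in simp_all)
  also have "\<dots> \<le> q / 2" using pq by simp
  finally have "q / 2 \<le> q - p * (q + v1\<^sup>2)" by linarith
  then have "\<alpha> * (q - p * (q + v1\<^sup>2)) \<ge> \<alpha> * (q / 2)"
    by (rule mult_left_mono) (use \<alpha> in simp)
  moreover have "2 * (p * q) \<le> 2 * ((\<alpha> / 32) * q)"
    by (intro mult_left_mono mult_right_mono) (use p pq in simp_all)
  moreover have "2 * ((\<alpha> / 32) * q) \<le> \<alpha> * (q / 2)" using \<alpha> pq by simp
  ultimately have "0 \<le> \<alpha> * (q - p * (q + v1\<^sup>2)) + v1 * (v3 * u2 - v2 * u3)"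
    using c by linarith
  then show ?thesis by (simp add: p_def q_def algebra_simps)
qed

lemma f_bounded_linear: "bounded_linear f"
  unfolding linear_conv_bounded_linear[symmetric]
  by (rule linearI) (auto simp: f_def vec_eq_iff forall_3)

lemmas has_vector_derivative_inner' = bounded_bilinear.has_vector_derivative[OF bounded_bilinear_inner]
lemmas bounded_bilinear_cross3 = bilinear_cross[unfolded bilinear_conv_bounded_bilinear]
lemmas has_vector_derivative_cross3 = bounded_bilinear.has_vector_derivative[OF bounded_bilinear_cross3]
lemmas has_vector_derivative_scaleR' = bounded_bilinear.has_vector_derivative[OF bounded_bilinear_scaleR]
lemmas has_vector_derivative_f = bounded_linear.has_vector_derivative[OF f_bounded_linear]

text \<open>
  The term \<open>G \<alpha> u (f u)\<close> for a unit vector \<open>u\<close>, with the double vector product expanded.  In this form it is a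
  polynomial in \<open>u\<close> whose derivative has few terms.
\<close>

definition anisotropy_torque :: "real \<Rightarrow> real^3 \<Rightarrow> real^3" where
  "anisotropy_torque \<alpha> u = cross3 u (f u) - \<alpha> *\<^sub>R ((u \<bullet> f u) *\<^sub>R u - f u)"

definition anisotropy_torque_deriv :: "real \<Rightarrow> real^3 \<Rightarrow> real^3 \<Rightarrow> real^3" where
  "anisotropy_torque_deriv \<alpha> u v = (cross3 u (f v) + cross3 v (f u)) -
     \<alpha> *\<^sub>R (((u \<bullet> f u) *\<^sub>R v + (u \<bullet> f v + v \<bullet> f u) *\<^sub>R u) - f v)"

lemma anisotropy_torque_has_derivative:
  assumes "(U has_vector_derivative V) (at x within S)"
  shows "((\<lambda>x. anisotropy_torque \<alpha> (U x)) has_vector_derivative anisotropy_torque_deriv \<alpha> (U x) V) (at x within S)"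
  unfolding anisotropy_torque_def anisotropy_torque_deriv_def
  by (intro has_vector_derivative_diff has_vector_derivative_cross3 has_vector_derivative_scaleR'
      bounded_linear.has_vector_derivative[OF bounded_linear_scaleR_right]
      has_vector_derivative_inner' has_vector_derivative_f assms)

lemma G_eq_anisotropy_torque:
  assumes "norm u = 1"
  shows "G \<alpha> u (f u) = anisotropy_torque \<alpha> u"
proof -
  have "u \<bullet> u = 1" using assms by (simp add: norm_eq_1)
  then show ?thesis unfolding G_def anisotropy_torque_def by (simp add: Lagrange)
qed

lemma f_nth [simp]: "f u $ 1 = 0" "f u $ 2 = u $ 2" "f u $ 3 = u $ 3"
  by (simp_all add: f_def)

text \<open>
  The derivative of the scalar factor \<open>u \<bullet> f u\<close> does not contribute, since it multiplies \<open>u \<bullet> v = 0\<close>.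
\<close>

lemma anisotropy_torque_deriv_tangent:
  assumes "u \<bullet> v = 0"
  shows "v \<bullet> anisotropy_torque_deriv \<alpha> u v =
    \<alpha> * (((v $ 2)\<^sup>2 + (v $ 3)\<^sup>2) - ((u $ 2)\<^sup>2 + (u $ 3)\<^sup>2) * ((v $ 1)\<^sup>2 + (v $ 2)\<^sup>2 + (v $ 3)\<^sup>2))
    + v $ 1 * (v $ 3 * u $ 2 - v $ 2 * u $ 3)"
proof -
  have "v \<bullet> anisotropy_torque_deriv \<alpha> u v =
     v \<bullet> cross3 u (f v) + v \<bullet> cross3 v (f u) - \<alpha> * ((u \<bullet> f u) * (v \<bullet> v) - v \<bullet> f v)"
    using assms by (simp add: anisotropy_torque_deriv_def inner_simps inner_commute[of v u])
  also have "v \<bullet> cross3 v (f u) = 0" by (rule dot_cross_self)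
  also have "v \<bullet> cross3 u (f v) = v $ 1 * (v $ 3 * u $ 2 - v $ 2 * u $ 3)"
    by (simp add: inner_vec_def sum_3 cross3_def algebra_simps)
  finally show ?thesis by (simp add: inner_vec_def sum_3 algebra_simps power2_eq_square)
qed

lemma small_deviation:
  fixes u :: "real^3"
  assumes u: "norm u = 1" and \<zeta>: "\<zeta> = vector [\<sigma>, 0, 0]" "\<sigma>\<^sup>2 = 1" and d: "norm (u - \<zeta>) \<le> \<delta>"
  shows "(u $ 2)\<^sup>2 + (u $ 3)\<^sup>2 \<le> \<delta>\<^sup>2" "u \<bullet> \<zeta> = 1 - (norm (u - \<zeta>))\<^sup>2 / 2"
    "(u $ 2)\<^sup>2 + (u $ 3)\<^sup>2 = (1 - u \<bullet> \<zeta>) * (1 + u \<bullet> \<zeta>)"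
proof -
  have n: "(norm (u - \<zeta>))\<^sup>2 = (u $ 1 - \<sigma>)\<^sup>2 + (u $ 2)\<^sup>2 + (u $ 3)\<^sup>2"
    unfolding power2_norm_eq_inner by (simp add: inner_vec_def sum_3 \<zeta> power2_eq_square)
  have u1: "(u $ 1)\<^sup>2 + (u $ 2)\<^sup>2 + (u $ 3)\<^sup>2 = 1"
    using u by (simp add: norm_eq_1 inner_vec_def sum_3 power2_eq_square)
  have z: "u \<bullet> \<zeta> = \<sigma> * u $ 1" by (simp add: inner_vec_def sum_3 \<zeta>)
  have "(norm (u - \<zeta>))\<^sup>2 \<le> \<delta>\<^sup>2" using d by (intro power_mono) auto
  then show "(u $ 2)\<^sup>2 + (u $ 3)\<^sup>2 \<le> \<delta>\<^sup>2" unfolding n using zero_le_power2[of "u $ 1 - \<sigma>"] by linarith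
  have "(norm (u - \<zeta>))\<^sup>2 = ((u $ 1)\<^sup>2 + (u $ 2)\<^sup>2 + (u $ 3)\<^sup>2) + \<sigma>\<^sup>2 - 2 * (\<sigma> * u $ 1)"
    unfolding n by (simp add: power2_eq_square algebra_simps)
  then show "u \<bullet> \<zeta> = 1 - (norm (u - \<zeta>))\<^sup>2 / 2"
    unfolding z u1 \<zeta>(2) by (simp add: diff_divide_distrib)
  have "(\<sigma> * u $ 1)\<^sup>2 = (u $ 1)\<^sup>2" using \<zeta>(2) by (simp add: power_mult_distrib)
  moreover have "(1 - \<sigma> * u $ 1) * (1 + \<sigma> * u $ 1) = 1 - (\<sigma> * u $ 1)\<^sup>2"
    by (simp add: power2_eq_square algebra_simps)
  ultimately show "(u $ 2)\<^sup>2 + (u $ 3)\<^sup>2 = (1 - u \<bullet> \<zeta>) * (1 + u \<bullet> \<zeta>)"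
    unfolding z using u1 by simp
qed

text \<open>
  The right-hand side of the equation at a point, \<open>w\<close> standing for the Laplacian of \<open>u\<close>.
\<close>

definition LLG_rhs :: "real \<Rightarrow> real \<Rightarrow> real^3 \<Rightarrow> real^3 \<Rightarrow> real^3" where
  "LLG_rhs \<alpha> \<beta> u w = cross3 u w - \<alpha> *\<^sub>R cross3 u (cross3 u w) - \<beta> *\<^sub>R G \<alpha> u (f u)"

text \<open>
  The precession term is orthogonal to \<open>w\<close>, and the damping term has the good sign.
\<close>

lemma inner_LLG_rhs_self:
  assumes "\<alpha> \<ge> 0" "norm u = 1"
  shows "- (w \<bullet> (\<beta> *\<^sub>R anisotropy_torque \<alpha> u)) \<le> w \<bullet> LLG_rhs \<alpha> \<beta> u w"
proof -
  have "w \<bullet> cross3 u (cross3 u w) = - ((norm (cross3 u w))\<^sup>2)"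
    by (simp add: power2_norm_eq_inner cross3_simps)
  then have "w \<bullet> LLG_rhs \<alpha> \<beta> u w = \<alpha> * (norm (cross3 u w))\<^sup>2 - (w \<bullet> (\<beta> *\<^sub>R anisotropy_torque \<alpha> u))"
    using G_eq_anisotropy_torque[OF assms(2), of \<alpha>]
    by (simp add: LLG_rhs_def inner_simps dot_cross_self)
  then show ?thesis using assms(1) by simp
qed

text \<open>
  The vector that is paired with the Laplacian in \<open>LLG_rhs \<alpha> \<beta> u w \<bullet> \<zeta>\<close>, that is, the adjoint of the
  second order part applied to \<open>\<zeta>\<close>.
\<close>

definition alignment_flux :: "real \<Rightarrow> real^3 \<Rightarrow> real^3 \<Rightarrow> real^3" where
  "alignment_flux \<alpha> \<zeta> u = cross3 \<zeta> u - \<alpha> *\<^sub>R ((u \<bullet> \<zeta>) *\<^sub>R u - \<zeta>)"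

lemma inner_LLG_rhs_axis:
  assumes u: "norm u = 1" and \<zeta>: "\<zeta> = vector [\<sigma>, 0, 0]"
  shows "LLG_rhs \<alpha> \<beta> u w \<bullet> \<zeta> = w \<bullet> alignment_flux \<alpha> \<zeta> u + \<alpha> * \<beta> * ((u $ 2)\<^sup>2 + (u $ 3)\<^sup>2) * (u \<bullet> \<zeta>)"
proof -
  have uu: "u \<bullet> u = 1" using u by (simp add: norm_eq_1)
  have 1: "cross3 u w \<bullet> \<zeta> = w \<bullet> cross3 \<zeta> u" by (simp add: cross3_simps)
  have 2: "cross3 u (cross3 u w) = (u \<bullet> w) *\<^sub>R u - w" using uu by (simp add: Lagrange)
  have 3: "anisotropy_torque \<alpha> u \<bullet> \<zeta> = - \<alpha> * (((u $ 2)\<^sup>2 + (u $ 3)\<^sup>2) * (u \<bullet> \<zeta>))"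
    by (simp add: anisotropy_torque_def inner_simps, simp add: inner_vec_def sum_3 cross3_def \<zeta> power2_eq_square algebra_simps)
  show ?thesis
    unfolding LLG_rhs_def G_eq_anisotropy_torque[OF u] 2
    by (simp add: inner_diff_left 1 3 alignment_flux_def inner_diff_right inner_commute[of w u] algebra_simps)
qed

text \<open>
  This is the derivative of half the Dirichlet energy along the flow, up to sign.  After an integration by
  parts the anisotropy contributes the pointwise form estimated in \<open>unit_tangent_estimate\<close>.
\<close>

lemma neumann_inner_LLG_rhs_nonneg:
  assumes ab: "a < b" and r: "neumann_rep a b U V W" and \<alpha>: "\<alpha> > 0" and \<beta>: "\<beta> > 0"
    and unit: "\<And>x. x \<in> {a..b} \<Longrightarrow> norm (U x) = 1"
    and tangent: "\<And>x. x \<in> {a..b} \<Longrightarrow> U x \<bullet> V x = 0"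
    and small: "\<And>x. x \<in> {a..b} \<Longrightarrow> (U x $ 2)\<^sup>2 + (U x $ 3)\<^sup>2 \<le> 1 / 64"
      "\<And>x. x \<in> {a..b} \<Longrightarrow> (U x $ 2)\<^sup>2 + (U x $ 3)\<^sup>2 \<le> \<alpha> / 32"
    and z: "z \<in> L2 {a<..<b}" "AE x in lebesgue_on {a<..<b}. z x = LLG_rhs \<alpha> \<beta> (U x) (W x)"
  shows "0 \<le> L2_inner {a<..<b} W z"
proof -
  let ?M = "lebesgue_on {a<..<b}"
  note cU = neumann_rep_continuous[OF r] and cV = neumann_rep_continuous_deriv[OF r]
  have W: "W \<in> L2 {a<..<b}" using r by (simp add: neumann_rep_def)
  have cf: "continuous_on {a..b} (\<lambda>x. f (h x))" if "continuous_on {a..b} h" for h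
    using bounded_linear.continuous_on[OF f_bounded_linear that] .
  define \<Psi> \<Psi>' where "\<Psi> x = \<beta> *\<^sub>R anisotropy_torque \<alpha> (U x)"
    and "\<Psi>' x = \<beta> *\<^sub>R anisotropy_torque_deriv \<alpha> (U x) (V x)" for x
  have d: "(\<Psi> has_vector_derivative \<Psi>' x) (at x within {a..b})" if "x \<in> {a..b}" for x
    unfolding \<Psi>_def \<Psi>'_def
    by (intro bounded_linear.has_vector_derivative[OF bounded_linear_scaleR_right]
        anisotropy_torque_has_derivative neumann_rep_derivative[OF r that])
  have c': "continuous_on {a..b} \<Psi>'"
    unfolding \<Psi>'_def anisotropy_torque_deriv_def
    by (intro continuous_intros continuous_on_cross cf cU cV)
  have \<Psi>L: "\<Psi> \<in> L2 {a<..<b}"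
    using d by (intro L2_continuous) (meson continuous_on_vector_derivative)
  have \<Psi>'L: "\<Psi>' \<in> L2 {a<..<b}" "V \<in> L2 {a<..<b}" by (intro L2_continuous c' cV)+
  have "0 \<le> L2_inner {a<..<b} V \<Psi>'"
    unfolding L2_inner_def
  proof (rule integral_nonneg_AE, rule AE_I2)
    fix x assume "x \<in> space ?M"
    then have x: "x \<in> {a..b}" by auto
    have "0 \<le> V x \<bullet> anisotropy_torque_deriv \<alpha> (U x) (V x)"
      unfolding anisotropy_torque_deriv_tangent[OF tangent[OF x]]
      by (rule unit_tangent_estimate[OF _ _ \<alpha> small[OF x], of "U x $ 1"])
        (use unit[OF x] tangent[OF x] in \<open>simp_all add: norm_eq_1 inner_vec_def sum_3 power2_eq_square\<close>)
    then show "0 \<le> V x \<bullet> \<Psi>' x" using \<beta> by (simp add: \<Psi>'_def)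
  qed
  also have "\<dots> = - L2_inner {a<..<b} W \<Psi>"
    using neumann_by_parts[OF ab r d c'] by simp
  also have "\<dots> = (LINT x|?M. - (W x \<bullet> \<Psi> x))"
    using L2_inner_integrable[OF W \<Psi>L] by (simp add: L2_inner_def)
  also have "\<dots> \<le> (LINT x|?M. W x \<bullet> z x)"
  proof (rule integral_mono_AE)
    show "integrable ?M (\<lambda>x. - (W x \<bullet> \<Psi> x))" using L2_inner_integrable[OF W \<Psi>L] by simp
    show "integrable ?M (\<lambda>x. W x \<bullet> z x)" by (rule L2_inner_integrable[OF W z(1)])
    show "AE x in ?M. - (W x \<bullet> \<Psi> x) \<le> W x \<bullet> z x"
      using z(2)
    proof (rule AE_mp, intro AE_I2 impI)
      fix x assume "x \<in> space ?M" and zx: "z x = LLG_rhs \<alpha> \<beta> (U x) (W x)"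
      then have "norm (U x) = 1" by (intro unit) auto
      then show "- (W x \<bullet> \<Psi> x) \<le> W x \<bullet> z x"
        unfolding zx \<Psi>_def by (rule inner_LLG_rhs_self[OF less_imp_le[OF \<alpha>]])
    qed
  qed
  finally show ?thesis by (simp add: L2_inner_def)
qed

lemma alignment_flux_has_derivative:
  assumes "(U has_vector_derivative V) (at x within S)"
  shows "((\<lambda>x. alignment_flux \<alpha> \<zeta> (U x)) has_vector_derivative
    (cross3 \<zeta> V - \<alpha> *\<^sub>R ((U x \<bullet> \<zeta>) *\<^sub>R V + (V \<bullet> \<zeta>) *\<^sub>R U x))) (at x within S)"
proof -
  have "((\<lambda>x. alignment_flux \<alpha> \<zeta> (U x)) has_vector_derivative
    ((cross3 \<zeta> V + cross3 0 (U x)) - \<alpha> *\<^sub>R (((U x \<bullet> \<zeta>) *\<^sub>R V + (U x \<bullet> 0 + V \<bullet> \<zeta>) *\<^sub>R U x) - 0))) (at x within S)"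
    unfolding alignment_flux_def
    by (intro has_vector_derivative_diff has_vector_derivative_cross3 has_vector_derivative_scaleR'
      bounded_linear.has_vector_derivative[OF bounded_linear_scaleR_right]
      has_vector_derivative_inner' has_vector_derivative_const assms)
  then show ?thesis by simp
qed

text \<open>
  The rate at which the mean of \<open>U\<close> turns towards \<open>\<zeta>\<close>.  After an integration by parts the exchange term becomes
  \<open>\<alpha>\<close> times the integral of \<open>(U \<bullet> \<zeta>) * (norm V)\<^sup>2\<close>, and the anisotropy adds \<open>\<alpha> * \<beta>\<close> times
  the integral of \<open>(1 - U \<bullet> \<zeta>) * (1 + U \<bullet> \<zeta>) * (U \<bullet> \<zeta>)\<close>.  Near \<open>\<zeta>\<close> both integrands are controlled from below.
\<close>

lemma neumann_inner_LLG_rhs_axis: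
  assumes ab: "a < b" and r: "neumann_rep a b U V W" and \<alpha>: "\<alpha> > 0" and \<beta>: "\<beta> > 0"
    and unit: "\<And>x. x \<in> {a..b} \<Longrightarrow> norm (U x) = 1"
    and tangent: "\<And>x. x \<in> {a..b} \<Longrightarrow> U x \<bullet> V x = 0"
    and \<zeta>: "\<zeta> = vector [\<sigma>, 0, 0]" "\<sigma>\<^sup>2 = 1"
    and small: "\<And>x. x \<in> {a..b} \<Longrightarrow> norm (U x - \<zeta>) \<le> 1"
    and z: "z \<in> L2 {a<..<b}" "AE x in lebesgue_on {a<..<b}. z x = LLG_rhs \<alpha> \<beta> (U x) (W x)"
  shows "\<alpha> / 2 * (L2_norm {a<..<b} V)\<^sup>2 + \<alpha> * \<beta> / 4 * (L2_norm {a<..<b} (\<lambda>x. U x - \<zeta>))\<^sup>2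
    \<le> L2_inner {a<..<b} z (\<lambda>x. \<zeta>)"
proof -
  let ?M = "lebesgue_on {a<..<b}"
  note cU = neumann_rep_continuous[OF r] and cV = neumann_rep_continuous_deriv[OF r]
  have W: "W \<in> L2 {a<..<b}" using r by (simp add: neumann_rep_def)
  define \<Phi> \<Phi>' where "\<Phi> x = alignment_flux \<alpha> \<zeta> (U x)"
    and "\<Phi>' x = cross3 \<zeta> (V x) - \<alpha> *\<^sub>R ((U x \<bullet> \<zeta>) *\<^sub>R V x + (V x \<bullet> \<zeta>) *\<^sub>R U x)" for x
  have d: "(\<Phi> has_vector_derivative \<Phi>' x) (at x within {a..b})" if "x \<in> {a..b}" for x
    unfolding \<Phi>_def \<Phi>'_def by (rule alignment_flux_has_derivative[OF neumann_rep_derivative[OF r that]])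
  have c': "continuous_on {a..b} \<Phi>'"
    unfolding \<Phi>'_def by (intro continuous_intros continuous_on_cross cU cV)
  have \<Phi>L: "\<Phi> \<in> L2 {a<..<b}"
    using d by (intro L2_continuous) (meson continuous_on_vector_derivative)
  have L: "V \<in> L2 {a<..<b}" "\<Phi>' \<in> L2 {a<..<b}" "(\<lambda>x. U x - \<zeta>) \<in> L2 {a<..<b}" "(\<lambda>x. \<zeta>) \<in> L2 {a<..<b}"
    by (intro L2_continuous continuous_intros c' cV cU)+
  let ?P = "\<lambda>x. \<alpha> * \<beta> * ((U x $ 2)\<^sup>2 + (U x $ 3)\<^sup>2) * (U x \<bullet> \<zeta>)"
  have iP: "integrable ?M ?P"
    by (intro integrable_Ioo_continuous continuous_intros cU)
  have iV: "integrable ?M (\<lambda>x. V x \<bullet> \<Phi>' x)" by (rule L2_inner_integrable[OF L(1,2)])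
  have "L2_inner {a<..<b} z (\<lambda>x. \<zeta>) = (LINT x|?M. W x \<bullet> \<Phi> x + ?P x)"
    unfolding L2_inner_def
  proof (rule Bochner_Integration.integral_cong_AE)
    show "(\<lambda>x. z x \<bullet> \<zeta>) \<in> borel_measurable ?M"
      using L2_inner_integrable[OF z(1) L(4)] by auto
    show "(\<lambda>x. W x \<bullet> \<Phi> x + ?P x) \<in> borel_measurable ?M"
      using L2_inner_integrable[OF W \<Phi>L] iP by (intro borel_measurable_integrable Bochner_Integration.integrable_add)
    show "AE x in ?M. z x \<bullet> \<zeta> = W x \<bullet> \<Phi> x + ?P x"
      using z(2) by (rule AE_mp) (auto intro!: AE_I2 inner_LLG_rhs_axis[OF _ \<zeta>(1)] unit simp: \<Phi>_def)
  qed
  also have "\<dots> = L2_inner {a<..<b} W \<Phi> + (LINT x|?M. ?P x)"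
    using L2_inner_integrable[OF W \<Phi>L] iP by (simp add: L2_inner_def)
  also have "\<dots> = (LINT x|?M. ?P x - V x \<bullet> \<Phi>' x)"
    using neumann_by_parts[OF ab r d c'] iP iV by (simp add: L2_inner_def)
  also have "\<dots> \<ge> (LINT x|?M. \<alpha> / 2 * (norm (V x))\<^sup>2 + \<alpha> * \<beta> / 4 * (norm (U x - \<zeta>))\<^sup>2)"
  proof (rule integral_mono)
    show "integrable ?M (\<lambda>x. \<alpha> / 2 * (norm (V x))\<^sup>2 + \<alpha> * \<beta> / 4 * (norm (U x - \<zeta>))\<^sup>2)"
      by (intro integrable_Ioo_continuous continuous_intros cU cV)
    show "integrable ?M (\<lambda>x. ?P x - V x \<bullet> \<Phi>' x)" using iP iV by simp
    fix x assume "x \<in> space ?M"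
    then have x: "x \<in> {a..b}" by auto
    define s where "s = U x \<bullet> \<zeta>"
    note dev = small_deviation[OF unit[OF x] \<zeta> small[OF x], folded s_def]
    have "(norm (U x - \<zeta>))\<^sup>2 \<le> 1\<^sup>2" using small[OF x] by (intro power_mono) auto
    then have s: "1 / 2 \<le> s" "s \<le> 1" using dev(2) by auto
    have "V x \<bullet> \<Phi>' x = - (\<alpha> * (s * (norm (V x))\<^sup>2))"
      using tangent[OF x]
      by (simp add: \<Phi>'_def inner_simps dot_cross_self s_def inner_commute[of "V x" "U x"] power2_norm_eq_inner)
    moreover have "\<alpha> * ((1 / 2) * (norm (V x))\<^sup>2) \<le> \<alpha> * (s * (norm (V x))\<^sup>2)"
      using s \<alpha> by (intro mult_left_mono mult_right_mono) auto
    moreover have "\<alpha> * \<beta> * ((norm (U x - \<zeta>))\<^sup>2 / 2 * (1 / 2)) \<le> \<alpha> * \<beta> * (((U x $ 2)\<^sup>2 + (U x $ 3)\<^sup>2) * s)"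
    proof (intro mult_left_mono mult_mono)
      have "(1 - s) * 1 \<le> (1 - s) * (1 + s)" using s by (intro mult_left_mono) auto
      then show "(norm (U x - \<zeta>))\<^sup>2 / 2 \<le> (U x $ 2)\<^sup>2 + (U x $ 3)\<^sup>2"
        unfolding dev(3) using dev(2) by simp
    qed (use s \<alpha> \<beta> in auto)
    ultimately show "\<alpha> / 2 * (norm (V x))\<^sup>2 + \<alpha> * \<beta> / 4 * (norm (U x - \<zeta>))\<^sup>2 \<le> ?P x - V x \<bullet> \<Phi>' x"
      by (simp add: s_def mult.assoc)
  qed
  also have "(LINT x|?M. \<alpha> / 2 * (norm (V x))\<^sup>2 + \<alpha> * \<beta> / 4 * (norm (U x - \<zeta>))\<^sup>2) =
      \<alpha> / 2 * (L2_norm {a<..<b} V)\<^sup>2 + \<alpha> * \<beta> / 4 * (L2_norm {a<..<b} (\<lambda>x. U x - \<zeta>))\<^sup>2"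
    using L2_square_integrable[OF L(1)] L2_square_integrable[OF L(3)]
    by (simp add: L2_norm_square L2_inner_def power2_norm_eq_inner)
  finally show ?thesis .
qed

text \<open>
  The length is constant, so that its derivative vanishes.
\<close>

lemma neumann_rep_unit:
  assumes ab: "a < b" and r: "neumann_rep a b U V W"
    and unit: "AE x in lebesgue_on {a<..<b}. norm (U x) = 1" and x: "x \<in> {a..b}"
  shows "norm (U x) = 1" "U x \<bullet> V x = 0"
proof -
  have 1: "norm (U x) = 1" if "x \<in> {a..b}" for x
  proof -
    have "norm (U x) - 1 = 0"
      by (rule continuous_AE_eq_0[OF ab _ _ that])
        (use unit in \<open>auto intro!: continuous_intros neumann_rep_continuous[OF r]\<close>)
    then show ?thesis by simp
  qed
  show "norm (U x) = 1" by (rule 1[OF x])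
  have U: "(U has_vector_derivative V x) (at x within {a..b})"
    by (rule neumann_rep_derivative[OF r x])
  have "((\<lambda>x. U x \<bullet> U x) has_vector_derivative (U x \<bullet> V x + V x \<bullet> U x)) (at x within {a..b})"
    by (rule has_vector_derivative_inner'[OF U U])
  moreover have "((\<lambda>x. U x \<bullet> U x) has_vector_derivative 0) (at x within {a..b})"
    by (rule has_vector_derivative_transform[OF x _ has_vector_derivative_const[of 1]])
      (use 1 in \<open>simp add: norm_eq_1\<close>)
  ultimately have "U x \<bullet> V x + V x \<bullet> U x = 0"
    by (rule vector_derivative_unique_within_closed_interval[unfolded box_real, OF ab x])
  then show "U x \<bullet> V x = 0" by (simp add: inner_commute)
qed

lemma neumann_domain_H1: "u \<in> neumann_domain \<Omega> \<Longrightarrow> u \<in> H1 \<Omega>"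
  by (auto simp: neumann_domain_def H2_def H1_def)

lemma zeta_cases:
  assumes "\<zeta> \<in> {zeta_plus, zeta_minus}"
  obtains \<sigma> where "\<zeta> = vector [\<sigma>, 0, 0]" "\<sigma>\<^sup>2 = 1"
  using assms that[of 1] that[of "-1"] by (auto simp: zeta_plus_def zeta_minus_def)

lemma norm_zeta: "\<zeta> \<in> {zeta_plus, zeta_minus} \<Longrightarrow> norm \<zeta> = 1"
  by (auto simp: zeta_plus_def zeta_minus_def norm_eq_1 inner_vec_def sum_3)

text \<open>
  The smallness of the distance is used only through the bound \<open>\<alpha> / (4 * (1 + 2 * \<alpha>))\<close> for the
  maximal deviation of \<open>u\<close> from \<open>\<zeta>\<close>, which is at most \<open>1 / 8\<close> and at most \<open>\<alpha> / 4\<close>.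
\<close>

lemma dissipation:
  fixes \<alpha> \<beta> :: real
  assumes ab: "a < b" and \<alpha>: "\<alpha> > 0" and \<beta>: "\<beta> > 0" and k: "k = 2 * max 1 (1 / sqrt (b - a))"
    and \<zeta>: "\<zeta> \<in> {zeta_plus, zeta_minus}"
    and u: "u \<in> neumann_domain {a<..<b}" and unit: "AE x in lebesgue_on {a<..<b}. norm (u x) = 1"
    and small: "H1_norm {a<..<b} (\<lambda>x. u x - \<zeta>) \<le> 1 / (2 * k\<^sup>2 * sqrt (b - a)) * (\<alpha> / (1 + 2 * \<alpha>))"
    and z: "z \<in> L2 {a<..<b}"
      "AE x in lebesgue_on {a<..<b}. z x = LLG_rhs \<alpha> \<beta> (u x) (Laplacian {a<..<b} u x)"
  shows "0 \<le> L2_inner {a<..<b} (Laplacian {a<..<b} u) z"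
    and "min (\<alpha> / 2) (\<alpha> * \<beta> / 4) * (H1_norm {a<..<b} (\<lambda>x. u x - \<zeta>))\<^sup>2 \<le> L2_inner {a<..<b} z (\<lambda>x. \<zeta>)"
proof -
  let ?M = "lebesgue_on {a<..<b}" and ?W = "Laplacian {a<..<b} u"
  obtain \<sigma> where \<sigma>: "\<zeta> = vector [\<sigma>, 0, 0]" "\<sigma>\<^sup>2 = 1" using zeta_cases[OF \<zeta>] by blast
  obtain U V where r: "neumann_rep a b U V ?W" and uU: "AE x in ?M. u x = U x" and DV: "AE x in ?M. D {a<..<b} u x = V x"
    using neumann_domain_rep[OF ab u] by blast
  have unitU: "AE x in ?M. norm (U x) = 1" using unit uU by (auto elim: AE_mp)
  have zU: "AE x in ?M. z x = LLG_rhs \<alpha> \<beta> (U x) (?W x)" using z(2) uU by (auto elim: AE_mp)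
  note rep = neumann_rep_unit[OF ab r unitU]
  have uH: "u \<in> H1 {a<..<b}" by (rule neumann_domain_H1[OF u])
  have cL: "(\<lambda>x. \<zeta>) \<in> L2 {a<..<b}" by (rule L2_continuous) simp
  have n1: "L2_norm {a<..<b} (\<lambda>x. u x - \<zeta>) = L2_norm {a<..<b} (\<lambda>x. U x - \<zeta>)"
    by (rule L2_norm_cong_AE[OF L2_diff[OF H1_L2[OF uH] cL]]) (use uU in auto)
  have n2: "L2_norm {a<..<b} (D {a<..<b} u) = L2_norm {a<..<b} V"
    by (rule L2_norm_cong_AE[OF H1_D(1)[OF uH] DV]) simp
  define N where "N = H1_norm {a<..<b} (\<lambda>x. u x - \<zeta>)"
  have N: "N\<^sup>2 = (L2_norm {a<..<b} (\<lambda>x. U x - \<zeta>))\<^sup>2 + (L2_norm {a<..<b} V)\<^sup>2"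
    unfolding N_def H1_norm_diff_const_square[OF ab uH] n1 n2 ..
  have N0: "N \<ge> 0" by (simp add: N_def H1_norm_def)
  have NU: "L2_norm {a<..<b} (\<lambda>x. U x - \<zeta>) \<le> N" "L2_norm {a<..<b} V \<le> N"
    using N N0 by (auto intro!: power2_le_imp_le[OF _ N0])
  define R where "R = \<alpha> / (1 + 2 * \<alpha>)"
  define \<delta> where "\<delta> = R / 4"
  have dev: "norm (U x - \<zeta>) \<le> \<delta>" if x: "x \<in> {a..b}" for x
  proof -
    define L where "L = sqrt (b - a)"
    have L: "L > 0" using ab by (simp add: L_def)
    \<comment> \<open>the two terms of the maximum in \<open>k\<close> serve the two terms of the bound for the maximal deviation\<close>
    have k1: "k \<ge> 2" "k * L \<ge> 2"
    proof -
      show "k \<ge> 2" using k by simp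
      have "(1 / L) * L \<le> max 1 (1 / L) * L" using L by (intro mult_right_mono) auto
      then show "k * L \<ge> 2" using L by (simp add: k L_def[symmetric])
    qed
    have k2: "1 / (2 * k\<^sup>2) \<le> 1 / 8" "1 / (2 * (k * L)\<^sup>2) \<le> 1 / 8"
    proof -
      have "2\<^sup>2 \<le> k\<^sup>2" "2\<^sup>2 \<le> (k * L)\<^sup>2" using k1 by (intro power_mono; simp)+
      moreover have "1 / (2 * t) \<le> 1 / 8" if "2\<^sup>2 \<le> t" for t :: real
        using that by (simp add: field_simps)
      ultimately show "1 / (2 * k\<^sup>2) \<le> 1 / 8" "1 / (2 * (k * L)\<^sup>2) \<le> 1 / 8" by blast+
    qed
    define \<epsilon> where "\<epsilon> = 1 / (2 * k\<^sup>2 * L) * R"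
    have "norm (U x - \<zeta>) \<le> L2_norm {a<..<b} (\<lambda>x. U x - \<zeta>) / L + L * L2_norm {a<..<b} V"
      unfolding L_def by (rule neumann_sup_bound[OF ab r x])
    also have "\<dots> \<le> \<epsilon> / L + L * \<epsilon>"
      using NU small L by (intro add_mono divide_right_mono mult_left_mono) (auto simp: N_def \<epsilon>_def L_def R_def)
    also have "\<dots> = (1 / (2 * (k * L)\<^sup>2) + 1 / (2 * k\<^sup>2)) * R"
      using L k1(1) by (simp add: \<epsilon>_def field_simps power2_eq_square)
    also have "\<dots> \<le> (1 / 8 + 1 / 8) * R"
      using k2 \<alpha> by (intro mult_right_mono add_mono) (auto simp: R_def)
    finally show ?thesis by (simp add: \<delta>_def)
  qed
  have \<delta>: "0 \<le> \<delta>" "\<delta> \<le> 1 / 8" "\<delta> \<le> \<alpha> / 4"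
  proof -
    have "R \<le> 1 / 2" using \<alpha> by (simp add: R_def field_simps)
    then show "\<delta> \<le> 1 / 8" by (simp add: \<delta>_def)
    have "R \<le> \<alpha> / 1" unfolding R_def using \<alpha> by (intro divide_left_mono) auto
    then show "\<delta> \<le> \<alpha> / 4" by (simp add: \<delta>_def)
    show "0 \<le> \<delta>" using \<alpha> by (simp add: \<delta>_def R_def)
  qed
  have \<delta>2: "\<delta>\<^sup>2 \<le> 1 / 64" "\<delta>\<^sup>2 \<le> \<alpha> / 32"
    using mult_mono[OF \<delta>(2,2)] mult_mono[OF \<delta>(3,2)] \<delta> \<alpha> by (auto simp: power2_eq_square)
  show "0 \<le> L2_inner {a<..<b} ?W z"
  proof (rule neumann_inner_LLG_rhs_nonneg[OF ab r \<alpha> \<beta> rep _ _ z(1) zU])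
    fix x assume x: "x \<in> {a..b}"
    show "(U x $ 2)\<^sup>2 + (U x $ 3)\<^sup>2 \<le> 1 / 64" "(U x $ 2)\<^sup>2 + (U x $ 3)\<^sup>2 \<le> \<alpha> / 32"
      using small_deviation(1)[OF rep(1)[OF x] \<sigma> dev[OF x]] \<delta>2 by auto
  qed
  have "min (\<alpha> / 2) (\<alpha> * \<beta> / 4) * N\<^sup>2 \<le> \<alpha> / 2 * (L2_norm {a<..<b} V)\<^sup>2 + \<alpha> * \<beta> / 4 * (L2_norm {a<..<b} (\<lambda>x. U x - \<zeta>))\<^sup>2"
    unfolding N distrib_left using mult_right_mono[OF min.cobounded1, of "(L2_norm {a<..<b} V)\<^sup>2" "\<alpha> / 2" "\<alpha> * \<beta> / 4"]
      mult_right_mono[OF min.cobounded2, of "(L2_norm {a<..<b} (\<lambda>x. U x - \<zeta>))\<^sup>2" "\<alpha> / 2" "\<alpha> * \<beta> / 4"]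
    by (simp add: mult.commute[of 2])
  also have "\<dots> \<le> L2_inner {a<..<b} z (\<lambda>x. \<zeta>)"
    using dev \<delta> by (intro neumann_inner_LLG_rhs_axis[OF ab r \<alpha> \<beta> rep \<sigma> _ z(1) zU]) force+
  finally show "min (\<alpha> / 2) (\<alpha> * \<beta> / 4) * (H1_norm {a<..<b} (\<lambda>x. u x - \<zeta>))\<^sup>2 \<le> L2_inner {a<..<b} z (\<lambda>x. \<zeta>)"
    unfolding N_def .
qed

section \<open>Testing Bochner integrals against a fixed function\<close>

lemma borel_measurable_AE_limit:
  fixes h :: "nat \<Rightarrow> real \<Rightarrow> real"
  assumes I: "I \<in> sets lebesgue" and h: "\<And>n. h n \<in> borel_measurable (lebesgue_on I)"
    and lim: "AE t in lebesgue_on I. (\<lambda>n. h n t) \<longlonglongrightarrow> g t"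
  shows "g \<in> borel_measurable (lebesgue_on I)"
proof (rule borel_measurable_AE_on[OF I])
  show "(\<lambda>t. lim (\<lambda>n. h n t)) \<in> borel_measurable (lebesgue_on I)"
    by (rule borel_measurable_lim_metric[OF h])
  show "AE t in lebesgue_on I. lim (\<lambda>n. h n t) = g t"
    using lim by (rule AE_mp) (auto intro!: AE_I2 limI)
qed

lemma simple_approx_AE_L2:
  assumes "simple_approx (L2 \<Omega>) (L2_norm \<Omega>) I s u" "I \<in> sets lebesgue"
  shows "AE t in lebesgue_on I. u t \<in> L2 \<Omega> \<and> (\<forall>n. s n t \<in> L2 \<Omega>) \<and> (\<lambda>n. L2_norm \<Omega> (\<lambda>x. s n t x - u t x)) \<longlonglongrightarrow> 0"
proof -
  have "AE t in lebesgue_on I. u t \<in> L2 \<Omega> \<and> (\<lambda>n. L2_norm \<Omega> (\<lambda>x. s n t x - u t x)) \<longlonglongrightarrow> 0"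
    using assms by (simp add: simple_approx_def)
  then show ?thesis
  proof (rule AE_mp, intro AE_I2 impI)
    fix t assume "t \<in> space (lebesgue_on I)"
      and "u t \<in> L2 \<Omega> \<and> (\<lambda>n. L2_norm \<Omega> (\<lambda>x. s n t x - u t x)) \<longlonglongrightarrow> 0"
    moreover have "s n t \<in> L2 \<Omega>" if "t \<in> I" for n
      using assms(1) that by (auto simp: simple_approx_def)
    ultimately show "u t \<in> L2 \<Omega> \<and> (\<forall>n. s n t \<in> L2 \<Omega>) \<and> (\<lambda>n. L2_norm \<Omega> (\<lambda>x. s n t x - u t x)) \<longlonglongrightarrow> 0"
      by simp
  qed
qed

text \<open>
  All three functions of time are limits almost everywhere of real simple functions.
\<close>

lemma simple_approx_measurable:
  assumes s: "simple_approx (L2 \<Omega>) (L2_norm \<Omega>) I s u" and I: "I \<in> sets lebesgue" and v: "v \<in> L2 \<Omega>"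
  shows "(\<lambda>t. L2_inner \<Omega> (s n t) v) \<in> borel_measurable (lebesgue_on I)"
    and "(\<lambda>t. L2_inner \<Omega> (u t) v) \<in> borel_measurable (lebesgue_on I)"
    and "(\<lambda>t. L2_norm \<Omega> (\<lambda>x. s n t x - u t x)) \<in> borel_measurable (lebesgue_on I)"
proof -
  have sf: "simple_function (lebesgue_on I) (s n)" for n using s by (simp add: simple_approx_def)
  have m: "(\<lambda>t. L2_inner \<Omega> (s n t) v) \<in> borel_measurable (lebesgue_on I)" for n
    using borel_measurable_simple_function[OF simple_function_compose1[OF sf, of "\<lambda>g. L2_inner \<Omega> g v"]] .
  then show "(\<lambda>t. L2_inner \<Omega> (s n t) v) \<in> borel_measurable (lebesgue_on I)" .
  note ae = simple_approx_AE_L2[OF s I]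
  show "(\<lambda>t. L2_inner \<Omega> (u t) v) \<in> borel_measurable (lebesgue_on I)"
  proof (rule borel_measurable_AE_limit[OF I m])
    show "AE t in lebesgue_on I. (\<lambda>n. L2_inner \<Omega> (s n t) v) \<longlonglongrightarrow> L2_inner \<Omega> (u t) v"
      using ae
    proof (rule AE_mp, intro AE_I2 impI)
      fix t assume t: "u t \<in> L2 \<Omega> \<and> (\<forall>n. s n t \<in> L2 \<Omega>) \<and> (\<lambda>n. L2_norm \<Omega> (\<lambda>x. s n t x - u t x)) \<longlonglongrightarrow> 0"
      show "(\<lambda>n. L2_inner \<Omega> (s n t) v) \<longlonglongrightarrow> L2_inner \<Omega> (u t) v"
      proof (rule LIM_zero_cancel, rule Lim_null_comparison)
        show "(\<lambda>n. L2_norm \<Omega> (\<lambda>x. s n t x - u t x) * L2_norm \<Omega> v) \<longlonglongrightarrow> 0"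
          using t by (intro tendsto_mult_left_zero) auto
        show "\<forall>\<^sub>F n in sequentially. norm (L2_inner \<Omega> (s n t) v - L2_inner \<Omega> (u t) v)
            \<le> L2_norm \<Omega> (\<lambda>x. s n t x - u t x) * L2_norm \<Omega> v"
          using t v L2_Cauchy_Schwarz[OF L2_diff v] by (auto simp: L2_inner_diff_left)
      qed
    qed
  qed
  show "(\<lambda>t. L2_norm \<Omega> (\<lambda>x. s n t x - u t x)) \<in> borel_measurable (lebesgue_on I)"
  proof (rule borel_measurable_AE_limit[OF I])
    show "(\<lambda>t. L2_norm \<Omega> (\<lambda>x. s n t x - s m t x)) \<in> borel_measurable (lebesgue_on I)" for m
      using borel_measurable_simple_function[OF simple_function_compose2[OF sf[of n] sf[of m], of "\<lambda>g h. L2_norm \<Omega> (\<lambda>x. g x - h x)"]] .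
    show "AE t in lebesgue_on I. (\<lambda>m. L2_norm \<Omega> (\<lambda>x. s n t x - s m t x)) \<longlonglongrightarrow> L2_norm \<Omega> (\<lambda>x. s n t x - u t x)"
      using ae
    proof (rule AE_mp, intro AE_I2 impI)
      fix t assume t: "u t \<in> L2 \<Omega> \<and> (\<forall>n. s n t \<in> L2 \<Omega>) \<and> (\<lambda>n. L2_norm \<Omega> (\<lambda>x. s n t x - u t x)) \<longlonglongrightarrow> 0"
      show "(\<lambda>m. L2_norm \<Omega> (\<lambda>x. s n t x - s m t x)) \<longlonglongrightarrow> L2_norm \<Omega> (\<lambda>x. s n t x - u t x)"
      proof (rule LIM_zero_cancel, rule Lim_null_comparison)
        show "(\<lambda>m. L2_norm \<Omega> (\<lambda>x. s m t x - u t x)) \<longlonglongrightarrow> 0" using t by auto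
        have "norm (L2_norm \<Omega> (\<lambda>x. s n t x - s m t x) - L2_norm \<Omega> (\<lambda>x. s n t x - u t x)) \<le> L2_norm \<Omega> (\<lambda>x. s m t x - u t x)" for m
          using L2_norm_reverse_triangle[of "\<lambda>x. s n t x - s m t x" \<Omega> "\<lambda>x. s n t x - u t x"] t
          by (simp add: L2_diff L2_norm_minus_commute[of _ "u t"])
        then show "\<forall>\<^sub>F m in sequentially. norm (L2_norm \<Omega> (\<lambda>x. s n t x - s m t x) - L2_norm \<Omega> (\<lambda>x. s n t x - u t x)) \<le> L2_norm \<Omega> (\<lambda>x. s m t x - u t x)"
          by simp
      qed
    qed
  qed
qed

lemma simple_function_L2_inner_integral:
  assumes I: "I \<in> lmeasurable" and s: "simple_function (lebesgue_on I) s" "s ` I \<subseteq> L2 \<Omega>" and v: "v \<in> L2 \<Omega>"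
  shows "integrable (lebesgue_on I) (\<lambda>t. L2_inner \<Omega> (s t) v)"
    and "(LINT t|lebesgue_on I. L2_inner \<Omega> (s t) v) = L2_inner \<Omega> (\<lambda>x. LINT t|lebesgue_on I. s t x) v"
    and "(\<lambda>x. LINT t|lebesgue_on I. s t x) \<in> L2 \<Omega>"
proof -
  let ?M = "lebesgue_on I"
  interpret finite_measure ?M by (rule finite_measure_lebesgue_on[OF I])
  define A where "A g = s -` {g} \<inter> I" for g
  have fin: "finite (s ` I)" and A: "A g \<in> sets ?M" for g
    using simple_functionD[OF s(1)] by (auto simp: A_def)
  have rep: "F (s t) = (\<Sum>g\<in>s ` I. indicator (A g) t *\<^sub>R F g)" if "t \<in> I" for t and F :: "(real \<Rightarrow> real^3) \<Rightarrow> 'z::real_vector"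
  proof -
    have "(\<Sum>g\<in>s ` I. indicator (A g) t *\<^sub>R F g) = (\<Sum>g\<in>s ` I. if g = s t then F g else 0)"
      using that by (intro sum.cong) (auto simp: A_def indicator_def)
    then show ?thesis using fin that by (simp add: sum.delta)
  qed
  have ind: "has_bochner_integral ?M (\<lambda>t. indicator (A g) t *\<^sub>R c) (measure ?M (A g) *\<^sub>R c)" for g and c :: "'z::{banach,second_countable_topology}"
    by (rule has_bochner_integral_indicator) (auto simp: A less_top[symmetric])
  have F: "has_bochner_integral ?M (\<lambda>t. F (s t)) (\<Sum>g\<in>s ` I. measure ?M (A g) *\<^sub>R F g)"
    for F :: "(real \<Rightarrow> real^3) \<Rightarrow> 'z::{banach,second_countable_topology}"
  proof -
    have "has_bochner_integral ?M (\<lambda>t. \<Sum>g\<in>s ` I. indicator (A g) t *\<^sub>R F g) (\<Sum>g\<in>s ` I. measure ?M (A g) *\<^sub>R F g)"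
      by (rule has_bochner_integral_sum[OF ind])
    then show ?thesis
      by (rule has_bochner_integral_cong[THEN iffD1, rotated 3]) (use rep[of _ F] in auto)
  qed
  have int: "(\<lambda>x. LINT t|?M. s t x) = (\<lambda>x. \<Sum>g\<in>s ` I. measure ?M (A g) *\<^sub>R g x)"
    using F[of "\<lambda>g. g _"] by (auto dest: has_bochner_integral_integral_eq)
  have gL: "(\<lambda>x. measure ?M (A g) *\<^sub>R g x) \<in> L2 \<Omega>" if "g \<in> s ` I" for g
    using s(2) that by (intro L2_scaleR) auto
  show "integrable ?M (\<lambda>t. L2_inner \<Omega> (s t) v)"
    using F[of "\<lambda>g. L2_inner \<Omega> g v"] by (rule integrable.intros)
  show "(\<lambda>x. LINT t|?M. s t x) \<in> L2 \<Omega>" unfolding int by (rule L2_sum[OF fin gL])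
  have "(LINT t|?M. L2_inner \<Omega> (s t) v) = (\<Sum>g\<in>s ` I. measure ?M (A g) * L2_inner \<Omega> g v)"
    using has_bochner_integral_integral_eq[OF F[of "\<lambda>g. L2_inner \<Omega> g v"]] by simp
  also have "\<dots> = L2_inner \<Omega> (\<lambda>x. LINT t|?M. s t x) v"
    unfolding int using L2_inner_sum_left[OF fin gL v] by (simp add: L2_inner_scaleR_left)
  finally show "(LINT t|?M. L2_inner \<Omega> (s t) v) = L2_inner \<Omega> (\<lambda>x. LINT t|?M. s t x) v" .
qed

text \<open>
  Pairing with a fixed function commutes with the Bochner integral.  For simple functions this is linearity,
  and both sides are continuous under the two limits in the definition.  It reduces the vector
  valued weak time derivative to real functions of time.
\<close>

lemma L2_bochner_integral_inner:
  assumes I: "I \<in> lmeasurable" and u: "has_L2_bochner_integral \<Omega> I u w" and v: "v \<in> L2 \<Omega>"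
  shows "(LINT t|lebesgue_on I. L2_inner \<Omega> (u t) v) = L2_inner \<Omega> w v"
proof -
  let ?M = "lebesgue_on I"
  have Is: "I \<in> sets lebesgue" using I by (rule fmeasurableD)
  obtain s where w: "w \<in> L2 \<Omega>" and s: "simple_approx (L2 \<Omega>) (L2_norm \<Omega>) I s u"
    and l1: "(\<lambda>n. \<integral>\<^sup>+t. ennreal (L2_norm \<Omega> (\<lambda>x. s n t x - u t x)) \<partial>?M) \<longlonglongrightarrow> 0"
    and lim: "(\<lambda>n. L2_norm \<Omega> (\<lambda>x. (LINT t|?M. s n t x) - w x)) \<longlonglongrightarrow> 0"
    using u unfolding has_L2_bochner_integral_def by blast
  have sf: "simple_function ?M (s n)" "s n ` I \<subseteq> L2 \<Omega>" for n
    using s by (auto simp: simple_approx_def)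
  note simple = simple_function_L2_inner_integral[OF I sf v]
  note meas = simple_approx_measurable[OF s Is v]
  define h where "h n t = L2_inner \<Omega> (s n t) v" for n t
  define g where "g t = L2_inner \<Omega> (u t) v" for t
  have hg: "AE t in ?M. \<forall>n. norm (h n t - g t) \<le> L2_norm \<Omega> v * L2_norm \<Omega> (\<lambda>x. s n t x - u t x)"
    using simple_approx_AE_L2[OF s Is]
  proof (rule AE_mp, intro AE_I2 impI allI)
    fix t n assume t: "u t \<in> L2 \<Omega> \<and> (\<forall>n. s n t \<in> L2 \<Omega>) \<and> (\<lambda>n. L2_norm \<Omega> (\<lambda>x. s n t x - u t x)) \<longlonglongrightarrow> 0"
    then show "norm (h n t - g t) \<le> L2_norm \<Omega> v * L2_norm \<Omega> (\<lambda>x. s n t x - u t x)"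
      using L2_Cauchy_Schwarz[OF L2_diff[of "s n t" \<Omega> "u t"] v] v
      by (simp add: h_def g_def L2_inner_diff_left mult.commute)
  qed
  have bound: "(\<integral>\<^sup>+t. norm (h n t - g t) \<partial>?M) \<le> ennreal (L2_norm \<Omega> v) * (\<integral>\<^sup>+t. ennreal (L2_norm \<Omega> (\<lambda>x. s n t x - u t x)) \<partial>?M)" for n
  proof -
    have "(\<integral>\<^sup>+t. norm (h n t - g t) \<partial>?M) \<le> (\<integral>\<^sup>+t. ennreal (L2_norm \<Omega> v) * ennreal (L2_norm \<Omega> (\<lambda>x. s n t x - u t x)) \<partial>?M)"
    proof (rule nn_integral_mono_AE, rule AE_mp[OF hg], intro AE_I2 impI)
      fix t assume "\<forall>n. norm (h n t - g t) \<le> L2_norm \<Omega> v * L2_norm \<Omega> (\<lambda>x. s n t x - u t x)"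
      then show "ennreal (norm (h n t - g t)) \<le> ennreal (L2_norm \<Omega> v) * ennreal (L2_norm \<Omega> (\<lambda>x. s n t x - u t x))"
        by (simp add: ennreal_mult[symmetric] L2_norm_nonneg ennreal_leI)
    qed
    also have "\<dots> = ennreal (L2_norm \<Omega> v) * (\<integral>\<^sup>+t. ennreal (L2_norm \<Omega> (\<lambda>x. s n t x - u t x)) \<partial>?M)"
      using meas(3) by (intro nn_integral_cmult) auto
    finally show ?thesis .
  qed
  have "(\<lambda>n. ennreal (L2_norm \<Omega> v) * (\<integral>\<^sup>+t. ennreal (L2_norm \<Omega> (\<lambda>x. s n t x - u t x)) \<partial>?M)) \<longlonglongrightarrow> ennreal (L2_norm \<Omega> v) * 0"
    by (intro ennreal_tendsto_cmult l1) simp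
  then have l1': "(\<lambda>n. ennreal (L2_norm \<Omega> v) * (\<integral>\<^sup>+t. ennreal (L2_norm \<Omega> (\<lambda>x. s n t x - u t x)) \<partial>?M)) \<longlonglongrightarrow> 0" by simp
  \<comment> \<open>convergence in mean, which also yields the integrability of the limit\<close>
  have lim1: "(\<lambda>n. \<integral>\<^sup>+t. norm (h n t - g t) \<partial>?M) \<longlonglongrightarrow> 0"
    by (rule tendsto_sandwich[OF _ _ tendsto_const l1']) (use bound in auto)
  have hi: "integrable ?M (h n)" for n using simple(1)[of n] by (simp add: h_def[abs_def])
  have "eventually (\<lambda>n. (\<integral>\<^sup>+t. norm (h n t - g t) \<partial>?M) < 1) sequentially"
    by (rule order_tendstoD(2)[OF lim1]) simp
  then obtain n where n: "(\<integral>\<^sup>+t. norm (h n t - g t) \<partial>?M) < 1" by (auto simp: eventually_sequentially)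
  have "integrable ?M (\<lambda>t. h n t - g t)"
  proof (rule integrableI_bounded)
    show "(\<lambda>t. h n t - g t) \<in> borel_measurable ?M"
      using meas(1,2) by (simp add: h_def g_def)
    show "(\<integral>\<^sup>+t. norm (h n t - g t) \<partial>?M) < \<infinity>" using n less_trans[OF _ ennreal_one_less_top] by (simp add: top.not_eq_extremum)
  qed
  from Bochner_Integration.integrable_diff[OF hi[of n] this] have gi: "integrable ?M g" by simp
  have "(\<lambda>n. LINT t|?M. h n t) \<longlonglongrightarrow> (LINT t|?M. g t)"
    by (rule tendsto_L1_int[OF _ gi lim1]) (use hi in auto)
  moreover have "(\<lambda>n. LINT t|?M. h n t) \<longlonglongrightarrow> L2_inner \<Omega> w v"
  proof (rule LIM_zero_cancel, rule Lim_null_comparison)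
    show "(\<lambda>n. L2_norm \<Omega> (\<lambda>x. (LINT t|?M. s n t x) - w x) * L2_norm \<Omega> v) \<longlonglongrightarrow> 0"
      by (rule tendsto_mult_left_zero[OF lim])
    have "norm ((LINT t|?M. h n t) - L2_inner \<Omega> w v) \<le> L2_norm \<Omega> (\<lambda>x. (LINT t|?M. s n t x) - w x) * L2_norm \<Omega> v" for n
      using L2_Cauchy_Schwarz[OF L2_diff[OF simple(3)[of n] w] v]
      by (simp add: h_def simple(2) L2_inner_diff_left[OF simple(3)[of n] w v])
    then show "\<forall>\<^sub>F n in sequentially. norm ((LINT t|?M. h n t) - L2_inner \<Omega> w v) \<le> L2_norm \<Omega> (\<lambda>x. (LINT t|?M. s n t x) - w x) * L2_norm \<Omega> v"
      by simp
  qed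
  ultimately show ?thesis unfolding g_def[symmetric] by (rule LIMSEQ_unique)
qed

section \<open>The evolution of the Dirichlet energy\<close>

lemma cont_into_L2_inner:
  assumes c: "cont_into (H1 \<Omega>) (H1_norm \<Omega>) I y" and v: "v \<in> L2 \<Omega>"
  shows "continuous_on I (\<lambda>t. L2_inner \<Omega> (y t) v)"
  unfolding continuous_on_def
proof
  fix t assume t: "t \<in> I"
  have lim: "((\<lambda>s. H1_norm \<Omega> (\<lambda>x. y s x - y t x)) \<longlongrightarrow> 0) (at t within I)" and L: "\<And>s. s \<in> I \<Longrightarrow> y s \<in> L2 \<Omega>"
    using c t by (auto simp: cont_into_def intro: H1_L2)
  show "((\<lambda>t. L2_inner \<Omega> (y t) v) \<longlongrightarrow> L2_inner \<Omega> (y t) v) (at t within I)"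
  proof (rule LIM_zero_cancel, rule Lim_null_comparison)
    show "((\<lambda>s. H1_norm \<Omega> (\<lambda>x. y s x - y t x) * L2_norm \<Omega> v) \<longlongrightarrow> 0) (at t within I)"
      by (rule tendsto_mult_left_zero[OF lim])
    show "\<forall>\<^sub>F s in at t within I. norm (L2_inner \<Omega> (y s) v - L2_inner \<Omega> (y t) v) \<le> H1_norm \<Omega> (\<lambda>x. y s x - y t x) * L2_norm \<Omega> v"
      unfolding eventually_at_filter
    proof (intro always_eventually allI impI)
      fix s assume "s \<in> I"
      have "norm (L2_inner \<Omega> (y s) v - L2_inner \<Omega> (y t) v) \<le> L2_norm \<Omega> (\<lambda>x. y s x - y t x) * L2_norm \<Omega> v"
        using L2_Cauchy_Schwarz[OF L2_diff[OF L[OF \<open>s \<in> I\<close>] L[OF t]] v]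
        by (simp add: L2_inner_diff_left L \<open>s \<in> I\<close> t v)
      also have "\<dots> \<le> H1_norm \<Omega> (\<lambda>x. y s x - y t x) * L2_norm \<Omega> v"
        by (intro mult_right_mono L2_norm_le_H1_norm L2_norm_nonneg)
      finally show "norm (L2_inner \<Omega> (y s) v - L2_inner \<Omega> (y t) v) \<le> H1_norm \<Omega> (\<lambda>x. y s x - y t x) * L2_norm \<Omega> v" .
    qed
  qed
qed

lemma cont_into_L2_norm_D:
  assumes ab: "a < b" and c: "cont_into (H1 {a<..<b}) (H1_norm {a<..<b}) I y"
  shows "continuous_on I (\<lambda>t. L2_norm {a<..<b} (D {a<..<b} (y t)))"
  unfolding continuous_on_def
proof
  let ?\<Omega> = "{a<..<b}"
  fix t assume t: "t \<in> I"
  have lim: "((\<lambda>s. H1_norm ?\<Omega> (\<lambda>x. y s x - y t x)) \<longlongrightarrow> 0) (at t within I)" and L: "\<And>s. s \<in> I \<Longrightarrow> y s \<in> H1 ?\<Omega>"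
    using c t by (auto simp: cont_into_def)
  show "((\<lambda>t. L2_norm ?\<Omega> (D ?\<Omega> (y t))) \<longlongrightarrow> L2_norm ?\<Omega> (D ?\<Omega> (y t))) (at t within I)"
  proof (rule LIM_zero_cancel, rule Lim_null_comparison[OF _ lim])
    show "\<forall>\<^sub>F s in at t within I. norm (L2_norm ?\<Omega> (D ?\<Omega> (y s)) - L2_norm ?\<Omega> (D ?\<Omega> (y t))) \<le> H1_norm ?\<Omega> (\<lambda>x. y s x - y t x)"
      unfolding eventually_at_filter
    proof (intro always_eventually allI impI)
      fix s assume s: "s \<in> I"
      have "norm (L2_norm ?\<Omega> (D ?\<Omega> (y s)) - L2_norm ?\<Omega> (D ?\<Omega> (y t))) \<le> L2_norm ?\<Omega> (\<lambda>x. D ?\<Omega> (y s) x - D ?\<Omega> (y t) x)"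
        using L2_norm_reverse_triangle[OF H1_D(1)[OF L[OF s]] H1_D(1)[OF L[OF t]]] by simp
      also have "\<dots> = L2_norm ?\<Omega> (D ?\<Omega> (\<lambda>x. y s x - y t x))"
        by (rule L2_norm_cong_AE[OF L2_diff[OF H1_D(1)[OF L[OF s]] H1_D(1)[OF L[OF t]]]])
          (use D_diff_AE_eq[OF ab L[OF s] L[OF t]] in auto)
      also have "\<dots> \<le> H1_norm ?\<Omega> (\<lambda>x. y s x - y t x)" by (rule L2_norm_D_le_H1_norm)
      finally show "norm (L2_norm ?\<Omega> (D ?\<Omega> (y s)) - L2_norm ?\<Omega> (D ?\<Omega> (y t))) \<le> H1_norm ?\<Omega> (\<lambda>x. y s x - y t x)" .
    qed
  qed
qed

lemma bochner_L2_inner_integrable: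
  assumes z: "z \<in> bochner_L2 (L2 \<Omega>) (L2_norm \<Omega>) {0<..<T}" and v: "v \<in> L2 \<Omega>"
  shows "integrable (lebesgue_on {0<..<T::real}) (\<lambda>t. L2_inner \<Omega> (z t) v)"
proof -
  let ?M = "lebesgue_on {0<..<T}"
  obtain s where s: "simple_approx (L2 \<Omega>) (L2_norm \<Omega>) {0<..<T} s z"
    and sq: "integrable ?M (\<lambda>t. (L2_norm \<Omega> (z t))\<^sup>2)"
    using z unfolding bochner_L2_def by blast
  have one: "integrable ?M (\<lambda>t. (L2_norm \<Omega> v)\<^sup>2)" by (rule integrable_Ioo_continuous) simp
  show ?thesis
  proof (rule Bochner_Integration.integrable_bound)
    show "integrable ?M (\<lambda>t. (L2_norm \<Omega> (z t))\<^sup>2 + (L2_norm \<Omega> v)\<^sup>2)" using sq one by simp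
    show "(\<lambda>t. L2_inner \<Omega> (z t) v) \<in> borel_measurable ?M"
      by (rule simple_approx_measurable(2)[OF s _ v]) simp
    show "AE t in ?M. norm (L2_inner \<Omega> (z t) v) \<le> norm ((L2_norm \<Omega> (z t))\<^sup>2 + (L2_norm \<Omega> v)\<^sup>2)"
    proof (rule AE_mp[OF simple_approx_AE_L2[OF s]], simp, intro AE_I2 impI)
      fix t assume t: "z t \<in> L2 \<Omega> \<and> (\<forall>n. s n t \<in> L2 \<Omega>) \<and> (\<lambda>n. L2_norm \<Omega> (\<lambda>x. s n t x - z t x)) \<longlonglongrightarrow> 0"
      have "norm (L2_inner \<Omega> (z t) v) \<le> L2_norm \<Omega> (z t) * L2_norm \<Omega> v"
        using L2_Cauchy_Schwarz[OF _ v, of "z t"] t by simp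
      also have "\<dots> \<le> 2 * L2_norm \<Omega> (z t) * L2_norm \<Omega> v" by (simp add: L2_norm_nonneg)
      also have "\<dots> \<le> (L2_norm \<Omega> (z t))\<^sup>2 + (L2_norm \<Omega> v)\<^sup>2" by (rule sum_squares_bound)
      finally show "norm (L2_inner \<Omega> (z t) v) \<le> norm ((L2_norm \<Omega> (z t))\<^sup>2 + (L2_norm \<Omega> v)\<^sup>2)" by simp
    qed
  qed
qed

text \<open>
  The real function \<open>\<lambda>t. L2_inner \<Omega> (y t) v\<close> has an integrable weak derivative, and it is continuous, so that it equals
  the primitive everywhere.
\<close>

lemma weak_time_deriv_inner_primitive:
  assumes T: "0 < T" and c: "cont_into (H1 \<Omega>) (H1_norm \<Omega>) {0..T} y"
    and z: "z \<in> bochner_L2 (L2 \<Omega>) (L2_norm \<Omega>) {0<..<T}"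
    and yz: "weak_time_deriv \<Omega> {0<..<T} y z" and v: "v \<in> L2 \<Omega>"
    and t: "t \<in> {0..T}"
  shows "L2_inner \<Omega> (y t) v = L2_inner \<Omega> (y 0) v + integral {0..t} (\<lambda>s. L2_inner \<Omega> (z s) v)"
proof -
  let ?M = "lebesgue_on {0<..<T}"
  define Y Z where "Y t = L2_inner \<Omega> (y t) v" and "Z t = L2_inner \<Omega> (z t) v" for t
  have Yc: "continuous_on {0..T} Y" unfolding Y_def by (rule cont_into_L2_inner[OF c v])
  have Zi: "integrable ?M Z" unfolding Z_def by (rule bochner_L2_inner_integrable[OF z v])
  have "\<exists>d. AE t in ?M. Y t = d + integral {0..t} Z"
  proof (rule weak_derivative_imp_primitive[OF T integrable_Ioo_continuous[OF Yc] Zi])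
    fix \<phi> assume "\<phi> \<in> test_functions {0<..<T}"
    then obtain w where w: "has_L2_bochner_integral \<Omega> {0<..<T} (\<lambda>t x. deriv \<phi> t *\<^sub>R y t x) w"
      "has_L2_bochner_integral \<Omega> {0<..<T} (\<lambda>t x. - (\<phi> t *\<^sub>R z t x)) w"
      using yz unfolding weak_time_deriv_def by blast
    show "(LINT t|?M. deriv \<phi> t * Y t) = - (LINT t|?M. \<phi> t * Z t)"
      using L2_bochner_integral_inner[OF _ w(1) v] L2_bochner_integral_inner[OF _ w(2) v]
      by (simp add: L2_inner_scaleR_left L2_inner_minus_left Y_def Z_def)
  qed
  then obtain d where d: "AE t in ?M. Y t = d + integral {0..t} Z" by blast
  have eq: "Y t - (d + integral {0..t} Z) = 0" if "t \<in> {0..T}" for t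
    by (rule continuous_AE_eq_0[OF T _ _ that])
      (use d in \<open>auto intro!: continuous_on_diff Yc primitive_continuous Zi\<close>)
  have "Y 0 = d" using eq[of 0] T by simp
  then show ?thesis using eq[OF t] by (simp add: Y_def Z_def[abs_def])
qed

text \<open>
  The Dirichlet energy equals \<open>- L2_inner \<Omega> (Laplacian \<Omega> u) u\<close>, to which Parseval's identity for the cosines
  applies.  Passing through the cosines of \<open>u\<close> itself makes a separate treatment of sine series for \<open>D u\<close> superfluous.
\<close>

lemma Dirichlet_energy_cosine:
  assumes ab: "a < b" and u: "u \<in> neumann_domain {a<..<b}"
  shows "Laplacian {a<..<b} u \<in> L2 {a<..<b}"
    and "cosine_coeff a b (Laplacian {a<..<b} u) p = - (real (fst p) * pi / (b - a))\<^sup>2 * cosine_coeff a b u p"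
    and "(\<lambda>n. \<Sum>p\<in>modes n. (real (fst p) * pi / (b - a))\<^sup>2 / mode_weight a b p * (cosine_coeff a b u p)\<^sup>2)
      \<longlonglongrightarrow> (L2_norm {a<..<b} (D {a<..<b} u))\<^sup>2"
proof -
  let ?\<Omega> = "{a<..<b}"
  obtain U V where r: "neumann_rep a b U V (Laplacian ?\<Omega> u)" and uU: "AE x in lebesgue_on ?\<Omega>. u x = U x"
    and DV: "AE x in lebesgue_on ?\<Omega>. D ?\<Omega> u x = V x"
    using neumann_domain_rep[OF ab u] by blast
  have uL: "u \<in> L2 ?\<Omega>" "D ?\<Omega> u \<in> L2 ?\<Omega>" using H1_L2 H1_D neumann_domain_H1[OF u] by auto
  show W: "Laplacian ?\<Omega> u \<in> L2 ?\<Omega>" using r by (simp add: neumann_rep_def)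
  have "cosine_coeff a b u p = cosine_coeff a b U p" for p
    unfolding cosine_coeff_def by (rule L2_inner_cong_AE[OF uL(1) uU cosine_mode_L2[OF ab]]) auto
  then show co: "cosine_coeff a b (Laplacian ?\<Omega> u) p = - (real (fst p) * pi / (b - a))\<^sup>2 * cosine_coeff a b u p" for p
    using neumann_cosine_coeff[OF ab r] by simp
  have "(\<lambda>n. - cosine_product a b n (Laplacian ?\<Omega> u) u) \<longlonglongrightarrow> - L2_inner ?\<Omega> (Laplacian ?\<Omega> u) u"
    by (intro tendsto_minus cosine_Parseval[OF ab W uL(1)])
  also have "- L2_inner ?\<Omega> (Laplacian ?\<Omega> u) u = - L2_inner ?\<Omega> (Laplacian ?\<Omega> u) U"
    using L2_inner_cong_AE[OF W _ uL(1) uU] by simp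
  also have "\<dots> = (L2_norm ?\<Omega> V)\<^sup>2" using neumann_energy[OF ab r] by simp
  also have "L2_norm ?\<Omega> V = L2_norm ?\<Omega> (D ?\<Omega> u)"
    using L2_norm_cong_AE[OF uL(2) DV] by simp
  also have "(\<lambda>n. - cosine_product a b n (Laplacian ?\<Omega> u) u) =
      (\<lambda>n. \<Sum>p\<in>modes n. (real (fst p) * pi / (b - a))\<^sup>2 / mode_weight a b p * (cosine_coeff a b u p)\<^sup>2)"
    unfolding cosine_product_def co by (simp add: sum_negf[symmetric] power2_eq_square algebra_simps)
  finally show "(\<lambda>n. \<Sum>p\<in>modes n. (real (fst p) * pi / (b - a))\<^sup>2 / mode_weight a b p * (cosine_coeff a b u p)\<^sup>2)
      \<longlonglongrightarrow> (L2_norm ?\<Omega> (D ?\<Omega> u))\<^sup>2" .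
qed

lemma AE_Ioo_subset:
  assumes "AE t in lebesgue_on {a<..<b::real}. P t" "a \<le> s" "t \<le> b"
  shows "AE t in lebesgue_on {s<..<t}. P t"
proof -
  have "AE x in lebesgue. x \<in> {a<..<b} \<longrightarrow> P x" using assms(1) by (simp add: AE_restrict_space_iff)
  then have "AE x in lebesgue. x \<in> {s<..<t} \<longrightarrow> P x"
    by (rule eventually_mono) (use assms(2,3) in auto)
  then show ?thesis by (simp add: AE_restrict_space_iff)
qed

lemma bochner_L2_AE:
  assumes "u \<in> bochner_L2 X N I"
  shows "AE t in lebesgue_on I. u t \<in> X"
proof -
  obtain s where "simple_approx X N I s u" using assms unfolding bochner_L2_def by blast
  then have "AE t in lebesgue_on I. u t \<in> X \<and> (\<lambda>n. N (\<lambda>x. s n t x - u t x)) \<longlonglongrightarrow> 0"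
    unfolding simple_approx_def by blast
  then show ?thesis by (rule eventually_mono) simp
qed

text \<open>
  Formally the derivative of the energy is \<open>- 2 * L2_inner \<Omega> (Laplacian \<Omega> (y t)) (z t)\<close>, but \<open>z t\<close> is only square
  integrable in space.  Every Fourier coefficient of \<open>y\<close> is absolutely continuous in time, which gives the identity for the
  partial sums of the energy.  The partial sums of the right-hand side have the integrable majorant
  \<open>(H2_norm \<Omega> (y t))\<^sup>2 + (L2_norm \<Omega> (z t))\<^sup>2\<close>, and the limit may be taken at all times at which \<open>y\<close> lies in the domain
  of the Neumann Laplacian.
\<close>

lemma Dirichlet_energy_antimono:
  assumes ab: "a < b" and c: "cont_into (H1 {a<..<b}) (H1_norm {a<..<b}) {0..T} y"
    and y: "y \<in> bochner_L2 (neumann_domain {a<..<b}) (H2_norm {a<..<b}) {0<..<T}"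
    and z: "z \<in> bochner_L2 (L2 {a<..<b}) (L2_norm {a<..<b}) {0<..<T}"
    and yz: "weak_time_deriv {a<..<b} {0<..<T} y z"
    and sign: "AE t in lebesgue_on {0<..<T}. 0 \<le> L2_inner {a<..<b} (Laplacian {a<..<b} (y t)) (z t)"
    and s: "0 < s" "y s \<in> neumann_domain {a<..<b}" and t: "t < T" "y t \<in> neumann_domain {a<..<b}" and st: "s \<le> t"
  shows "L2_norm {a<..<b} (D {a<..<b} (y t)) \<le> L2_norm {a<..<b} (D {a<..<b} (y s))"
proof -
  let ?\<Omega> = "{a<..<b}" and ?J = "lebesgue_on {s<..<t}"
  let ?W = "\<lambda>\<sigma>. Laplacian ?\<Omega> (y \<sigma>)"
  have T: "0 < T" using s t st by simp
  define Y Z where "Y p \<sigma> = cosine_coeff a b (y \<sigma>) p" and "Z p \<sigma> = cosine_coeff a b (z \<sigma>) p" for p \<sigma>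
  define \<mu> where "\<mu> p = (real (fst p) * pi / (b - a))\<^sup>2 / mode_weight a b p" for p
  have YZ: "Y p \<sigma> = Y p 0 + integral {0..\<sigma>} (Z p)" if "\<sigma> \<in> {0..T}" for p \<sigma>
    unfolding Y_def Z_def cosine_coeff_def
    by (rule weak_time_deriv_inner_primitive[OF T c z yz cosine_mode_L2[OF ab] that])
  have ZT: "integrable (lebesgue_on {0<..<T}) (Z p)" for p
    unfolding Z_def cosine_coeff_def by (rule bochner_L2_inner_integrable[OF z cosine_mode_L2[OF ab]])
  have Zi: "integrable ?J (Z p)" for p
    by (rule integrable_Ioo_subset[OF ZT]) (use s t in auto)
  \<comment> \<open>the representation as a primitive, restarted at the time \<open>s\<close>\<close>
  have YZs: "Y p \<sigma> = Y p s + integral {s..\<sigma>} (Z p)" if "\<sigma> \<in> {s..t}" for p \<sigma>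
  proof -
    have "Z p absolutely_integrable_on {0..\<sigma>}"
      using integrable_Ioo_subset[OF ZT[of p], of 0 \<sigma>] that t by (simp add: integrable_Ioo_iff)
    then have "Z p integrable_on {0..\<sigma>}" by (rule set_lebesgue_integral_eq_integral(1))
    then have "integral {0..s} (Z p) + integral {s..\<sigma>} (Z p) = integral {0..\<sigma>} (Z p)"
      using that s by (intro Henstock_Kurzweil_Integration.integral_combine) auto
    then show ?thesis using YZ[of s p] YZ[of \<sigma> p] that s t by auto
  qed
  have Yc: "continuous_on {s..t} (Y p)" for p
    unfolding Y_def cosine_coeff_def
    by (rule continuous_on_subset[OF cont_into_L2_inner[OF c cosine_mode_L2[OF ab]]]) (use s t in auto)
  have YZi: "integrable ?J (\<lambda>\<sigma>. Y p \<sigma> * Z p \<sigma>)" for p by (rule integrable_mult_continuous[OF Zi Yc])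
  have square: "(Y p t)\<^sup>2 - (Y p s)\<^sup>2 = 2 * (LINT \<sigma>|?J. Y p \<sigma> * Z p \<sigma>)" for p
    using integration_by_parts_primitives[OF st Zi Zi YZs YZs, of p p] by (simp add: power2_eq_square mult.commute)
  define F where "F n \<sigma> = (\<Sum>p\<in>modes n. \<mu> p * (Y p \<sigma> * Z p \<sigma>))" for n \<sigma>
  have Fi: "integrable ?J (F n)" for n unfolding F_def using YZi by (intro Bochner_Integration.integrable_sum) auto
  have diff: "(\<Sum>p\<in>modes n. \<mu> p * (Y p t)\<^sup>2) - (\<Sum>p\<in>modes n. \<mu> p * (Y p s)\<^sup>2) = 2 * (LINT \<sigma>|?J. F n \<sigma>)" for n
  proof -
    have "(LINT \<sigma>|?J. F n \<sigma>) = (\<Sum>p\<in>modes n. \<mu> p * (LINT \<sigma>|?J. Y p \<sigma> * Z p \<sigma>))"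
      unfolding F_def using YZi by simp
    then show ?thesis
      by (simp add: sum_subtractf[symmetric] right_diff_distrib[symmetric] square sum_distrib_left mult.left_commute)
  qed
  have yAE: "AE \<sigma> in ?J. y \<sigma> \<in> neumann_domain ?\<Omega>"
    by (rule AE_Ioo_subset[OF bochner_L2_AE[OF y]]) (use s t in auto)
  have zAE: "AE \<sigma> in ?J. z \<sigma> \<in> L2 ?\<Omega>"
    by (rule AE_Ioo_subset[OF bochner_L2_AE[OF z]]) (use s t in auto)
  have signJ: "AE \<sigma> in ?J. 0 \<le> L2_inner ?\<Omega> (?W \<sigma>) (z \<sigma>)"
    by (rule AE_Ioo_subset[OF sign]) (use s t in auto)
  have FW: "F n \<sigma> = - cosine_product a b n (?W \<sigma>) (z \<sigma>)" if "y \<sigma> \<in> neumann_domain ?\<Omega>" for n \<sigma>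
    unfolding F_def cosine_product_def Dirichlet_energy_cosine(2)[OF ab that] Y_def Z_def \<mu>_def
    by (simp add: sum_negf[symmetric] algebra_simps)
  have lim: "AE \<sigma> in ?J. (\<lambda>n. F n \<sigma>) \<longlonglongrightarrow> - L2_inner ?\<Omega> (?W \<sigma>) (z \<sigma>)"
    using yAE zAE
  proof (elim AE_mp, intro AE_I2 impI)
    fix \<sigma> assume "y \<sigma> \<in> neumann_domain ?\<Omega>" "z \<sigma> \<in> L2 ?\<Omega>"
    then show "(\<lambda>n. F n \<sigma>) \<longlonglongrightarrow> - L2_inner ?\<Omega> (?W \<sigma>) (z \<sigma>)"
      unfolding FW[OF \<open>y \<sigma> \<in> neumann_domain ?\<Omega>\<close>]
      by (intro tendsto_minus cosine_Parseval[OF ab] Dirichlet_energy_cosine(1)[OF ab])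
  qed
  define w where "w \<sigma> = (H2_norm ?\<Omega> (y \<sigma>))\<^sup>2 + (L2_norm ?\<Omega> (z \<sigma>))\<^sup>2" for \<sigma>
  have "integrable (lebesgue_on {0<..<T}) w"
    using y z unfolding w_def bochner_L2_def by simp
  then have wi: "integrable ?J w" by (rule integrable_Ioo_subset) (use s t in auto)
  have bound: "AE \<sigma> in ?J. norm (F n \<sigma>) \<le> w \<sigma>" for n
    using yAE zAE
  proof (elim AE_mp, intro AE_I2 impI)
    fix \<sigma> assume y\<sigma>: "y \<sigma> \<in> neumann_domain ?\<Omega>" and z\<sigma>: "z \<sigma> \<in> L2 ?\<Omega>"
    have "norm (F n \<sigma>) \<le> 2 * L2_norm ?\<Omega> (?W \<sigma>) * L2_norm ?\<Omega> (z \<sigma>)"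
      unfolding FW[OF y\<sigma>] using cosine_product_bound[OF ab Dirichlet_energy_cosine(1)[OF ab y\<sigma>] z\<sigma>] by simp
    also have "\<dots> \<le> (L2_norm ?\<Omega> (?W \<sigma>))\<^sup>2 + (L2_norm ?\<Omega> (z \<sigma>))\<^sup>2" by (rule sum_squares_bound)
    also have "\<dots> \<le> w \<sigma>" by (simp add: w_def H2_norm_def)
    finally show "norm (F n \<sigma>) \<le> w \<sigma>" .
  qed
  have "(\<lambda>n. LINT \<sigma>|?J. F n \<sigma>) \<longlonglongrightarrow> (LINT \<sigma>|?J. - L2_inner ?\<Omega> (?W \<sigma>) (z \<sigma>))"
  proof (rule integral_dominated_convergence[OF _ _ wi lim bound])
    show "(\<lambda>\<sigma>. - L2_inner ?\<Omega> (?W \<sigma>) (z \<sigma>)) \<in> borel_measurable ?J"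
      by (rule borel_measurable_AE_limit[OF _ _ lim]) (use Fi in auto)
  qed (use Fi in auto)
  then have "(\<lambda>n. 2 * (LINT \<sigma>|?J. F n \<sigma>)) \<longlonglongrightarrow> 2 * (LINT \<sigma>|?J. - L2_inner ?\<Omega> (?W \<sigma>) (z \<sigma>))"
    by (rule tendsto_mult_left)
  moreover have "(\<lambda>n. (\<Sum>p\<in>modes n. \<mu> p * (Y p t)\<^sup>2) - (\<Sum>p\<in>modes n. \<mu> p * (Y p s)\<^sup>2)) \<longlonglongrightarrow>
      (L2_norm ?\<Omega> (D ?\<Omega> (y t)))\<^sup>2 - (L2_norm ?\<Omega> (D ?\<Omega> (y s)))\<^sup>2"
    unfolding \<mu>_def Y_def by (intro tendsto_diff Dirichlet_energy_cosine(3)[OF ab] s t)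
  ultimately have "(L2_norm ?\<Omega> (D ?\<Omega> (y t)))\<^sup>2 - (L2_norm ?\<Omega> (D ?\<Omega> (y s)))\<^sup>2 = 2 * (LINT \<sigma>|?J. - L2_inner ?\<Omega> (?W \<sigma>) (z \<sigma>))"
    unfolding diff using LIMSEQ_unique by blast
  also have "\<dots> \<le> 0"
  proof -
    have "0 \<le> (LINT \<sigma>|?J. L2_inner ?\<Omega> (?W \<sigma>) (z \<sigma>))" by (rule integral_nonneg_AE[OF signJ])
    then show ?thesis by simp
  qed
  finally have "(L2_norm ?\<Omega> (D ?\<Omega> (y t)))\<^sup>2 \<le> (L2_norm ?\<Omega> (D ?\<Omega> (y s)))\<^sup>2" by simp
  then show ?thesis by (rule power2_le_imp_le) (rule L2_norm_nonneg)
qed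

section \<open>Convergence to the equilibrium\<close>

lemma AE_Ioo_witness:
  assumes "AE t in lebesgue_on {a<..<b::real}. P t" "a \<le> p" "p < q" "q \<le> b"
  obtains t where "p < t" "t < q" "P t"
proof -
  have ae: "AE t in lebesgue_on {p<..<q}. P t" by (rule AE_Ioo_subset[OF assms(1,2,4)])
  have "\<exists>t. p < t \<and> t < q \<and> P t"
  proof (rule ccontr)
    assume no: "\<not> (\<exists>t. p < t \<and> t < q \<and> P t)"
    have "AE t in lebesgue_on {p<..<q}. (1 :: real) = 0"
      by (rule AE_mp[OF ae], intro AE_I2 impI) (use no in auto)
    then have "(1 :: real) = 0"
      using continuous_AE_eq_0[of p q "\<lambda>_. 1 :: real" p] assms(3) by simp
    then show False by simp
  qed
  then show thesis using that by blast
qed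

lemma antimono_if_AE_antimono:
  fixes g :: "real \<Rightarrow> real"
  assumes g: "continuous_on {0..T} g" and ae: "AE t in lebesgue_on {0<..<T}. P t"
    and anti: "\<And>s t. 0 < s \<Longrightarrow> s \<le> t \<Longrightarrow> t < T \<Longrightarrow> P s \<Longrightarrow> P t \<Longrightarrow> g t \<le> g s"
    and st: "0 \<le> s" "s \<le> t" "t \<le> T"
  shows "g t \<le> g s"
proof (cases "s = t")
  case False
  with st have st': "s < t" by simp
  show ?thesis
  proof (rule field_le_epsilon)
    fix e :: real assume e: "e > 0"
    obtain d1 where d1: "d1 > 0" "\<And>r. r \<in> {0..T} \<Longrightarrow> dist r s < d1 \<Longrightarrow> dist (g r) (g s) < e / 2"
      using g st e unfolding continuous_on_iff by (metis atLeastAtMost_iff half_gt_zero order_trans)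
    obtain d2 where d2: "d2 > 0" "\<And>r. r \<in> {0..T} \<Longrightarrow> dist r t < d2 \<Longrightarrow> dist (g r) (g t) < e / 2"
      using g st e unfolding continuous_on_iff by (metis atLeastAtMost_iff half_gt_zero order_trans)
    obtain s' where s': "s < s'" "s' < min (s + d1) ((s + t) / 2)" "P s'"
      by (rule AE_Ioo_witness[OF ae, of s "min (s + d1) ((s + t) / 2)"]) (use d1 st st' in \<open>auto simp: min_def\<close>)
    obtain t' where t': "max (t - d2) ((s + t) / 2) < t'" "t' < t" "P t'"
      by (rule AE_Ioo_witness[OF ae, of "max (t - d2) ((s + t) / 2)" t]) (use d2 st st' in \<open>auto simp: max_def\<close>)
    have "g t' \<le> g s'" using s' t' st by (intro anti) auto
    moreover have "dist (g s') (g s) < e / 2" using s' t' st by (intro d1) (auto simp: dist_real_def)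
    moreover have "dist (g t') (g t) < e / 2" using s' t' st by (intro d2) (auto simp: dist_real_def)
    ultimately show "g t \<le> g s + e" unfolding dist_real_def abs_less_iff by linarith
  qed
qed simp

text \<open>
  Otherwise let \<open>\<tau>\<close> be the first time at which the value \<open>\<epsilon>\<close> is attained; the hypothesis then excludes this at \<open>\<tau>\<close>.
\<close>

lemma stays_below_threshold:
  fixes N :: "real \<Rightarrow> real"
  assumes N: "continuous_on {0..t} N" and 0: "N 0 < \<epsilon>" and t: "0 \<le> t"
    and step: "\<And>\<tau>. 0 < \<tau> \<Longrightarrow> \<tau> \<le> t \<Longrightarrow> (\<And>s. s \<in> {0..\<tau>} \<Longrightarrow> N s \<le> \<epsilon>) \<Longrightarrow> N \<tau> < \<epsilon>"
  shows "N t < \<epsilon>"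
proof (rule ccontr)
  assume "\<not> N t < \<epsilon>"
  then have Nt: "\<epsilon> \<le> N t" by simp
  define S where "S = {s \<in> {0..t}. N s = \<epsilon>}"
  have ivt: "\<exists>r\<in>{0..s}. N r = \<epsilon>" if "s \<in> {0..t}" "\<epsilon> \<le> N s" for s
    using IVT'[of N 0 \<epsilon> s] that 0 continuous_on_subset[OF N, of "{0..s}"] by auto
  have "S \<noteq> {}" using ivt[of t] Nt t by (auto simp: S_def)
  moreover have "compact S"
  proof -
    have "closed S"
      unfolding S_def by (rule continuous_closed_preimage_constant[OF N]) simp
    moreover have "bounded S"
      by (rule bounded_subset[OF bounded_closed_interval[of 0 t]]) (auto simp: S_def)
    ultimately show ?thesis by (simp add: compact_eq_bounded_closed)
  qed
  ultimately obtain \<tau> where \<tau>: "\<tau> \<in> S" "\<And>s. s \<in> S \<Longrightarrow> \<tau> \<le> s"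
    using compact_attains_inf by metis
  have "N s \<le> \<epsilon>" if "s \<in> {0..\<tau>}" for s
  proof (rule ccontr)
    assume "\<not> N s \<le> \<epsilon>"
    moreover have "s \<in> {0..t}" using that \<tau>(1) by (auto simp: S_def)
    ultimately obtain r where "r \<in> {0..s}" "N r = \<epsilon>" using ivt[of s] by auto
    then have "s = \<tau>" using \<tau>(2)[of r] that \<tau>(1) by (auto simp: S_def)
    then show False using \<open>\<not> N s \<le> \<epsilon>\<close> \<tau>(1) by (simp add: S_def)
  qed
  moreover have "0 < \<tau>" using \<tau>(1) 0 by (cases "\<tau> = 0") (auto simp: S_def)
  ultimately have "N \<tau> < \<epsilon>" using \<tau>(1) by (intro step) (auto simp: S_def)
  then show False using \<tau>(1) by (simp add: S_def)
qed

text \<open>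
  The two monotone quantities of the flow, available as long as the solution stays near \<open>\<zeta>\<close>.
\<close>

lemma LLG_Lyapunov:
  fixes a b \<alpha> \<beta> k T :: real
  assumes ab: "a < b" and \<alpha>: "\<alpha> > 0" and \<beta>: "\<beta> > 0" and k: "k = 2 * max 1 (1 / sqrt (b - a))"
    and \<zeta>: "\<zeta> \<in> {zeta_plus, zeta_minus}" and sol: "LLG_solution {a<..<b} \<alpha> \<beta> y\<^sub>0 y" and T: "0 < T"
    and small: "\<And>t. t \<in> {0..T} \<Longrightarrow>
      H1_norm {a<..<b} (\<lambda>x. y t x - \<zeta>) \<le> 1 / (2 * k\<^sup>2 * sqrt (b - a)) * (\<alpha> / (1 + 2 * \<alpha>))"
    and Nc: "continuous_on {0..T} (\<lambda>t. (H1_norm {a<..<b} (\<lambda>x. y t x - \<zeta>))\<^sup>2)"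
    and st: "0 \<le> s" "s \<le> t" "t \<le> T"
  shows "L2_norm {a<..<b} (D {a<..<b} (y t)) \<le> L2_norm {a<..<b} (D {a<..<b} (y s))"
    and "min (\<alpha> / 2) (\<alpha> * \<beta> / 4) * integral {s..t} (\<lambda>\<sigma>. (H1_norm {a<..<b} (\<lambda>x. y \<sigma> x - \<zeta>))\<^sup>2)
      \<le> L2_inner {a<..<b} (y t) (\<lambda>x. \<zeta>) - L2_inner {a<..<b} (y s) (\<lambda>x. \<zeta>)"
proof -
  let ?\<Omega> = "{a<..<b}" and ?M = "lebesgue_on {0<..<T}"
  let ?c = "min (\<alpha> / 2) (\<alpha> * \<beta> / 4)" and ?N = "\<lambda>\<sigma>. H1_norm ?\<Omega> (\<lambda>x. y \<sigma> x - \<zeta>)"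
  have solT: "cont_into (H1 ?\<Omega>) (H1_norm ?\<Omega>) {0..T} y"
    "y \<in> bochner_L2 (neumann_domain ?\<Omega>) (H2_norm ?\<Omega>) {0<..<T}"
    "\<exists>z\<in>bochner_L2 (L2 ?\<Omega>) (L2_norm ?\<Omega>) {0<..<T}. weak_time_deriv ?\<Omega> {0<..<T} y z \<and>
      (AE t in ?M. AE x in lebesgue_on ?\<Omega>. z t x = LLG_rhs \<alpha> \<beta> (y t x) (Laplacian ?\<Omega> (y t) x))"
    using sol T unfolding LLG_solution_def LLG_rhs_def by blast+
  then obtain z where z: "z \<in> bochner_L2 (L2 ?\<Omega>) (L2_norm ?\<Omega>) {0<..<T}" "weak_time_deriv ?\<Omega> {0<..<T} y z"
    "AE t in ?M. AE x in lebesgue_on ?\<Omega>. z t x = LLG_rhs \<alpha> \<beta> (y t x) (Laplacian ?\<Omega> (y t) x)"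
    by blast
  have unit: "AE x in lebesgue_on ?\<Omega>. norm (y t x) = 1" if "t \<ge> 0" for t
    using sol that unfolding LLG_solution_def by blast
  have yAE: "AE \<sigma> in ?M. y \<sigma> \<in> neumann_domain ?\<Omega>"
    by (rule bochner_L2_AE[OF solT(2)])
  have zAE: "AE \<sigma> in ?M. z \<sigma> \<in> L2 ?\<Omega>"
    by (rule bochner_L2_AE[OF z(1)])
  have dis: "AE \<sigma> in ?M. 0 \<le> L2_inner ?\<Omega> (Laplacian ?\<Omega> (y \<sigma>)) (z \<sigma>) \<and>
      ?c * (?N \<sigma>)\<^sup>2 \<le> L2_inner ?\<Omega> (z \<sigma>) (\<lambda>x. \<zeta>)"
    using yAE zAE z(3)
  proof (elim AE_mp, intro AE_I2 impI)
    fix \<sigma> assume \<sigma>: "\<sigma> \<in> space ?M" and y\<sigma>: "y \<sigma> \<in> neumann_domain ?\<Omega>" and z\<sigma>: "z \<sigma> \<in> L2 ?\<Omega>"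
      and eq: "AE x in lebesgue_on ?\<Omega>. z \<sigma> x = LLG_rhs \<alpha> \<beta> (y \<sigma> x) (Laplacian ?\<Omega> (y \<sigma>) x)"
    have "\<sigma> \<ge> 0" "\<sigma> \<in> {0..T}" using \<sigma> by auto
    then show "0 \<le> L2_inner ?\<Omega> (Laplacian ?\<Omega> (y \<sigma>)) (z \<sigma>) \<and> ?c * (?N \<sigma>)\<^sup>2 \<le> L2_inner ?\<Omega> (z \<sigma>) (\<lambda>x. \<zeta>)"
      using dissipation[OF ab \<alpha> \<beta> k \<zeta> y\<sigma> unit small z\<sigma> eq] by blast
  qed
  have sign: "AE \<sigma> in ?M. 0 \<le> L2_inner ?\<Omega> (Laplacian ?\<Omega> (y \<sigma>)) (z \<sigma>)"
    using dis by (rule eventually_mono) simp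
  show "L2_norm ?\<Omega> (D ?\<Omega> (y t)) \<le> L2_norm ?\<Omega> (D ?\<Omega> (y s))"
    by (rule antimono_if_AE_antimono[OF cont_into_L2_norm_D[OF ab solT(1)] yAE _ st])
      (rule Dirichlet_energy_antimono[OF ab solT(1,2) z(1,2) sign], auto)
  let ?Z = "\<lambda>\<sigma>. L2_inner ?\<Omega> (z \<sigma>) (\<lambda>x. \<zeta>)"
  have cL: "(\<lambda>x. \<zeta>) \<in> L2 ?\<Omega>" by (rule L2_continuous) simp
  have ZT: "integrable ?M ?Z" by (rule bochner_L2_inner_integrable[OF z(1) cL])
  have q: "L2_inner ?\<Omega> (y \<sigma>) (\<lambda>x. \<zeta>) = L2_inner ?\<Omega> (y 0) (\<lambda>x. \<zeta>) + integral {0..\<sigma>} ?Z" if "\<sigma> \<in> {0..T}" for \<sigma>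
    by (rule weak_time_deriv_inner_primitive[OF T solT(1) z(1,2) cL that])
  have Zst: "integrable (lebesgue_on {s<..<t}) ?Z" by (rule integrable_Ioo_subset[OF ZT st(1,3)])
  have "integrable (lebesgue_on {0<..<t}) ?Z" by (rule integrable_Ioo_subset[OF ZT]) (use st in auto)
  then have "?Z integrable_on {0..t}"
    unfolding integrable_Ioo_iff by (rule set_lebesgue_integral_eq_integral(1))
  then have "integral {0..s} ?Z + integral {s..t} ?Z = integral {0..t} ?Z"
    using st by (intro Henstock_Kurzweil_Integration.integral_combine) auto
  then have qst: "L2_inner ?\<Omega> (y t) (\<lambda>x. \<zeta>) - L2_inner ?\<Omega> (y s) (\<lambda>x. \<zeta>) = integral {s..t} ?Z"
    using q[of s] q[of t] st by auto
  have Nst: "continuous_on {s..t} (\<lambda>\<sigma>. (?N \<sigma>)\<^sup>2)" by (rule continuous_on_subset[OF Nc]) (use st in auto)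
  have Ni: "integrable (lebesgue_on {s<..<t}) (\<lambda>\<sigma>. (?N \<sigma>)\<^sup>2)" by (rule integrable_Ioo_continuous[OF Nst])
  have "?c * integral {s..t} (\<lambda>\<sigma>. (?N \<sigma>)\<^sup>2) = (LINT \<sigma>|lebesgue_on {s<..<t}. ?c * (?N \<sigma>)\<^sup>2)"
    using LINT_Ioo[OF Ni] by simp
  also have "\<dots> \<le> (LINT \<sigma>|lebesgue_on {s<..<t}. ?Z \<sigma>)"
  proof (rule integral_mono_AE)
    show "AE \<sigma> in lebesgue_on {s<..<t}. ?c * (?N \<sigma>)\<^sup>2 \<le> ?Z \<sigma>"
      by (rule AE_Ioo_subset[OF eventually_mono[OF dis]]) (use st in auto)
  qed (use Ni Zst in auto)
  also have "\<dots> = integral {s..t} ?Z" by (rule LINT_Ioo[OF Zst])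
  finally show "?c * integral {s..t} (\<lambda>\<sigma>. (?N \<sigma>)\<^sup>2) \<le> L2_inner ?\<Omega> (y t) (\<lambda>x. \<zeta>) - L2_inner ?\<Omega> (y s) (\<lambda>x. \<zeta>)"
    unfolding qst .
qed

text \<open>
  For unit vectors \<open>(norm (u - \<zeta>))\<^sup>2 = 2 * (1 - u \<bullet> \<zeta>)\<close>, so that the \<open>L2\<close> part of the distance is an affine function of
  \<open>u\<close>.  Its evolution therefore needs no chain rule.
\<close>

lemma H1_distance_of_unit_field:
  assumes ab: "a < b" and u: "u \<in> H1 {a<..<b}" and unit: "AE x in lebesgue_on {a<..<b}. norm (u x) = 1"
    and \<zeta>: "norm \<zeta> = 1"
  shows "(H1_norm {a<..<b} (\<lambda>x. u x - \<zeta>))\<^sup>2 =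
    2 * ((b - a) - L2_inner {a<..<b} u (\<lambda>x. \<zeta>)) + (L2_norm {a<..<b} (D {a<..<b} u))\<^sup>2"
    and "\<bar>L2_inner {a<..<b} u (\<lambda>x. \<zeta>)\<bar> \<le> b - a"
proof -
  let ?M = "lebesgue_on {a<..<b}"
  have cL: "(\<lambda>x. \<zeta>) \<in> L2 {a<..<b}" by (rule L2_continuous) simp
  have one: "(LINT x|?M. 1) = b - a"
    using LINT_Ioo[OF integrable_Ioo_continuous[of a b "\<lambda>_. 1::real"]] ab by simp
  have n2: "(L2_norm {a<..<b} (\<lambda>x. \<zeta>))\<^sup>2 = b - a"
    using one \<zeta> by (simp add: L2_norm_square L2_inner_def norm_eq_1)
  have "(L2_norm {a<..<b} u)\<^sup>2 = (LINT x|?M. (norm (u x))\<^sup>2)"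
    by (simp add: L2_norm_square L2_inner_def power2_norm_eq_inner)
  also have "\<dots> = (LINT x|?M. 1)"
    by (rule Bochner_Integration.integral_cong_AE)
      (use unit L2_square_integrable[OF H1_L2[OF u]] in \<open>auto elim: AE_mp\<close>)
  finally have n1: "(L2_norm {a<..<b} u)\<^sup>2 = b - a" using one by simp
  show "(H1_norm {a<..<b} (\<lambda>x. u x - \<zeta>))\<^sup>2 =
    2 * ((b - a) - L2_inner {a<..<b} u (\<lambda>x. \<zeta>)) + (L2_norm {a<..<b} (D {a<..<b} u))\<^sup>2"
    unfolding H1_norm_diff_const_square[OF ab u] L2_norm_diff_square[OF H1_L2[OF u] cL] n1 n2 by simp
  have "L2_norm {a<..<b} u = sqrt (b - a)" "L2_norm {a<..<b} (\<lambda>x. \<zeta>) = sqrt (b - a)"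
    using n1 n2 L2_norm_nonneg by (auto intro!: real_sqrt_unique[symmetric])
  then show "\<bar>L2_inner {a<..<b} u (\<lambda>x. \<zeta>)\<bar> \<le> b - a"
    using L2_Cauchy_Schwarz[OF H1_L2[OF u] cL] ab by simp
qed

theorem proposition7p2:
  fixes a b \<alpha> \<beta> k :: real
    and \<Omega> :: "real set"
    and y\<^sub>0 :: "real \<Rightarrow> real^3"
    and \<zeta> :: "real^3"
    and y :: "real \<Rightarrow> real \<Rightarrow> real^3"
  assumes "a < b" and "\<Omega> = {a<..<b}"
    and "\<alpha> > 0" and "\<beta> > 0"
    and "k = 2 * max 1 (1 / sqrt (b - a))"
    and "y\<^sub>0 \<in> H1 \<Omega>" and "\<forall>x\<in>\<Omega>. norm (y\<^sub>0 x) = 1"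
    and "\<zeta> \<in> {zeta_plus, zeta_minus}"
    and "H1_norm \<Omega> (\<lambda>x. y\<^sub>0 x - \<zeta>) < 1 / (2 * k\<^sup>2 * sqrt (b - a)) * (\<alpha> / (1 + 2 * \<alpha>))"
    and "LLG_solution \<Omega> \<alpha> \<beta> y\<^sub>0 y"
  shows "((\<lambda>t. H1_norm \<Omega> (\<lambda>x. y t x - \<zeta>)) \<longlongrightarrow> 0) at_top"
proof -
  note ab = assms(1)
  have sol: "LLG_solution {a<..<b} \<alpha> \<beta> y\<^sub>0 y" using assms by simp
  define N where "N t = H1_norm {a<..<b} (\<lambda>x. y t x - \<zeta>)" for t
  define g where "g t = L2_norm {a<..<b} (D {a<..<b} (y t))" for t
  define q where "q t = L2_inner {a<..<b} (y t) (\<lambda>x. \<zeta>)" for t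
  define \<epsilon> where "\<epsilon> = 1 / (2 * k\<^sup>2 * sqrt (b - a)) * (\<alpha> / (1 + 2 * \<alpha>))"
  define c where "c = min (\<alpha> / 2) (\<alpha> * \<beta> / 4)"
  have c: "c > 0" using assms by (simp add: c_def)
  have N0: "N t \<ge> 0" for t by (simp add: N_def H1_norm_def)
  have cont: "cont_into (H1 {a<..<b}) (H1_norm {a<..<b}) {0..T} y" if "T > 0" for T
    using sol that unfolding LLG_solution_def by blast
  have yH: "y t \<in> H1 {a<..<b}" if "t \<ge> 0" for t
    using cont[of "t + 1"] that by (auto simp: cont_into_def)
  have unit: "AE x in lebesgue_on {a<..<b}. norm (y t x) = 1" if "t \<ge> 0" for t
    using sol that unfolding LLG_solution_def by blast
  note dist = H1_distance_of_unit_field[OF ab yH unit norm_zeta[OF assms(8)]]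
  have N2: "(N t)\<^sup>2 = 2 * ((b - a) - q t) + (g t)\<^sup>2" and q_le: "\<bar>q t\<bar> \<le> b - a" if "t \<ge> 0" for t
    using dist[OF that that] unfolding N_def q_def g_def by auto
  have cL: "(\<lambda>x. \<zeta>) \<in> L2 {a<..<b}" by (rule L2_continuous) simp
  have N2c: "continuous_on {0..T} (\<lambda>t. (N t)\<^sup>2)" if "T > 0" for T
  proof -
    have "continuous_on {0..T} (\<lambda>t. 2 * ((b - a) - q t) + (g t)\<^sup>2)"
      unfolding q_def g_def
      by (intro continuous_intros cont_into_L2_inner[OF cont[OF that] cL] cont_into_L2_norm_D[OF ab cont[OF that]])
    then show ?thesis by (rule continuous_on_eq) (simp add: N2)
  qed
  have Nc: "continuous_on {0..T} N" if "T > 0" for T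
    using continuous_on_real_sqrt[OF N2c[OF that]] N0 by simp
  have Lyapunov: "g t \<le> g s" "c * integral {s..t} (\<lambda>\<sigma>. (N \<sigma>)\<^sup>2) \<le> q t - q s" "N t \<le> N s"
    if T: "T > 0" and small: "\<And>t. t \<in> {0..T} \<Longrightarrow> N t \<le> \<epsilon>" and st: "0 \<le> s" "s \<le> t" "t \<le> T" for s t T
  proof -
    note L = LLG_Lyapunov[OF ab assms(3,4,5,8) sol T small[unfolded N_def \<epsilon>_def] N2c[OF T, unfolded N_def] st]
    show 1: "g t \<le> g s" and 2: "c * integral {s..t} (\<lambda>\<sigma>. (N \<sigma>)\<^sup>2) \<le> q t - q s"
      using L unfolding g_def q_def N_def c_def by auto
    have "0 \<le> integral {s..t} (\<lambda>\<sigma>. (N \<sigma>)\<^sup>2)"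
      using st by (intro integral_nonneg integrable_continuous_real continuous_on_subset[OF N2c[OF T]]) auto
    then have "q s \<le> q t" using 2 c by (smt (verit) mult_nonneg_nonneg)
    moreover have "(g t)\<^sup>2 \<le> (g s)\<^sup>2" using 1 by (intro power_mono) (auto simp: g_def L2_norm_nonneg)
    ultimately have "(N t)\<^sup>2 \<le> (N s)\<^sup>2" using N2[of t] N2[of s] st by simp
    then show "N t \<le> N s" using N0 by (rule power2_le_imp_le)
  qed
  have start: "N 0 < \<epsilon>"
  proof -
    have y0: "y\<^sub>0 \<in> H1 {a<..<b}" using assms by simp
    have eq: "AE x in lebesgue_on {a<..<b}. y 0 x = y\<^sub>0 x" using sol unfolding LLG_solution_def by blast
    have "L2_norm {a<..<b} (\<lambda>x. y 0 x - \<zeta>) = L2_norm {a<..<b} (\<lambda>x. y\<^sub>0 x - \<zeta>)"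
      by (rule L2_norm_cong_AE[OF L2_diff[OF H1_L2[OF yH] cL]]) (use eq in auto)
    moreover have "L2_norm {a<..<b} (D {a<..<b} (y 0)) = L2_norm {a<..<b} (D {a<..<b} y\<^sub>0)"
      by (rule L2_norm_cong_AE[OF H1_D(1)[OF yH] D_cong_AE[OF ab yH y0 eq]]) auto
    ultimately have "(N 0)\<^sup>2 = (H1_norm {a<..<b} (\<lambda>x. y\<^sub>0 x - \<zeta>))\<^sup>2"
      unfolding N_def H1_norm_diff_const_square[OF ab yH[OF order_refl]] H1_norm_diff_const_square[OF ab y0] by simp
    then have "N 0 = H1_norm {a<..<b} (\<lambda>x. y\<^sub>0 x - \<zeta>)"
      by (rule power2_eq_imp_eq) (simp_all add: N0 H1_norm_def)
    then show ?thesis using assms by (simp add: \<epsilon>_def)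
  qed
  have small: "N t \<le> \<epsilon>" if t: "t \<ge> 0" for t
  proof (cases "t = 0")
    case False
    with t have t: "t > 0" by simp
    have "N t < \<epsilon>"
    proof (rule stays_below_threshold[OF Nc[OF t] start])
      fix \<tau> assume "0 < \<tau>" "\<tau> \<le> t" and "\<And>s. s \<in> {0..\<tau>} \<Longrightarrow> N s \<le> \<epsilon>"
      then have "N \<tau> \<le> N 0" by (intro Lyapunov(3)[of \<tau>]) auto
      then show "N \<tau> < \<epsilon>" using start by simp
    qed (use t in simp)
    then show ?thesis by simp
  qed (use start in simp)
  have decay: "N t \<le> sqrt (2 * (b - a) / (c * t))" if t: "t > 0" for t
  proof -
    \<comment> \<open>\<open>N\<close> does not increase, so that its last value bounds its mean from below\<close>
    have "(N t)\<^sup>2 * t = integral {0..t} (\<lambda>\<sigma>. (N t)\<^sup>2)" using t by simp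
    also have "\<dots> \<le> integral {0..t} (\<lambda>\<sigma>. (N \<sigma>)\<^sup>2)"
    proof (rule integral_le)
      show "(\<lambda>\<sigma>. (N \<sigma>)\<^sup>2) integrable_on {0..t}" by (rule integrable_continuous_real[OF N2c[OF t]])
      fix \<sigma> assume "\<sigma> \<in> {0..t}"
      then have "N t \<le> N \<sigma>" using small t by (intro Lyapunov(3)[of t]) auto
      then show "(N t)\<^sup>2 \<le> (N \<sigma>)\<^sup>2" by (rule power_mono[OF _ N0])
    qed (auto intro: integrable_continuous_real)
    finally have "c * ((N t)\<^sup>2 * t) \<le> c * integral {0..t} (\<lambda>\<sigma>. (N \<sigma>)\<^sup>2)" using c by simp
    also have "\<dots> \<le> q t - q 0" by (rule Lyapunov(2)[OF t]) (use small t in auto)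
    also have "\<dots> \<le> 2 * (b - a)" using q_le[of t] q_le[of 0] t by simp
    finally have "(N t)\<^sup>2 \<le> 2 * (b - a) / (c * t)" using c t by (simp add: field_simps)
    then show ?thesis by (rule real_le_rsqrt)
  qed
  have "((\<lambda>t. 2 * (b - a) / (c * t)) \<longlongrightarrow> 0) at_top"
    by (intro tendsto_divide_0[OF tendsto_const] filterlim_at_top_imp_at_infinity
        filterlim_tendsto_pos_mult_at_top[OF tendsto_const c filterlim_ident])
  then have "((\<lambda>t. sqrt (2 * (b - a) / (c * t))) \<longlongrightarrow> sqrt 0) at_top" by (rule tendsto_real_sqrt)
  then have lim: "((\<lambda>t. sqrt (2 * (b - a) / (c * t))) \<longlongrightarrow> 0) at_top" by simp
  have "(N \<longlongrightarrow> 0) at_top"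
  proof (rule tendsto_sandwich[OF _ _ tendsto_const lim])
    show "\<forall>\<^sub>F t in at_top. 0 \<le> N t" using N0 by simp
    show "\<forall>\<^sub>F t in at_top. N t \<le> sqrt (2 * (b - a) / (c * t))"
      using eventually_gt_at_top[of 0] by eventually_elim (rule decay)
  qed
  then show ?thesis using assms(2) by (simp add: N_def[abs_def])
qed

end
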